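(* Let $D\subset\mathbb{R}^n$ be a domain, $E=D\times\mathbb{R}^r$ the trivial vector bundle over $D$, and $1\le q\le n$. Let $\{g_j\}$ be a sequence of $C^2$ Riemannian metrics on $E$, each of which makes $(E,g_j)$ Nakano $q$-semipositive, and suppose $\{g_j\}$ increasingly converges to a $C^2$ Riemannian metric $g$ on $E$, i.e. $g_i\le g_j\le g$ for all $i\le j$. Then $(E,g)$ is Nakano $q$-semipositive.
   Context: A Riemannian metric on $E$ is a map $g:D\to\mathrm{Sym}^+_r(\mathbb{R})$; $g_i\le g_j$ means $g_j-g_i$ is positive semidefinite pointwise. For $E$-valued $q$-forms $\alpha=\sum_\tau(\sum_{|I|=q}\alpha_{I,\tau}dx_I)\otimes e_\tau$, $\langle\alpha,\beta\rangle_g=\sum_{\tau,\xi}\sum_I\alpha_{I,\tau}\beta_{I,\xi}g_{\tau\xi}$. The curvature operator of $g$ is $\Theta_E=-\sum_{i,j=1}^n\frac{\partial}{\partial x_i}\big(g^{-1}\frac{\partial g}{\partial x_j}\big)\,dx_i\wedge\big(\frac{\partial}{\partial x_j}\lrcorner\,\cdot\big)$ (matrix acting on fiber coefficients). $(E,g)$ is Nakano $q$-semipositive if $\langle\Theta_E\alpha,\alpha\rangle_g\ge0$ at every point of $D$ for every $E$-valued $q$-form $\alpha$. *)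

theory Defs
  imports "HOL-Analysis.Analysis"
begin

text \<open>Coordinates of R^n are indexed by a finite linearly ordered type 'n,
  fibre coordinates of E = D x R^r by a finite type 'r.  A metric on E is
  a map g :: real^'n => real^'r^'r (matrix-valued).\<close>

definition pd :: "'n::finite \<Rightarrow> (real^'n \<Rightarrow> 'b::real_normed_vector) \<Rightarrow> real^'n \<Rightarrow> 'b" where
  "pd j f x = vector_derivative (\<lambda>t. f (x + t *\<^sub>R axis j 1)) (at 0)"

definition has_pd :: "'n::finite \<Rightarrow> (real^'n \<Rightarrow> 'b::real_normed_vector) \<Rightarrow> real^'n \<Rightarrow> bool" where
  "has_pd j f x \<longleftrightarrow> (\<lambda>t. f (x + t *\<^sub>R axis j 1)) differentiable (at 0)"

definition C2_on :: "(real^'n::finite) set \<Rightarrow> (real^'n \<Rightarrow> 'b::real_normed_vector) \<Rightarrow> bool" where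
  "C2_on D f \<longleftrightarrow> continuous_on D f \<and>
     (\<forall>j. (\<forall>x\<in>D. has_pd j f x) \<and> continuous_on D (pd j f)) \<and>
     (\<forall>i j. (\<forall>x\<in>D. has_pd i (pd j f) x) \<and> continuous_on D (pd i (pd j f)))"

definition pos_def_sym :: "real^'r^'r \<Rightarrow> bool" where
  "pos_def_sym A \<longleftrightarrow> transpose A = A \<and> (\<forall>v. v \<noteq> 0 \<longrightarrow> v \<bullet> (A *v v) > 0)"

definition riem_metric :: "(real^'n::finite) set \<Rightarrow> (real^'n \<Rightarrow> real^'r^'r) \<Rightarrow> bool" where
  "riem_metric D g \<longleftrightarrow> (\<forall>x\<in>D. pos_def_sym (g x))"

definition metric_le :: "(real^'n::finite) set \<Rightarrow> (real^'n \<Rightarrow> real^'r^'r) \<Rightarrow> (real^'n \<Rightarrow> real^'r^'r) \<Rightarrow> bool" where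
  "metric_le D g1 g2 \<longleftrightarrow> (\<forall>x\<in>D. \<forall>v. v \<bullet> ((g2 x - g1 x) *v v) \<ge> 0)"

text \<open>E-valued q-forms at a point: alpha I = (alpha_{I,tau})_tau for an index set I
  (identified with the increasing multi-index), only |I| = q is relevant.
  Coefficient of dx_I in dx_i /\ (d/dx_j contracted with alpha).\<close>
definition wedge_contr :: "'n::{finite,linorder} \<Rightarrow> 'n \<Rightarrow> ('n set \<Rightarrow> real^'r) \<Rightarrow> 'n set \<Rightarrow> real^'r" where
  "wedge_contr i j a I =
     (if i \<in> I \<and> j \<notin> I - {i}
      then ((-1::real) ^ (card {k \<in> I - {i}. k < i} + card {k \<in> I - {i}. k < j}))
            *\<^sub>R a (insert j (I - {i}))
      else 0)"

definition curv_apply :: "((real,'n::{finite,linorder}) vec \<Rightarrow> real^'r^'r) \<Rightarrow> (real,'n) vec \<Rightarrow> ('n set \<Rightarrow> real^'r) \<Rightarrow> 'n set \<Rightarrow> real^'r" where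
  "curv_apply g x a I =
     - (\<Sum>i\<in>UNIV. \<Sum>j\<in>UNIV.
          pd i (\<lambda>y. matrix_inv (g y) ** pd j g y) x *v wedge_contr i j a I)"

definition form_inner :: "nat \<Rightarrow> real^'r^'r \<Rightarrow> ('n::finite set \<Rightarrow> real^'r) \<Rightarrow> ('n set \<Rightarrow> real^'r) \<Rightarrow> real" where
  "form_inner q G a b = (\<Sum>I\<in>{I. card I = q}. a I \<bullet> (G *v b I))"

definition nakano_q_semipos :: "nat \<Rightarrow> ((real,'n::{finite,linorder}) vec) set \<Rightarrow> ((real,'n) vec \<Rightarrow> real^'r^'r) \<Rightarrow> bool" where
  "nakano_q_semipos q D g \<longleftrightarrow>
     (\<forall>x\<in>D. \<forall>a::'n set \<Rightarrow> real^'r. form_inner q (g x) (curv_apply g x a) a \<ge> 0)"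

end

theory Submission
  imports Defs "HOL-Real_Asymp.Real_Asymp"
begin

text \<open>
  Suppose the curvature form of \<open>g\<close> is negative at \<open>x\<^sub>0\<close> on a \<open>q\<close>-form \<open>\<xi>\<close>. Following the \<open>L\<^sup>2\<close> method of
  Hoermander, every metric is multiplied by \<open>exp (- \<sigma> |x - x\<^sub>0|\<^sup>2)\<close>, which adds \<open>2 \<sigma> q\<close> to its curvature.
  Semipositivity of \<open>g\<^sub>j\<close> and the Bochner identity then give a solution of \<open>d u = \<xi>\<close> with
  \<open>2 \<sigma> q |u|\<^sup>2 \<le> |\<xi>|\<^sup>2\<close> in the norm of \<open>g\<^sub>j\<close>. This estimate contains no derivatives of the metric, so it passes to
  \<open>g\<close> up to a factor \<open>1 + \<eta>\<close>, because \<open>g\<^sub>j \<le> g \<le> (1 + \<eta>) g\<^sub>j\<close> on a compact cube for large \<open>j\<close>. Pairing \<open>d u = \<xi>\<close>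
  with a cutoff of \<open>\<xi>\<close> and applying the Bochner identity of \<open>g\<close> to it contradicts the negative
  curvature as \<open>\<sigma> \<rightarrow> \<infinity>\<close>, since the terms caused by the cutoff are exponentially small in \<open>\<sigma>\<close>.

  To avoid Sobolev spaces and boundary regularity, all forms are cochains on a cubical grid of mesh
  \<open>h\<close> in a cube around \<open>x\<^sub>0\<close>. There the existence theorem is finite-dimensional linear algebra, the flat
  faces of the cube contribute no boundary term, and the discrete curvature converges uniformly to
  that of the metric as \<open>h \<rightarrow> 0\<close>; the errors of the discretization are absorbed by the gradient term
  of the Bochner identity. The mesh is chosen last, after \<open>\<sigma>\<close>, \<open>\<eta>\<close> and \<open>j\<close>.
\<close>

section \<open>Matrices, signs and sums over index sets\<close>

text \<open>The curvature contains second derivatives of the metric, while monotone convergence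
  controls only its values; hence the detour through an estimate that mentions values alone. This
  estimate must be sharp in its leading constant: 2 \<sigma> q on one side meets (1 + \<eta>) (2
  \<sigma> q - c) on the other, so \<eta> has to tend to 0 at fixed \<sigma>, and only afterwards
  may \<sigma> grow. The cutoff is harmless because its differences live where |x - x0| >= R/4,
  whereas the mass of the test form is measured where |x - x0| <= R/8; the weight is at most
  exp(-\<sigma> R^2/16) in the first region and at least exp(-\<sigma> R^2/64) in the second, and
  the quotient decays faster than 1/\<sigma>. Sums over the grid carry no volume factor: all of them
  are compared with the number of grid points, which cancels, so the final inequality involves
  neither the mesh nor j. Constant coefficients of \<xi> make the right-hand side of d u = \<xi>
  exactly closed on the grid.\<close>

lemma norm_matrix_vector_le:
  fixes A :: "real^'n^'m"
  shows "norm (A *v x) \<le> norm A * norm x"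
proof -
  have "(norm (A *v x))\<^sup>2 = (\<Sum>i\<in>UNIV. (A $ i \<bullet> x)\<^sup>2)"
    by (simp add: norm_vec_def L2_set_def sum_nonneg matrix_mult_dot)
  also have "\<dots> \<le> (\<Sum>i\<in>UNIV. (norm (A $ i))\<^sup>2 * (norm x)\<^sup>2)"
    by (intro sum_mono) (metis Cauchy_Schwarz_ineq power2_norm_eq_inner)
  also have "\<dots> = (norm A * norm x)\<^sup>2"
    by (simp add: norm_vec_def[of A] L2_set_def sum_nonneg power_mult_distrib sum_distrib_right)
  finally show ?thesis
    by (rule power2_le_imp_le) simp
qed

lemma abs_inner_matrix_le:
  fixes A :: "real^'n^'m"
  shows "\<bar>u \<bullet> (A *v v)\<bar> \<le> norm A * norm u * norm v"
proof -
  have "\<bar>u \<bullet> (A *v v)\<bar> \<le> norm u * norm (A *v v)"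
    by (rule Cauchy_Schwarz_ineq2)
  also have "\<dots> \<le> norm u * (norm A * norm v)"
    by (intro mult_left_mono norm_matrix_vector_le) simp
  finally show ?thesis by (simp add: mult_ac)
qed

lemma bounded_bilinear_matrix_vector:
  "bounded_bilinear (\<lambda>(A::real^'n^'m) x. A *v x)"
  unfolding bilinear_conv_bounded_bilinear[symmetric] bilinear_def
  by (intro conjI allI linearI)
    (simp_all add: matrix_vector_mult_def vec_eq_iff sum.distrib distrib_right distrib_left
      sum_distrib_left mult_ac)

lemma matrix_add_rdistrib: "(A + B) ** C = A ** C + B ** (C :: real^'p^'n)"
  for A :: "real^'n^'m"
  by (simp add: matrix_matrix_mult_def vec_eq_iff sum.distrib distrib_right)

lemma matrix_diff_ldistrib: "A ** (B - C) = A ** B - A ** (C :: real^'p^'n)"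
  for A :: "real^'n^'m"
  by (simp add: matrix_matrix_mult_def vec_eq_iff sum_subtractf right_diff_distrib)

lemma matrix_diff_rdistrib: "(A - B) ** C = A ** C - B ** (C :: real^'p^'n)"
  for A :: "real^'n^'m"
  by (simp add: matrix_matrix_mult_def vec_eq_iff sum_subtractf left_diff_distrib)

lemma bounded_bilinear_matrix_matrix:
  "bounded_bilinear (\<lambda>(A::real^'n^'m) (B::real^'p^'n). A ** B)"
  unfolding bilinear_conv_bounded_bilinear[symmetric] bilinear_def
  by (intro conjI allI linearI)
    (simp_all add: matrix_matrix_mult_def vec_eq_iff sum.distrib distrib_right distrib_left
      sum_distrib_left mult_ac)

lemmas tendsto_matrix_vector = bounded_bilinear.tendsto[OF bounded_bilinear_matrix_vector]
lemmas tendsto_matrix_matrix = bounded_bilinear.tendsto[OF bounded_bilinear_matrix_matrix]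
lemmas continuous_on_matrix_vector = bounded_bilinear.continuous_on[OF bounded_bilinear_matrix_vector]
lemmas continuous_on_matrix_matrix = bounded_bilinear.continuous_on[OF bounded_bilinear_matrix_matrix]

lemma inner_symmetric_matrix:
  fixes A :: "real^'n^'n"
  assumes "transpose A = A"
  shows "u \<bullet> (A *v v) = v \<bullet> (A *v u)"
  by (metis assms dot_lmul_matrix inner_commute vector_transpose_matrix)

lemma invertible_matrix_inv:
  fixes A :: "real^'n^'n"
  assumes "invertible A"
  shows "A ** matrix_inv A = mat 1" "matrix_inv A ** A = mat 1"
  using someI_ex[OF assms[unfolded invertible_def]] unfolding matrix_inv_def by auto

lemma pos_def_sym_matrix_inv:
  fixes A :: "real^'n^'n"
  assumes "pos_def_sym A"
  shows "A ** matrix_inv A = mat 1" "matrix_inv A ** A = mat 1"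
proof -
  have "x = 0" if "A *v x = 0" for x
    using assms that unfolding pos_def_sym_def by (metis inner_zero_right less_irrefl)
  then have "invertible A"
    by (metis invertible_left_inverse matrix_left_invertible_ker)
  then show "A ** matrix_inv A = mat 1" "matrix_inv A ** A = mat 1"
    by (rule invertible_matrix_inv)+
qed

lemma pos_def_sym_inner_ge:
  assumes "pos_def_sym A" shows "v \<bullet> (A *v v) \<ge> 0"
  using assms unfolding pos_def_sym_def by (cases "v = 0") (auto simp: less_imp_le)

text \<open>The sign of sorting dx_i into dx_J when i is not in J. The two exponents in
  \<open>wedge_contr\<close> are those of \<open>isgn i (I - {i})\<close> and
  \<open>isgn j (I - {i})\<close>.\<close>

definition isgn :: "'n::linorder \<Rightarrow> 'n set \<Rightarrow> real" where
  "isgn i J = (-1) ^ card {k \<in> J. k < i}"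

lemma isgn_mult_self [simp]: "isgn i J * isgn i J = 1"
  by (simp add: isgn_def flip: power_mult_distrib)

lemma abs_isgn [simp]: "\<bar>isgn i J\<bar> = 1"
  by (simp add: isgn_def power_abs)

lemma isgn_insert:
  fixes J :: "'n::{finite,linorder} set"
  assumes "j \<notin> J"
  shows "isgn i (insert j J) = (if j < i then - isgn i J else isgn i J)"
proof -
  have "{k \<in> insert j J. k < i} = (if j < i then insert j {k \<in> J. k < i} else {k \<in> J. k < i})"
    by auto
  then show ?thesis using assms by (simp add: isgn_def)
qed

text \<open>Pairs (K, i) with i in K correspond to pairs (J, i) with i outside J through J = K -
  {i}. On the level of sums this is the duality of wedging with dx_i and contracting with d/dx_i; it
  makes \<open>d\<close> and \<open>\<delta>\<close> adjoint.\<close>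

lemma sum_subset_remove:
  fixes F :: "'n::finite \<Rightarrow> 'n set \<Rightarrow> 'a::comm_monoid_add"
  shows "(\<Sum>K\<in>UNIV. \<Sum>i\<in>K. F i (K - {i})) = (\<Sum>J\<in>UNIV. \<Sum>i\<in>-J. F i J)"
proof -
  have "(\<Sum>K\<in>UNIV. \<Sum>i\<in>K. F i (K - {i})) = (\<Sum>(K,i)\<in>Sigma UNIV (\<lambda>K. K). F i (K - {i}))"
    by (rule sum.Sigma) auto
  also have "\<dots> = (\<Sum>(J,i)\<in>Sigma UNIV uminus. F i J)"
    by (rule sum.reindex_bij_witness[where i = "\<lambda>(J,i). (insert i J, i)" and j = "\<lambda>(K,i). (K - {i}, i)"])
      auto
  also have "\<dots> = (\<Sum>J\<in>UNIV. \<Sum>i\<in>-J. F i J)"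
    by (rule sum.Sigma[symmetric]) auto
  finally show ?thesis .
qed

lemma sum_subset_insert:
  fixes F :: "'n::finite \<Rightarrow> 'n set \<Rightarrow> 'a::comm_monoid_add"
  shows "(\<Sum>J\<in>UNIV. \<Sum>i\<in>-J. F i (insert i J)) = (\<Sum>K\<in>UNIV. \<Sum>i\<in>K. F i K)"
  unfolding sum_subset_remove[symmetric, of "\<lambda>i J. F i (insert i J)"]
  by (intro sum.cong refl) (simp add: insert_absorb)

lemma sum_offdiag_swap:
  fixes f :: "'b \<Rightarrow> 'b \<Rightarrow> 'a::comm_monoid_add"
  assumes "finite A"
  shows "(\<Sum>j\<in>A. \<Sum>i\<in>A-{j}. f i j) = (\<Sum>i\<in>A. \<Sum>j\<in>A-{i}. f i j)"
proof -
  have "(\<Sum>j\<in>A. \<Sum>i\<in>A-{j}. f i j) = (\<Sum>j\<in>A. \<Sum>i | i \<in> A \<and> i \<noteq> j. f i j)"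
    by (rule sum.cong[OF refl], rule sum.cong) auto
  also have "\<dots> = (\<Sum>i\<in>A. \<Sum>j | j \<in> A \<and> i \<noteq> j. f i j)"
    using assms by (intro sum.swap_restrict)
  also have "\<dots> = (\<Sum>i\<in>A. \<Sum>j\<in>A-{i}. f i j)"
    by (rule sum.cong[OF refl], rule sum.cong) auto
  finally show ?thesis .
qed

text \<open>|d \<alpha>|^2 is a double sum over i, j in K and |\<delta> \<alpha>|^2 one over i, j
  outside J. The off-diagonal part is rewritten with J = K - {i, j}, so that the cross terms of both
  run over the same triples.\<close>

lemma sum_subset_pairs_insert:
  fixes F :: "'n::finite \<Rightarrow> 'n \<Rightarrow> 'n set \<Rightarrow> 'a::comm_monoid_add"
  shows "(\<Sum>K\<in>UNIV. \<Sum>i\<in>K. \<Sum>j\<in>K. F i j K) =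
    (\<Sum>J\<in>UNIV. \<Sum>i\<in>-J. F i i (insert i J)) +
    (\<Sum>J\<in>UNIV. \<Sum>i\<in>-J. \<Sum>j\<in>-J-{i}. F i j (insert i (insert j J)))"
proof -
  have "(\<Sum>K\<in>UNIV. \<Sum>i\<in>K. \<Sum>j\<in>K. F i j K) =
      (\<Sum>K\<in>UNIV. \<Sum>i\<in>K. F i i K) + (\<Sum>K\<in>UNIV. \<Sum>i\<in>K. \<Sum>j\<in>K-{i}. F i j K)"
    unfolding sum.distrib[symmetric] by (intro sum.cong refl) (simp add: sum.remove)
  also have "(\<Sum>K\<in>UNIV. \<Sum>i\<in>K. F i i K) = (\<Sum>J\<in>UNIV. \<Sum>i\<in>-J. F i i (insert i J))"
    by (rule sum_subset_insert[symmetric])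
  also have "(\<Sum>K\<in>UNIV. \<Sum>i\<in>K. \<Sum>j\<in>K-{i}. F i j K) =
      (\<Sum>J\<in>UNIV. \<Sum>i\<in>-J. \<Sum>j\<in>insert i J-{i}. F i j (insert i J))"
    by (rule sum_subset_insert[symmetric])
  also have "\<dots> = (\<Sum>J\<in>UNIV. \<Sum>i\<in>-J. \<Sum>j\<in>J. F i j (insert i J))"
    by (intro sum.cong refl) auto
  also have "\<dots> = (\<Sum>J\<in>UNIV. \<Sum>j\<in>J. \<Sum>i\<in>-J. F i j (insert i J))"
    by (rule sum.cong[OF refl], rule sum.swap)
  also have "\<dots> = (\<Sum>J\<in>UNIV. \<Sum>j\<in>-J. \<Sum>i\<in>-insert j J. F i j (insert i (insert j J)))"
    by (rule sum_subset_insert[symmetric, of "\<lambda>j K. \<Sum>i\<in>-K. F i j (insert i K)"])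
  also have "\<dots> = (\<Sum>J\<in>UNIV. \<Sum>j\<in>-J. \<Sum>i\<in>-J-{j}. F i j (insert i (insert j J)))"
    by (intro sum.cong refl) auto
  also have "\<dots> = (\<Sum>J\<in>UNIV. \<Sum>i\<in>-J. \<Sum>j\<in>-J-{i}. F i j (insert i (insert j J)))"
    by (rule sum.cong[OF refl], rule sum_offdiag_swap) simp
  finally show ?thesis .
qed

lemma sum_pairs_split:
  fixes F :: "'n::finite \<Rightarrow> 'n \<Rightarrow> 'n set \<Rightarrow> 'a::comm_monoid_add"
  shows "(\<Sum>J\<in>UNIV. \<Sum>i\<in>-J. \<Sum>j\<in>-J. F i j J) =
    (\<Sum>J\<in>UNIV. \<Sum>i\<in>-J. F i i J) + (\<Sum>J\<in>UNIV. \<Sum>i\<in>-J. \<Sum>j\<in>-J-{i}. F i j J)"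
  unfolding sum.distrib[symmetric] by (intro sum.cong refl) (simp add: sum.remove)

text \<open>Stated for functions on an index set because the finite-dimensional spaces of cochains below
  depend on a number of grid points and so do not form a type.\<close>

lemma riesz_finite_support:
  fixes b :: "('a \<Rightarrow> real) \<Rightarrow> ('a \<Rightarrow> real) \<Rightarrow> real" and l :: "('a \<Rightarrow> real) \<Rightarrow> real"
  assumes "finite S"
    and add: "\<And>x y z c. b x (\<lambda>i. y i + c * z i) = b x y + c * b x z"
    and sym: "\<And>x y. b x y = b y x"
    and pos: "\<And>x. (\<And>i. i \<notin> S \<Longrightarrow> x i = 0) \<Longrightarrow> b x x \<le> 0 \<Longrightarrow> x = (\<lambda>i. 0)"
    and lin: "\<And>y z c. l (\<lambda>i. y i + c * z i) = l y + c * l z"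
  shows "\<exists>x. (\<forall>i. i \<notin> S \<longrightarrow> x i = 0) \<and> (\<forall>y. (\<forall>i. i \<notin> S \<longrightarrow> y i = 0) \<longrightarrow> b x y = l y)"
  using assms(1) pos lin
proof (induction S arbitrary: l rule: finite_induct)
  case empty
  have zero: "y = (\<lambda>i. 0)" if "\<forall>i. i \<notin> {} \<longrightarrow> y i = (0::real)" for y :: "'a \<Rightarrow> real" using that by auto
  have "b (\<lambda>i. 0) (\<lambda>i. 0) = 0" using add[of "\<lambda>i. 0" "\<lambda>i. 0" 1 "\<lambda>i. 0"] by simp
  moreover have "l (\<lambda>i. 0) = 0" using empty(2)[of "\<lambda>i. 0" 1 "\<lambda>i. 0"] by simp
  ultimately show ?case using zero by (intro exI[of _ "\<lambda>i. 0"]) metis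
next
  case (insert a S)
  have posS: "x = (\<lambda>i. 0)" if "\<And>i. i \<notin> S \<Longrightarrow> x i = 0" "b x x \<le> 0" for x
    using insert.prems(1)[of x] that by blast
  define e where "e = (\<lambda>i. if i = a then 1 else 0 :: real)"
  obtain p where p: "\<forall>i. i \<notin> S \<longrightarrow> p i = 0" "\<forall>y. (\<forall>i. i \<notin> S \<longrightarrow> y i = 0) \<longrightarrow> b p y = b e y"
    using insert.IH[of "b e"] posS add by blast
  obtain x0 where x0: "\<forall>i. i \<notin> S \<longrightarrow> x0 i = 0" "\<forall>y. (\<forall>i. i \<notin> S \<longrightarrow> y i = 0) \<longrightarrow> b x0 y = l y"
    using insert.IH[of l] posS insert.prems(2) by blast
  \<comment> \<open>Gram-Schmidt: \<open>p\<close> represents b(e, .) on S, so \<open>w\<close> is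
    b-orthogonal to everything supported on S. The solution \<open>x0\<close> on S stays valid, and
    a multiple of \<open>w\<close> accounts for the new coordinate.\<close>
  define w where "w = (\<lambda>i. e i + (-1) * p i)"
  have wa: "w a = 1" using p(1) insert.hyps by (simp add: w_def e_def)
  have wS: "w i = 0" if "i \<notin> insert a S" for i using that p(1) by (simp add: w_def e_def)
  have bw: "b w w > 0"
    using insert.prems(1)[of w] wS wa by (metis linorder_not_less zero_neq_one)
  have orth: "b w y = 0" if "\<forall>i. i \<notin> S \<longrightarrow> y i = 0" for y
  proof -
    have "b y w = b y e + (-1) * b y p" unfolding w_def by (rule add)
    then show ?thesis using p(2) that sym by simp
  qed
  define x where "x = (\<lambda>i. x0 i + (l w / b w w) * w i)"
  have "b x y + b x0 w * y a = l y + b x0 w * y a" if y: "\<forall>i. i \<notin> insert a S \<longrightarrow> y i = 0" for y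
  proof -
    define y' where "y' = (\<lambda>i. y i + (- y a) * w i)"
    have y'S: "\<forall>i. i \<notin> S \<longrightarrow> y' i = 0"
    proof (intro allI impI)
      fix i assume "i \<notin> S"
      then show "y' i = 0" using y wa wS by (cases "i = a") (auto simp: y'_def)
    qed
    have yeq: "y = (\<lambda>i. y' i + y a * w i)" by (auto simp: y'_def)
    have 1: "b x y' = l y'"
    proof -
      have "b y' x = b y' x0 + (l w / b w w) * b y' w" unfolding x_def by (rule add)
      then show ?thesis using sym orth[OF y'S] x0(2) y'S by simp
    qed
    have 2: "b x w = l w"
    proof -
      have "b w x = b w x0 + (l w / b w w) * b w w" unfolding x_def by (rule add)
      then show ?thesis using sym orth[OF x0(1)] bw by simp
    qed
    have "b x y = b x y' + y a * b x w" using add[of x y' "y a" w] yeq by simp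
    also have "\<dots> = l y' + y a * l w" using 1 2 by simp
    also have "\<dots> = l y" using insert.prems(2)[of y' "y a" w] yeq by simp
    finally show ?thesis by simp
  qed
  moreover have "\<forall>i. i \<notin> insert a S \<longrightarrow> x i = 0" using x0(1) wS by (simp add: x_def)
  ultimately show ?case by (intro exI[of _ x]) simp
qed

section \<open>Cochains on a box and the discrete Bochner identity\<close>

text \<open>A cochain value \<open>\<alpha> k I\<close> belongs to the cube \<open>k + [0, h]\<^sup>I\<close>, which lies in the box exactly when
  \<open>k \<in> Box I\<close>. The index set is a discrete torus, so that shifts are bijections of \<open>X\<close>; its layers \<open>k i = 0\<close>
  carry no cochain values and keep the wrap-around from ever being felt.\<close>

locale lattice =
  fixes L :: int and h :: real and dummy :: "'n::{finite,linorder} itself"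
  assumes L: "L \<ge> 3" and h: "h > 0"
begin

definition X :: "('n \<Rightarrow> int) set" where
  "X = {k. \<forall>i. 0 \<le> k i \<and> k i < L}"

definition up :: "'n \<Rightarrow> ('n \<Rightarrow> int) \<Rightarrow> 'n \<Rightarrow> int" where
  "up i k = k(i := (k i + 1) mod L)"

definition dn :: "'n \<Rightarrow> ('n \<Rightarrow> int) \<Rightarrow> 'n \<Rightarrow> int" where
  "dn i k = k(i := (k i - 1) mod L)"

definition Box :: "'n set \<Rightarrow> ('n \<Rightarrow> int) set" where
  "Box I = {k. \<forall>i. 1 \<le> k i \<and> k i < (if i \<in> I then L - 1 else L)}"

definition cochain :: "nat \<Rightarrow> (('n \<Rightarrow> int) \<Rightarrow> 'n set \<Rightarrow> 'b::zero) \<Rightarrow> bool" where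
  "cochain q \<alpha> \<longleftrightarrow> (\<forall>k I. \<alpha> k I \<noteq> 0 \<longrightarrow> k \<in> Box I \<and> card I = q)"

definition D :: "'n \<Rightarrow> (('n \<Rightarrow> int) \<Rightarrow> 'b::real_vector) \<Rightarrow> ('n \<Rightarrow> int) \<Rightarrow> 'b" where
  "D i \<phi> k = (\<phi> (up i k) - \<phi> k) /\<^sub>R h"

text \<open>The truncation drops the cells that leave the box, where the difference would only see
  the cochain jump to zero. Thus \<open>d\<close> is free of boundary conditions and kills constant
  forms exactly (\<open>d_const\<close>); the extension by zero is left to its adjoint.\<close>

definition d :: "(('n \<Rightarrow> int) \<Rightarrow> 'n set \<Rightarrow> 'b::real_vector) \<Rightarrow> ('n \<Rightarrow> int) \<Rightarrow> 'n set \<Rightarrow> 'b" where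
  "d \<alpha> k K = (if k \<in> Box K then \<Sum>i\<in>K. isgn i (K - {i}) *\<^sub>R D i (\<lambda>k. \<alpha> k (K - {i})) k else 0)"

lemma X_PiE: "X = PiE UNIV (\<lambda>_. {0..<L})"
  by (auto simp: X_def PiE_UNIV_domain)

lemma finite_X [simp]: "finite X"
  unfolding X_PiE by (rule finite_PiE) auto

lemma card_X: "card X = nat L ^ CARD('n)"
  unfolding X_PiE by (simp add: card_PiE)

lemma Box_subset_X: "Box I \<subseteq> X"
proof
  fix k assume "k \<in> Box I"
  then have "1 \<le> k i \<and> k i < (if i \<in> I then L - 1 else L)" for i by (auto simp: Box_def)
  then show "k \<in> X" unfolding X_def by (smt (verit) mem_Collect_eq)
qed

lemma finite_Box [simp]: "finite (Box I)"
  using Box_subset_X finite_X by (rule finite_subset)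

lemma up_in_X [simp]: "k \<in> X \<Longrightarrow> up i k \<in> X"
  and dn_in_X [simp]: "k \<in> X \<Longrightarrow> dn i k \<in> X"
  using L by (auto simp: X_def up_def dn_def)

lemma dn_up [simp]: "k \<in> X \<Longrightarrow> dn i (up i k) = k"
  and up_dn [simp]: "k \<in> X \<Longrightarrow> up i (dn i k) = k"
  using L by (auto simp: X_def up_def dn_def fun_eq_iff mod_simps)

lemma dn_up_commute: "k \<in> X \<Longrightarrow> dn i (up j k) = up j (dn i k)"
  using L by (cases "i = j") (auto simp: up_def dn_def fun_eq_iff mod_simps)

lemma dn_dn_commute: "dn i (dn j k) = dn j (dn i k)"
  by (auto simp: dn_def fun_eq_iff)

lemma bij_up: "bij_betw (up i) X X"
  by (rule bij_betw_byWitness[where f' = "dn i"]) auto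

lemma sum_up: "(\<Sum>k\<in>X. f (up i k)) = (\<Sum>k\<in>X. f k)"
  by (rule sum.reindex_bij_betw[OF bij_up])

lemma cochain_zero: "cochain q \<alpha> \<Longrightarrow> k \<notin> Box I \<Longrightarrow> \<alpha> k I = 0"
  "cochain q \<alpha> \<Longrightarrow> card I \<noteq> q \<Longrightarrow> \<alpha> k I = 0"
  by (auto simp: cochain_def)

lemma Box_le: "k \<in> Box I \<Longrightarrow> 1 \<le> k i" "k \<in> Box I \<Longrightarrow> k i < L" "k \<in> Box I \<Longrightarrow> i \<in> I \<Longrightarrow> k i < L - 1"
  unfolding Box_def by (auto split: if_splits dest: spec[of _ i])

lemma BoxI: "(\<And>i. 1 \<le> k i \<and> k i < L \<and> (i \<in> I \<longrightarrow> k i < L - 1)) \<Longrightarrow> k \<in> Box I"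
  by (auto simp: Box_def)

lemma up_other: "j \<noteq> i \<Longrightarrow> up i k j = k j"
  by (simp add: up_def)

lemma up_no_wrap: "k \<in> Box I \<Longrightarrow> i \<in> I \<Longrightarrow> up i k = k(i := k i + 1)"
  using Box_le[of k I i] by (simp add: up_def fun_eq_iff)

lemma Box_insert_subset: "Box (insert i J) \<subseteq> Box J"
  by (rule subsetI, rule BoxI) (metis Box_le insertCI)

lemma up_in_Box:
  assumes "k \<in> Box (insert i J)" "i \<notin> J" shows "up i k \<in> Box J"
proof (rule BoxI)
  fix l
  have "up i k = k(i := k i + 1)" using up_no_wrap[OF assms(1)] by simp
  then show "1 \<le> up i k l \<and> up i k l < L \<and> (l \<in> J \<longrightarrow> up i k l < L - 1)"
    using assms Box_le[OF assms(1), of l] by (cases "l = i") auto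
qed

lemma up_in_Box': "k \<in> Box K \<Longrightarrow> i \<in> K \<Longrightarrow> up i k \<in> Box (K - {i})"
  using up_in_Box[of k i "K - {i}"] by (simp add: insert_absorb)

lemma Box_remove: "k \<in> Box K \<Longrightarrow> k \<in> Box (K - {i})"
  by (rule BoxI) (use Box_le[of k K] in auto)

lemma dn_in_Box: "dn i k \<in> Box (insert i J) \<Longrightarrow> k \<in> X \<Longrightarrow> i \<notin> J \<Longrightarrow> k \<in> Box J"
  using up_in_Box[of "dn i k" i J] by simp

text \<open>Where two difference quotients of tangential components are both nonzero, the truncation in \<open>d\<close>
  is inactive; this is why no boundary term appears in the Bochner identity.\<close>

lemma Box_insert2I:
  assumes "i \<noteq> j" "i \<notin> J" "j \<notin> J"
    and "k \<in> Box (insert j J) \<or> up i k \<in> Box (insert j J)"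
    and "k \<in> Box (insert i J) \<or> up j k \<in> Box (insert i J)"
  shows "k \<in> Box (insert i (insert j J))"
proof (rule BoxI)
  fix l
  have 1: "1 \<le> k l \<and> k l < L \<and> (l \<in> insert j J \<longrightarrow> k l < L - 1)" if "l \<noteq> i"
    using assms(4) Box_le[of _ "insert j J" l] up_other[OF that] by metis
  have 2: "1 \<le> k l \<and> k l < L \<and> (l \<in> insert i J \<longrightarrow> k l < L - 1)" if "l \<noteq> j"
    using assms(5) Box_le[of _ "insert i J" l] up_other[OF that] by metis
  show "1 \<le> k l \<and> k l < L \<and> (l \<in> insert i (insert j J) \<longrightarrow> k l < L - 1)"
    using 1 2 assms(1) by blast
qed

lemma D_add: "D i (\<lambda>k. f k + c *\<^sub>R g k) k = D i f k + c *\<^sub>R D i g k"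
  by (simp add: D_def algebra_simps)

lemma d_add: "d (\<lambda>k I. f k I + c *\<^sub>R g k I) k K = d f k K + c *\<^sub>R d g k K"
proof -
  have "(\<Sum>i\<in>K. isgn i (K - {i}) *\<^sub>R (D i (\<lambda>k. f k (K - {i})) k + c *\<^sub>R D i (\<lambda>k. g k (K - {i})) k)) =
    (\<Sum>i\<in>K. isgn i (K - {i}) *\<^sub>R D i (\<lambda>k. f k (K - {i})) k) +
    c *\<^sub>R (\<Sum>i\<in>K. isgn i (K - {i}) *\<^sub>R D i (\<lambda>k. g k (K - {i})) k)"
    by (simp add: scaleR_right_distrib sum.distrib scaleR_sum_right mult.commute)
  then show ?thesis by (simp add: d_def D_add)
qed

lemma cochain_d:
  assumes "cochain q \<alpha>" shows "cochain (Suc q) (d \<alpha>)"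
  unfolding cochain_def
proof (intro allI impI)
  fix k I assume ne: "d \<alpha> k I \<noteq> 0"
  then have k: "k \<in> Box I" by (auto simp: d_def split: if_splits)
  with ne obtain i where i: "i \<in> I" "D i (\<lambda>k. \<alpha> k (I - {i})) k \<noteq> 0"
    unfolding d_def by (auto elim: sum.not_neutral_contains_not_neutral)
  then have "\<alpha> (up i k) (I - {i}) \<noteq> 0 \<or> \<alpha> k (I - {i}) \<noteq> 0" by (auto simp: D_def)
  then have "card (I - {i}) = q" using assms unfolding cochain_def by blast
  then show "k \<in> Box I \<and> card I = Suc q" using k i(1)
    by (metis card.remove finite)
qed

lemma d_const:
  assumes "\<And>k I. k \<in> Box I \<Longrightarrow> f k I = \<xi> I"
  shows "d f k K = 0"
proof -
  have "D i (\<lambda>k. f k (K - {i})) k = 0" if "k \<in> Box K" "i \<in> K" for i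
    using that assms up_in_Box' Box_remove by (simp add: D_def)
  then show ?thesis by (simp add: d_def)
qed

end

section \<open>The codifferential of a fibre metric and the Bochner identity on the grid\<close>

locale metric_lattice = lattice L h dummy
  for L :: int and h :: real and dummy :: "'n::{finite,linorder} itself" +
  fixes G H :: "('n \<Rightarrow> int) \<Rightarrow> real^'r^'r"
  assumes G_sym: "k \<in> X \<Longrightarrow> u \<bullet> (G k *v v) = v \<bullet> (G k *v u)"
    and GH: "k \<in> X \<Longrightarrow> G k ** H k = mat 1"
    and HG: "k \<in> X \<Longrightarrow> H k ** G k = mat 1"
    and G_pos: "k \<in> X \<Longrightarrow> v \<noteq> 0 \<Longrightarrow> v \<bullet> (G k *v v) > 0"
begin

definition lip :: "(('n \<Rightarrow> int) \<Rightarrow> real^'r) \<Rightarrow> (('n \<Rightarrow> int) \<Rightarrow> real^'r) \<Rightarrow> real" where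
  "lip \<phi> \<psi> = (\<Sum>k\<in>X. \<phi> k \<bullet> (G k *v \<psi> k))"

definition ip :: "(('n \<Rightarrow> int) \<Rightarrow> 'n set \<Rightarrow> real^'r) \<Rightarrow> (('n \<Rightarrow> int) \<Rightarrow> 'n set \<Rightarrow> real^'r) \<Rightarrow> real" where
  "ip \<alpha> \<beta> = (\<Sum>I\<in>UNIV. lip (\<lambda>k. \<alpha> k I) (\<lambda>k. \<beta> k I))"

text \<open>The adjoint of \<open>D i\<close>. Since a cochain vanishes outside its box, the codifferential below needs no
  truncation, in contrast to \<open>d\<close>.\<close>

definition Ds :: "'n \<Rightarrow> (('n \<Rightarrow> int) \<Rightarrow> real^'r) \<Rightarrow> ('n \<Rightarrow> int) \<Rightarrow> real^'r" where
  "Ds i \<phi> k = (H k *v (G (dn i k) *v \<phi> (dn i k)) - \<phi> k) /\<^sub>R h"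

definition \<delta> :: "(('n \<Rightarrow> int) \<Rightarrow> 'n set \<Rightarrow> real^'r) \<Rightarrow> ('n \<Rightarrow> int) \<Rightarrow> 'n set \<Rightarrow> real^'r" where
  "\<delta> \<alpha> k J = (if k \<in> X then \<Sum>i\<in>-J. isgn i J *\<^sub>R Ds i (\<lambda>k. \<alpha> k (insert i J)) k else 0)"

text \<open>The transport matrix inside \<open>Ds i\<close>. For a sampled metric it is the identity
  minus h g^{-1} \<partial>_i g, up to terms of higher order in h.\<close>

definition A :: "'n \<Rightarrow> ('n \<Rightarrow> int) \<Rightarrow> real^'r^'r" where
  "A i k = H k ** G (dn i k)"

text \<open>One factor h belongs to \<open>D j\<close>, the other to the connection part of
  \<open>A i\<close>; so this approximates - \<partial>_j (g^{-1} \<partial>_i g), a coefficient of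
  the curvature operator.\<close>

definition C :: "'n \<Rightarrow> 'n \<Rightarrow> ('n \<Rightarrow> int) \<Rightarrow> real^'r^'r" where
  "C i j k = (A i (up j k) - A i k) /\<^sub>R h\<^sup>2"

lemma G_H_vec [simp]: "k \<in> X \<Longrightarrow> G k *v (H k *v v) = v"
  by (simp add: matrix_vector_mul_assoc GH)

lemma G_nonneg: "k \<in> X \<Longrightarrow> v \<bullet> (G k *v v) \<ge> 0"
  using G_pos[of k v] by (cases "v = 0") auto

lemma lip_sym: "lip \<phi> \<psi> = lip \<psi> \<phi>"
  unfolding lip_def using G_sym by (intro sum.cong) auto

lemma ip_sym: "ip \<alpha> \<beta> = ip \<beta> \<alpha>"
  unfolding ip_def using lip_sym by simp

lemma lip_add: "lip \<phi> (\<lambda>k. \<psi> k + c *\<^sub>R \<eta> k) = lip \<phi> \<psi> + c * lip \<phi> \<eta>"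
  by (simp add: lip_def matrix_vector_right_distrib matrix_vector_mult_scaleR inner_add_right
      sum.distrib sum_distrib_left)

lemma ip_add: "ip \<alpha> (\<lambda>k I. \<beta> k I + c *\<^sub>R \<gamma> k I) = ip \<alpha> \<beta> + c * ip \<alpha> \<gamma>"
  by (simp add: ip_def lip_add sum.distrib sum_distrib_left)

lemma lip_sum: "finite S \<Longrightarrow> lip \<phi> (\<lambda>k. \<Sum>i\<in>S. c i *\<^sub>R \<psi> i k) = (\<Sum>i\<in>S. c i * lip \<phi> (\<psi> i))"
proof (induction S rule: finite_induct)
  case empty show ?case by (simp add: lip_def)
next
  case (insert x F)
  then show ?case using lip_add[of \<phi> "\<lambda>k. \<Sum>i\<in>F. c i *\<^sub>R \<psi> i k" "c x" "\<psi> x"] by (simp add: add_ac)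
qed

lemma lip_sum_sum:
  assumes "finite S" "finite T"
  shows "lip (\<lambda>k. \<Sum>i\<in>S. c i *\<^sub>R \<phi> i k) (\<lambda>k. \<Sum>j\<in>T. e j *\<^sub>R \<psi> j k) =
    (\<Sum>i\<in>S. \<Sum>j\<in>T. c i * e j * lip (\<phi> i) (\<psi> j))"
proof -
  have "lip (\<lambda>k. \<Sum>i\<in>S. c i *\<^sub>R \<phi> i k) (\<psi> j) = (\<Sum>i\<in>S. c i * lip (\<phi> i) (\<psi> j))" for j
    using lip_sum[OF assms(1), of "\<psi> j" c \<phi>] by (simp only: lip_sym[of "\<psi> j"])
  then show ?thesis
    unfolding lip_sum[OF assms(2)]
    by (subst sum.swap) (simp add: sum_distrib_left mult_ac)
qed

lemma lip_cong: "(\<And>k. k \<in> X \<Longrightarrow> \<phi> k = \<phi>' k) \<Longrightarrow> (\<And>k. k \<in> X \<Longrightarrow> \<psi> k = \<psi>' k) \<Longrightarrow> lip \<phi> \<psi> = lip \<phi>' \<psi>'"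
  unfolding lip_def by (intro sum.cong) auto

lemma ip_nonneg: "ip \<alpha> \<alpha> \<ge> 0"
  unfolding ip_def lip_def by (intro sum_nonneg) (auto intro: G_nonneg)

lemma ip_eq_0D:
  assumes "ip \<alpha> \<alpha> \<le> 0" "k \<in> X" shows "\<alpha> k I = 0"
proof (rule ccontr)
  assume "\<alpha> k I \<noteq> 0"
  then have "0 < \<alpha> k I \<bullet> (G k *v \<alpha> k I)" using G_pos assms by blast
  also have "\<dots> \<le> lip (\<lambda>k. \<alpha> k I) (\<lambda>k. \<alpha> k I)"
    unfolding lip_def using assms(2) G_nonneg by (intro member_le_sum) auto
  also have "\<dots> \<le> ip \<alpha> \<alpha>"
    unfolding ip_def using G_nonneg by (intro member_le_sum) (auto simp: lip_def intro!: sum_nonneg)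
  finally show False using assms(1) by simp
qed

lemma ip_zero_left: "(\<And>k I. k \<in> X \<Longrightarrow> \<alpha> k I = 0) \<Longrightarrow> ip \<alpha> \<beta> = 0"
  by (simp add: ip_def lip_def)

lemma ip_Cauchy_Schwarz: "(ip \<alpha> \<beta>)\<^sup>2 \<le> ip \<alpha> \<alpha> * ip \<beta> \<beta>"
proof (cases "ip \<beta> \<beta> = 0")
  case True
  then have "ip \<beta> \<alpha> = 0" using ip_eq_0D[of \<beta>] by (intro ip_zero_left) auto
  then show ?thesis using True ip_sym[of \<alpha> \<beta>] by simp
next
  case False
  then have pos: "ip \<beta> \<beta> > 0" using ip_nonneg[of \<beta>] by simp
  define c where "c = - ip \<alpha> \<beta> / ip \<beta> \<beta>"
  let ?g = "\<lambda>k I. \<alpha> k I + c *\<^sub>R \<beta> k I"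
  have "0 \<le> ip ?g ?g" by (rule ip_nonneg)
  also have "\<dots> = ip \<alpha> \<alpha> + 2 * c * ip \<alpha> \<beta> + c\<^sup>2 * ip \<beta> \<beta>"
    using ip_add[of ?g \<alpha> c \<beta>] ip_add[of \<alpha> \<alpha> c \<beta>] ip_add[of \<beta> \<alpha> c \<beta>] ip_sym
    by (simp add: algebra_simps power2_eq_square)
  also have "\<dots> = ip \<alpha> \<alpha> - (ip \<alpha> \<beta>)\<^sup>2 / ip \<beta> \<beta>"
    using pos by (simp add: c_def power2_eq_square field_simps)
  finally show ?thesis using pos by (simp add: field_simps)
qed

text \<open>Summation by parts, without boundary terms because the shift is a bijection of the
  torus.\<close>

lemma lip_D_left: "lip (D i \<phi>) \<psi> = lip \<phi> (Ds i \<psi>)"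
proof -
  have "lip (D i \<phi>) \<psi> = ((\<Sum>k\<in>X. \<phi> (up i k) \<bullet> (G k *v \<psi> k)) - (\<Sum>k\<in>X. \<phi> k \<bullet> (G k *v \<psi> k))) / h"
    by (simp add: lip_def D_def inner_diff_left sum_subtractf sum_divide_distrib[symmetric]
        divide_inverse_commute sum_distrib_left[symmetric])
  also have "(\<Sum>k\<in>X. \<phi> (up i k) \<bullet> (G k *v \<psi> k)) = (\<Sum>k\<in>X. \<phi> k \<bullet> (G (dn i k) *v \<psi> (dn i k)))"
    using sum_up[of "\<lambda>k. \<phi> k \<bullet> (G (dn i k) *v \<psi> (dn i k))" i] by simp
  also have "(\<dots> - (\<Sum>k\<in>X. \<phi> k \<bullet> (G k *v \<psi> k))) / h = lip \<phi> (Ds i \<psi>)"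
    by (simp add: lip_def Ds_def matrix_vector_mult_scaleR matrix_vector_mult_diff_distrib
        inner_diff_right sum_subtractf divide_inverse_commute sum_distrib_left[symmetric])
  finally show ?thesis .
qed

text \<open>Expanded, the two products agree except in the value of \<phi> at
  \<open>up j (dn i k)\<close>, which carries \<open>A i (up j k)\<close> in one of them and
  \<open>A i k\<close> in the other.\<close>

lemma commutator:
  assumes "k \<in> X"
  shows "D j (Ds i \<phi>) k = C i j k *v \<phi> (up j (dn i k)) + Ds i (D j \<phi>) k"
proof -
  have "h\<^sup>2 *\<^sub>R D j (Ds i \<phi>) k = h\<^sup>2 *\<^sub>R (C i j k *v \<phi> (up j (dn i k)) + Ds i (D j \<phi>) k)"
    using h assms dn_up_commute[OF assms, of i j]
    by (simp add: D_def Ds_def C_def A_def power2_eq_square scaleR_right_distrib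
        matrix_vector_mult_scaleR scaleR_matrix_vector_assoc[symmetric] matrix_vector_mul_assoc
        scaleR_right_diff_distrib matrix_vector_mult_diff_distrib matrix_vector_mult_diff_rdistrib)
  then show ?thesis using h by simp
qed

text \<open>Move one adjoint difference to the other side, commute, and move back: the directions i
  and j are exchanged at the price of a curvature term.\<close>

lemma lip_Ds_Ds:
  "lip (Ds i a) (Ds j b) = (\<Sum>k\<in>X. b k \<bullet> (G k *v (C i j k *v a (up j (dn i k))))) + lip (D j a) (D i b)"
proof -
  have "lip (Ds i a) (Ds j b) = lip (D j (Ds i a)) b" by (simp add: lip_D_left)
  also have "\<dots> = lip b (\<lambda>k. C i j k *v a (up j (dn i k)) + 1 *\<^sub>R Ds i (D j a) k)"
    unfolding lip_sym[of _ b] by (rule lip_cong) (simp_all add: commutator)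
  also have "\<dots> = lip b (\<lambda>k. C i j k *v a (up j (dn i k))) + lip b (Ds i (D j a))"
    using lip_add[of b _ 1] by simp
  also have "lip b (Ds i (D j a)) = lip (D j a) (D i b)"
    unfolding lip_D_left[symmetric] by (rule lip_sym)
  finally show ?thesis by (simp add: lip_def)
qed

lemma Ds_add: "Ds i (\<lambda>k. f k + c *\<^sub>R g k) k = Ds i f k + c *\<^sub>R Ds i g k"
  by (simp add: Ds_def algebra_simps matrix_vector_right_distrib matrix_vector_mult_scaleR)

lemma \<delta>_add: "\<delta> (\<lambda>k I. f k I + c *\<^sub>R g k I) k J = \<delta> f k J + c *\<^sub>R \<delta> g k J"
proof -
  have "(\<Sum>i\<in>-J. isgn i J *\<^sub>R (Ds i (\<lambda>k. f k (insert i J)) k + c *\<^sub>R Ds i (\<lambda>k. g k (insert i J)) k)) =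
    (\<Sum>i\<in>-J. isgn i J *\<^sub>R Ds i (\<lambda>k. f k (insert i J)) k) +
    c *\<^sub>R (\<Sum>i\<in>-J. isgn i J *\<^sub>R Ds i (\<lambda>k. g k (insert i J)) k)"
    by (simp add: scaleR_right_distrib sum.distrib scaleR_sum_right mult.commute)
  then show ?thesis by (simp add: \<delta>_def Ds_add)
qed

lemma cochain_\<delta>:
  assumes "cochain (Suc q) \<alpha>" shows "cochain q (\<delta> \<alpha>)"
  unfolding cochain_def
proof (intro allI impI)
  fix k J assume ne: "\<delta> \<alpha> k J \<noteq> 0"
  then have k: "k \<in> X" by (auto simp: \<delta>_def split: if_splits)
  with ne obtain i where i: "i \<notin> J" "Ds i (\<lambda>k. \<alpha> k (insert i J)) k \<noteq> 0"
    unfolding \<delta>_def by (auto elim: sum.not_neutral_contains_not_neutral)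
  have "\<not> (\<alpha> k (insert i J) = 0 \<and> \<alpha> (dn i k) (insert i J) = 0)"
    using i(2) by (auto simp: Ds_def)
  then consider "\<alpha> k (insert i J) \<noteq> 0" | "\<alpha> (dn i k) (insert i J) \<noteq> 0" by blast
  then have "card (insert i J) = Suc q \<and> k \<in> Box J"
    using assms Box_insert_subset dn_in_Box[OF _ k i(1)] unfolding cochain_def by cases blast+
  then show "k \<in> Box J \<and> card J = q" using i(1) by simp
qed

text \<open>The truncation in \<open>d\<close> is invisible here because \<beta> vanishes outside
  its boxes.\<close>

lemma ip_d_left:
  assumes "cochain q \<beta>"
  shows "ip (d \<alpha>) \<beta> = ip \<alpha> (\<delta> \<beta>)"
proof -
  have "ip (d \<alpha>) \<beta> = (\<Sum>K\<in>UNIV. lip (\<lambda>k. \<Sum>i\<in>K. isgn i (K - {i}) *\<^sub>R D i (\<lambda>k. \<alpha> k (K - {i})) k) (\<lambda>k. \<beta> k K))"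
    unfolding ip_def lip_def d_def using cochain_zero(1)[OF assms]
    by (intro sum.cong refl) auto
  also have "\<dots> = (\<Sum>K\<in>UNIV. \<Sum>i\<in>K. isgn i (K - {i}) * lip (\<lambda>k. \<alpha> k (K - {i})) (Ds i (\<lambda>k. \<beta> k (insert i (K - {i})))))"
    by (subst lip_sym, subst lip_sum) (auto simp: insert_absorb lip_D_left[symmetric] lip_sym intro!: sum.cong)
  also have "\<dots> = (\<Sum>J\<in>UNIV. \<Sum>i\<in>-J. isgn i J * lip (\<lambda>k. \<alpha> k J) (Ds i (\<lambda>k. \<beta> k (insert i J))))"
    by (rule sum_subset_remove[of "\<lambda>i J. isgn i J * lip (\<lambda>k. \<alpha> k J) (Ds i (\<lambda>k. \<beta> k (insert i J)))"])
  also have "\<dots> = (\<Sum>J\<in>UNIV. lip (\<lambda>k. \<alpha> k J) (\<lambda>k. \<Sum>i\<in>-J. isgn i J *\<^sub>R Ds i (\<lambda>k. \<beta> k (insert i J)) k))"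
    by (simp add: lip_sum)
  also have "\<dots> = ip \<alpha> (\<delta> \<beta>)"
    unfolding ip_def \<delta>_def by (intro sum.cong refl lip_cong) auto
  finally show ?thesis .
qed

lemma Ds_Ds_commute:
  assumes "k \<in> X" shows "Ds i (Ds j \<phi>) k = Ds j (Ds i \<phi>) k"
  using assms dn_dn_commute[of i j k]
  by (simp add: Ds_def matrix_vector_mult_scaleR matrix_vector_mult_diff_distrib algebra_simps)

text \<open>Up to sign, \<open>Ds i\<close> is the plain backward difference conjugated by G, so
  these operators commute, whereas the sign attached to (i, j) is antisymmetric. The double sum
  equals its own negative.\<close>

lemma \<delta>_\<delta>: "\<delta> (\<delta> \<alpha>) k J = 0"
proof (cases "k \<in> X")
  case False then show ?thesis by (simp add: \<delta>_def)
next
  case k: True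
  let ?T = "\<lambda>i j. (isgn i J * isgn j (insert i J)) *\<^sub>R Ds i (Ds j (\<lambda>k. \<alpha> k (insert i (insert j J)))) k"
  have Ds_sum: "Ds i (\<lambda>k. if k \<in> X then \<Sum>j\<in>S. c j *\<^sub>R f j k else 0) k = (\<Sum>j\<in>S. c j *\<^sub>R Ds i (f j) k)"
    if "finite S" for i S c and f :: "'n \<Rightarrow> ('n \<Rightarrow> int) \<Rightarrow> real^'r"
    using that
  proof (induction S rule: finite_induct)
    case empty show ?case by (simp add: Ds_def)
  next
    case (insert x F)
    then show ?case
      using k by (simp add: Ds_def matrix_vector_right_distrib matrix_vector_mult_scaleR algebra_simps)
  qed
  have "\<delta> (\<delta> \<alpha>) k J = (\<Sum>i\<in>-J. isgn i J *\<^sub>R (\<Sum>j\<in>-insert i J. isgn j (insert i J) *\<^sub>R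
      Ds i (Ds j (\<lambda>k. \<alpha> k (insert j (insert i J)))) k))"
    using k by (simp add: \<delta>_def Ds_sum del: Compl_insert)
  also have "\<dots> = (\<Sum>i\<in>-J. \<Sum>j\<in>-J-{i}. ?T i j)"
    by (intro sum.cong refl) (auto simp: scaleR_sum_right insert_commute Compl_insert intro!: sum.cong)
  finally have 1: "\<delta> (\<delta> \<alpha>) k J = (\<Sum>i\<in>-J. \<Sum>j\<in>-J-{i}. ?T i j)" .
  have "(\<Sum>i\<in>-J. \<Sum>j\<in>-J-{i}. ?T i j) = (\<Sum>i\<in>-J. \<Sum>j\<in>-J-{i}. ?T j i)"
    by (rule sum_offdiag_swap) simp
  also have "\<dots> = (\<Sum>i\<in>-J. \<Sum>j\<in>-J-{i}. - ?T i j)"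
  proof (intro sum.cong refl)
    fix i j assume "i \<in> -J" "j \<in> -J-{i}"
    then have "isgn j J * isgn i (insert j J) = - (isgn i J * isgn j (insert i J))"
      by (auto simp: isgn_insert)
    then show "?T j i = - ?T i j"
      using Ds_Ds_commute[OF k] by (simp add: insert_commute)
  qed
  also have "\<dots> = - (\<Sum>i\<in>-J. \<Sum>j\<in>-J-{i}. ?T i j)" by (simp add: sum_negf)
  finally show ?thesis unfolding 1 by (simp add: eq_neg_iff_add_eq_0 flip: scaleR_2)
qed

text \<open>The gradient term |\<nabla> \<alpha>|^2. Its halves are the diagonal terms of |\<delta>
  \<alpha>|^2 and of |d \<alpha>|^2; therefore differences in directions of the index set run over
  all of X, including the jumps to zero at the faces, and those in the other directions only over
  the box.\<close>

definition energy :: "(('n \<Rightarrow> int) \<Rightarrow> 'n set \<Rightarrow> real^'r) \<Rightarrow> real" where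
  "energy \<alpha> = (\<Sum>J\<in>UNIV. \<Sum>i\<in>-J. lip (D i (\<lambda>k. \<alpha> k (insert i J))) (D i (\<lambda>k. \<alpha> k (insert i J)))) +
    (\<Sum>J\<in>UNIV. \<Sum>i\<in>-J. \<Sum>k\<in>Box (insert i J). D i (\<lambda>k. \<alpha> k J) k \<bullet> (G k *v D i (\<lambda>k. \<alpha> k J) k))"

text \<open>By \<open>lip_Ds_Ds\<close>, |\<delta> \<alpha>|^2 becomes the curvature terms plus
  products of plain differences. The diagonal i = j of these products and the diagonal of |d
  \<alpha>|^2 form the energy; off the diagonal the two contributions cancel.\<close>

theorem discrete_Bochner:
  assumes "cochain q \<alpha>"
  shows "ip (\<delta> \<alpha>) (\<delta> \<alpha>) + ip (d \<alpha>) (d \<alpha>) =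
    (\<Sum>J\<in>UNIV. \<Sum>i\<in>-J. \<Sum>j\<in>-J. isgn i J * isgn j J *
       (\<Sum>k\<in>X. \<alpha> k (insert j J) \<bullet> (G k *v (C i j k *v \<alpha> (up j (dn i k)) (insert i J))))) + energy \<alpha>"
proof -
  let ?S = "\<lambda>i j J. isgn i J * isgn j J"
  let ?D = "\<lambda>i I. D i (\<lambda>k. \<alpha> k I)"
  let ?E = "\<lambda>i j J. ?S i j J * (\<Sum>k\<in>X. \<alpha> k (insert j J) \<bullet> (G k *v (C i j k *v \<alpha> (up j (dn i k)) (insert i J))))"
  have "ip (\<delta> \<alpha>) (\<delta> \<alpha>) = (\<Sum>J\<in>UNIV. lip (\<lambda>k. \<Sum>i\<in>-J. isgn i J *\<^sub>R Ds i (\<lambda>k. \<alpha> k (insert i J)) k)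
      (\<lambda>k. \<Sum>j\<in>-J. isgn j J *\<^sub>R Ds j (\<lambda>k. \<alpha> k (insert j J)) k))"
    unfolding ip_def \<delta>_def by (intro sum.cong refl lip_cong) auto
  also have "\<dots> = (\<Sum>J\<in>UNIV. \<Sum>i\<in>-J. \<Sum>j\<in>-J. ?E i j J + ?S i j J * lip (?D j (insert i J)) (?D i (insert j J)))"
    by (simp add: lip_sum_sum lip_Ds_Ds ring_distribs)
  also have "\<dots> = (\<Sum>J\<in>UNIV. \<Sum>i\<in>-J. \<Sum>j\<in>-J. ?E i j J) +
      (\<Sum>J\<in>UNIV. \<Sum>i\<in>-J. \<Sum>j\<in>-J. ?S i j J * lip (?D j (insert i J)) (?D i (insert j J)))"
    by (simp add: sum.distrib)
  also have "(\<Sum>J\<in>UNIV. \<Sum>i\<in>-J. \<Sum>j\<in>-J. ?S i j J * lip (?D j (insert i J)) (?D i (insert j J))) =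
      (\<Sum>J\<in>UNIV. \<Sum>i\<in>-J. lip (?D i (insert i J)) (?D i (insert i J))) +
      (\<Sum>J\<in>UNIV. \<Sum>i\<in>-J. \<Sum>j\<in>-J-{i}. ?S i j J * lip (?D j (insert i J)) (?D i (insert j J)))"
    by (subst sum_pairs_split) simp
  finally have \<delta>_part: "ip (\<delta> \<alpha>) (\<delta> \<alpha>) = (\<Sum>J\<in>UNIV. \<Sum>i\<in>-J. \<Sum>j\<in>-J. ?E i j J) +
      ((\<Sum>J\<in>UNIV. \<Sum>i\<in>-J. lip (?D i (insert i J)) (?D i (insert i J))) +
      (\<Sum>J\<in>UNIV. \<Sum>i\<in>-J. \<Sum>j\<in>-J-{i}. ?S i j J * lip (?D j (insert i J)) (?D i (insert j J))))" .
  let ?B = "\<lambda>i j K. isgn i (K - {i}) * isgn j (K - {j}) *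
      (\<Sum>k\<in>Box K. ?D i (K - {i}) k \<bullet> (G k *v ?D j (K - {j}) k))"
  have "ip (d \<alpha>) (d \<alpha>) = (\<Sum>K\<in>UNIV. \<Sum>i\<in>K. \<Sum>j\<in>K. ?B i j K)"
    unfolding ip_def
  proof (rule sum.cong[OF refl])
    fix K :: "'n set"
    let ?u = "\<lambda>k. \<Sum>i\<in>K. isgn i (K - {i}) *\<^sub>R ?D i (K - {i}) k"
    have "lip (\<lambda>k. d \<alpha> k K) (\<lambda>k. d \<alpha> k K) = (\<Sum>k\<in>X. if k \<in> Box K then ?u k \<bullet> (G k *v ?u k) else 0)"
      unfolding lip_def d_def by (intro sum.cong) auto
    also have "\<dots> = (\<Sum>k\<in>Box K. ?u k \<bullet> (G k *v ?u k))"
      using Box_subset_X[of K] by (simp add: sum.If_cases Int_absorb1)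
    also have "\<dots> = (\<Sum>k\<in>Box K. \<Sum>i\<in>K. \<Sum>j\<in>K. isgn i (K - {i}) * isgn j (K - {j}) *
      (?D i (K - {i}) k \<bullet> (G k *v ?D j (K - {j}) k)))"
      by (rule sum.cong[OF refl], subst sum.swap)
        (simp add: inner_sum_left inner_sum_right mult_ac sum_distrib_left
          linear_sum[OF matrix_vector_mul_linear] matrix_vector_mult_scaleR)
    also have "\<dots> = (\<Sum>i\<in>K. \<Sum>j\<in>K. ?B i j K)"
      by (simp add: sum_distrib_left sum.swap[of _ "Box K"])
    finally show "lip (\<lambda>k. d \<alpha> k K) (\<lambda>k. d \<alpha> k K) = (\<Sum>i\<in>K. \<Sum>j\<in>K. ?B i j K)" .
  qed
  also have "\<dots> = (\<Sum>J\<in>UNIV. \<Sum>i\<in>-J. ?B i i (insert i J)) +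
    (\<Sum>J\<in>UNIV. \<Sum>i\<in>-J. \<Sum>j\<in>-J-{i}. ?B i j (insert i (insert j J)))"
    by (rule sum_subset_pairs_insert)
  also have "(\<Sum>J\<in>UNIV. \<Sum>i\<in>-J. \<Sum>j\<in>-J-{i}. ?B i j (insert i (insert j J))) =
    (\<Sum>J\<in>UNIV. \<Sum>i\<in>-J. \<Sum>j\<in>-J-{i}. - (?S i j J * lip (?D j (insert i J)) (?D i (insert j J))))"
  proof (intro sum.cong refl)
    fix J and i j :: 'n assume "i \<in> -J" "j \<in> -J-{i}"
    then have ij: "i \<notin> J" "j \<notin> J" "i \<noteq> j" by auto
    then have K: "insert i (insert j J) - {i} = insert j J" "insert i (insert j J) - {j} = insert i J" by auto
    \<comment> \<open>Exactly one of i < j and j < i holds, so exactly one of the two signs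
      flips.\<close>
    have sg: "isgn i (insert j J) * isgn j (insert i J) = - ?S i j J"
      using ij by (auto simp: isgn_insert)
    have "(\<Sum>k\<in>Box (insert i (insert j J)). ?D i (insert j J) k \<bullet> (G k *v ?D j (insert i J) k)) =
      lip (?D i (insert j J)) (?D j (insert i J))"
      unfolding lip_def
    proof (rule sum.mono_neutral_left[OF finite_X Box_subset_X], intro ballI)
      \<comment> \<open>Outside this box one of the two difference quotients vanishes, so the
        truncated sum coming from |d \<alpha>|^2 is the full sum coming from |\<delta>
        \<alpha>|^2.\<close>
      fix k assume k: "k \<in> X - Box (insert i (insert j J))"
      then have "\<not> ((k \<in> Box (insert j J) \<or> up i k \<in> Box (insert j J)) \<and>
          (k \<in> Box (insert i J) \<or> up j k \<in> Box (insert i J)))"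
        using Box_insert2I[OF ij(3,1,2)] by blast
      then have "?D i (insert j J) k = 0 \<or> ?D j (insert i J) k = 0"
        using cochain_zero(1)[OF assms] by (auto simp: D_def)
      then show "?D i (insert j J) k \<bullet> (G k *v ?D j (insert i J) k) = 0" by auto
    qed
    then show "?B i j (insert i (insert j J)) = - (?S i j J * lip (?D j (insert i J)) (?D i (insert j J)))"
      unfolding K sg using lip_sym by simp
  qed
  also have "\<dots> = - (\<Sum>J\<in>UNIV. \<Sum>i\<in>-J. \<Sum>j\<in>-J-{i}. ?S i j J * lip (?D j (insert i J)) (?D i (insert j J)))"
    by (simp add: sum_negf)
  also have "(\<Sum>J\<in>UNIV. \<Sum>i\<in>-J. ?B i i (insert i J)) =
      (\<Sum>J\<in>UNIV. \<Sum>i\<in>-J. \<Sum>k\<in>Box (insert i J). ?D i J k \<bullet> (G k *v ?D i J k))"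
    by (intro sum.cong refl) simp
  finally show ?thesis unfolding \<delta>_part energy_def by simp
qed

end

section \<open>Solvability of d u = f with an L^2 estimate\<close>

context metric_lattice
begin

text \<open>The Hodge Laplacian is inverted on \<open>q\<close>-cochains, \<open>u = \<delta> \<beta>\<close> where \<open>\<beta>\<close> solves
  \<open>\<delta> d \<beta> + d \<delta> \<beta> = f\<close>; closedness of \<open>f\<close> forces \<open>d \<beta> = 0\<close>.\<close>

theorem solve_d:
  assumes c: "c > 0"
    and coercive: "\<And>\<alpha>. cochain (Suc p) \<alpha> \<Longrightarrow> c * ip \<alpha> \<alpha> \<le> ip (\<delta> \<alpha>) (\<delta> \<alpha>) + ip (d \<alpha>) (d \<alpha>)"
    and f: "cochain (Suc p) f" and df: "\<And>k K. d f k K = 0"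
  obtains u where "\<And>k I. k \<in> X \<Longrightarrow> d u k I = f k I" "c * ip u u \<le> ip f f"
proof -
  \<comment> \<open>Functions supported on the finite set S of triples (k, I, \<tau>) encode the
    cochains of degree \<open>Suc p\<close>; in this shape \<open>riesz_finite_support\<close>
    applies to them.\<close>
  define cv :: "(('n \<Rightarrow> int) \<times> 'n set \<times> 'r \<Rightarrow> real) \<Rightarrow> ('n \<Rightarrow> int) \<Rightarrow> 'n set \<Rightarrow> real^'r"
    where "cv F k I = (\<chi> \<tau>. F (k, I, \<tau>))" for F k I
  define S where "S = (SIGMA k:X. {I. k \<in> Box I \<and> card I = Suc p} \<times> (UNIV :: 'r set))"
  have finS: "finite S" unfolding S_def by (intro finite_SigmaI) auto
  have cv_add: "cv (\<lambda>i. y i + e * z i) = (\<lambda>k I. cv y k I + e *\<^sub>R cv z k I)" for y z e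
    by (simp add: cv_def fun_eq_iff vec_eq_iff)
  have cv_cochain: "cochain (Suc p) (cv F)" if "\<And>i. i \<notin> S \<Longrightarrow> F i = 0" for F
    unfolding cochain_def
  proof (intro allI impI)
    fix k I assume "cv F k I \<noteq> 0"
    then obtain \<tau> where "F (k, I, \<tau>) \<noteq> 0" by (auto simp: cv_def vec_eq_iff)
    then have "(k, I, \<tau>) \<in> S" using that by blast
    then show "k \<in> Box I \<and> card I = Suc p" by (simp add: S_def)
  qed
  define b where "b F F' = ip (\<delta> (cv F)) (\<delta> (cv F')) + ip (d (cv F)) (d (cv F'))" for F F'
  have \<delta>_add': "\<delta> (\<lambda>k I. f k I + e *\<^sub>R g k I) = (\<lambda>k J. \<delta> f k J + e *\<^sub>R \<delta> g k J)" for f g e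
    by (simp add: fun_eq_iff \<delta>_add)
  have d_add': "d (\<lambda>k I. f k I + e *\<^sub>R g k I) = (\<lambda>k J. d f k J + e *\<^sub>R d g k J)"
    for f g :: "('n \<Rightarrow> int) \<Rightarrow> 'n set \<Rightarrow> real^'r" and e
    by (simp add: fun_eq_iff d_add)
  have "\<exists>F. (\<forall>i. i \<notin> S \<longrightarrow> F i = 0) \<and> (\<forall>y. (\<forall>i. i \<notin> S \<longrightarrow> y i = 0) \<longrightarrow> b F y = ip f (cv y))"
  proof (rule riesz_finite_support[OF finS])
    show "b x (\<lambda>i. y i + e * z i) = b x y + e * b x z" for x y z e
      by (simp add: b_def cv_add \<delta>_add' d_add' ip_add algebra_simps)
    show "b x y = b y x" for x y
      by (simp add: b_def ip_sym)
    show "ip f (cv (\<lambda>i. y i + e * z i)) = ip f (cv y) + e * ip f (cv z)" for y z e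
      by (simp add: cv_add ip_add)
    show "F = (\<lambda>i. 0)" if F: "\<And>i. i \<notin> S \<Longrightarrow> F i = 0" and le: "b F F \<le> 0" for F
    proof (rule ext)
      fix i :: "('n \<Rightarrow> int) \<times> 'n set \<times> 'r"
      obtain k I \<tau> where i: "i = (k, I, \<tau>)" by (cases i)
      have "cochain (Suc p) (cv F)" using F by (rule cv_cochain)
      from coercive[OF this] have "c * ip (cv F) (cv F) \<le> 0" using le by (simp add: b_def)
      then have "ip (cv F) (cv F) \<le> 0" using c by (simp add: mult_le_0_iff)
      then have "k \<in> X \<Longrightarrow> cv F k I = 0" by (rule ip_eq_0D)
      then have "k \<in> X \<Longrightarrow> F i = 0" by (simp add: cv_def vec_eq_iff i)
      moreover have "k \<notin> X \<Longrightarrow> F i = 0" using F[of i] by (simp add: S_def i)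
      ultimately show "F i = 0" by blast
    qed
  qed
  then obtain F where F: "\<And>i. i \<notin> S \<Longrightarrow> F i = 0"
    and bF: "\<And>y. (\<forall>i. i \<notin> S \<longrightarrow> y i = 0) \<Longrightarrow> b F y = ip f (cv y)" by blast
  define \<beta> where "\<beta> = cv F"
  have \<beta>: "cochain (Suc p) \<beta>" unfolding \<beta>_def using F by (rule cv_cochain)
  have weak: "ip (\<delta> \<beta>) (\<delta> \<phi>) + ip (d \<beta>) (d \<phi>) = ip f \<phi>" if \<phi>: "cochain (Suc p) \<phi>" for \<phi>
  proof -
    define y where "y = (\<lambda>(k, I, \<tau>). \<phi> k I $ \<tau>)"
    have "cv y = \<phi>" by (simp add: y_def cv_def fun_eq_iff vec_eq_iff)
    moreover have "\<forall>i. i \<notin> S \<longrightarrow> y i = 0"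
    proof (intro allI impI)
      fix i assume "i \<notin> S"
      obtain k I \<tau> where i: "i = (k, I, \<tau>)" by (cases i)
      have "\<phi> k I = 0"
        using \<open>i \<notin> S\<close> Box_subset_X[of I] cochain_zero(1)[OF \<phi>, of k I] cochain_zero(2)[OF \<phi>, of I k] by (auto simp: S_def i)
      then show "y i = 0" by (simp add: y_def i)
    qed
    ultimately show ?thesis using bF[of y] by (simp add: b_def \<beta>_def)
  qed
  have d\<beta>: "cochain (Suc (Suc p)) (d \<beta>)" by (rule cochain_d[OF \<beta>])
  have \<delta>d\<beta>: "cochain (Suc p) (\<delta> (d \<beta>))" by (rule cochain_\<delta>[OF d\<beta>])
  have zero: "ip (\<lambda>k I. 0) \<phi> = 0" for \<phi> by (simp add: ip_zero_left)
  have dfun: "d f = (\<lambda>k K. 0)" using df by (simp add: fun_eq_iff)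
  have \<delta>\<delta>fun: "\<delta> (\<delta> (d \<beta>)) = (\<lambda>k J. 0)" by (simp add: fun_eq_iff \<delta>_\<delta>)
  \<comment> \<open>Test the weak equation with \<delta> d \<beta>: the term with \<delta> \<delta>
    drops out, and <f, \<delta> d \<beta>> = <d f, d \<beta>> = 0.\<close>
  have "ip (\<delta> (d \<beta>)) (\<delta> (d \<beta>)) = ip (d (\<delta> (d \<beta>))) (d \<beta>)"
    using ip_d_left[OF d\<beta>] by simp
  also have "\<dots> = ip f (\<delta> (d \<beta>))"
    using weak[OF \<delta>d\<beta>] zero ip_sym by (simp add: \<delta>\<delta>fun)
  also have "\<dots> = 0" using ip_d_left[OF d\<beta>, of f] zero by (simp add: dfun)
  finally have "\<delta> (d \<beta>) k J = 0" if "k \<in> X" for k J using ip_eq_0D that by simp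
  then have "ip (\<delta> (d \<beta>)) \<beta> = 0" by (intro ip_zero_left)
  then have d\<beta>0: "ip (d \<beta>) (d \<beta>) = 0" using ip_d_left[OF d\<beta>, of \<beta>] ip_sym by simp
  then have d\<beta>_0: "d \<beta> k J = 0" if "k \<in> X" for k J using ip_eq_0D that by simp
  have weak': "ip (\<delta> \<beta>) (\<delta> \<phi>) = ip f \<phi>" if "cochain (Suc p) \<phi>" for \<phi>
    using weak[OF that] ip_zero_left[of "d \<beta>" "d \<phi>"] d\<beta>_0 by simp
  let ?u = "\<delta> \<beta>"
  show thesis
  proof (rule that[of ?u])
    \<comment> \<open>The residual d u - f is itself a cochain, hence an admissible test form, and
      so it is orthogonal to itself.\<close>
    let ?g = "\<lambda>k I. d ?u k I + (-1) *\<^sub>R f k I"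
    have "cochain (Suc p) (d ?u)" by (intro cochain_d cochain_\<delta> \<beta>)
    then have g: "cochain (Suc p) ?g" using f unfolding cochain_def by (metis add_0 scaleR_zero_right)
    have "ip ?g ?g = ip (d ?u) ?g - ip f ?g"
      using ip_add[of ?g "d ?u" "-1" f] ip_sym by simp
    also have "\<dots> = 0" using weak'[OF g] ip_d_left[OF g] by simp
    finally show "d ?u k I = f k I" if "k \<in> X" for k I using ip_eq_0D[of ?g k I] that by simp
  next
    \<comment> \<open>Together with c |\<beta>|^2 <= |u|^2, Cauchy-Schwarz turns this into c |u|^4
      <= |f|^2 |u|^2.\<close>
    have uu: "ip ?u ?u = ip f \<beta>" by (rule weak'[OF \<beta>])
    have "c * ip \<beta> \<beta> \<le> ip ?u ?u" using coercive[OF \<beta>] d\<beta>0 by simp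
    then have "(ip ?u ?u)\<^sup>2 * c \<le> ip f f * ip ?u ?u"
      using ip_Cauchy_Schwarz[of f \<beta>] ip_nonneg[of f] c unfolding uu
      by (smt (verit, ccfv_SIG) mult.assoc mult.commute mult_left_mono mult_right_mono)
    then show "c * ip ?u ?u \<le> ip f f"
      using ip_nonneg[of ?u] ip_nonneg[of f]
      by (cases "ip ?u ?u = 0") (auto simp: power2_eq_square mult_ac)
  qed
qed

end

section \<open>Finite differences of a metric\<close>

definition has_pderiv :: "(real^'n \<Rightarrow> 'b::real_normed_vector) \<Rightarrow> 'n::finite \<Rightarrow> 'b \<Rightarrow> real^'n \<Rightarrow> bool" where
  "has_pderiv f i f' x \<longleftrightarrow> ((\<lambda>t. f (x + t *\<^sub>R axis i 1)) has_vector_derivative f') (at 0)"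

lemma has_pderiv_line:
  assumes "has_pderiv f i f' (x + t *\<^sub>R axis i 1)"
  shows "((\<lambda>t. f (x + t *\<^sub>R axis i 1)) has_vector_derivative f') (at t)"
proof -
  have 1: "((\<lambda>s. s - t) has_vector_derivative 1) (at t)"
    by (auto intro!: derivative_eq_intros)
  have "((\<lambda>s. f (x + t *\<^sub>R axis i 1 + s *\<^sub>R axis i 1)) has_vector_derivative f') (at (t - t))"
    using assms by (simp add: has_pderiv_def)
  from vector_diff_chain_at[OF 1 this] show ?thesis
    by (simp add: o_def algebra_simps)
qed

text \<open>The mean value inequality for F(t) - t c. The sign of b is free because the metric is
  also differenced backwards.\<close>

lemma vector_derivative_deviation:
  fixes F :: "real \<Rightarrow> 'b::real_normed_vector"
  assumes "\<And>t. \<bar>t\<bar> \<le> \<bar>b\<bar> \<Longrightarrow> (F has_vector_derivative F' t) (at t)"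
    and "\<And>t. \<bar>t\<bar> \<le> \<bar>b\<bar> \<Longrightarrow> norm (F' t - c) \<le> B"
  shows "norm (F b - F 0 - b *\<^sub>R c) \<le> \<bar>b\<bar> * B"
proof -
  define E where "E = (\<lambda>t. F t - t *\<^sub>R c)"
  have "norm (E b - E 0) \<le> B * norm (b - 0)"
  proof (rule differentiable_bound)
    show "convex {-\<bar>b\<bar>..\<bar>b\<bar>}" by simp
    fix t assume "t \<in> {-\<bar>b\<bar>..\<bar>b\<bar>}"
    then have t: "\<bar>t\<bar> \<le> \<bar>b\<bar>" by auto
    have "(E has_vector_derivative F' t - c) (at t)"
      unfolding E_def using assms(1)[OF t] by (auto intro!: derivative_eq_intros)
    then show "(E has_derivative (\<lambda>s. s *\<^sub>R (F' t - c))) (at t within {-\<bar>b\<bar>..\<bar>b\<bar>})"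
      unfolding has_vector_derivative_def by (rule has_derivative_at_withinI)
    show "onorm (\<lambda>s. s *\<^sub>R (F' t - c)) \<le> B"
      using assms(2)[OF t] by (intro onorm_le) (simp add: mult.commute[of B] mult_left_mono)
  qed auto
  then show ?thesis by (simp add: E_def algebra_simps)
qed

text \<open>The derivative is frozen at y0 while the base point y moves: grid points near y0 change
  with the mesh, so the bound has to be uniform in y.\<close>

lemma pderiv_difference_quotient:
  fixes f :: "real^'n::finite \<Rightarrow> 'b::real_normed_vector"
  assumes U: "open U" "y0 \<in> U" and f: "\<And>x. x \<in> U \<Longrightarrow> has_pderiv f i (f' x) x"
    and cont: "continuous_on U f'" and "\<epsilon> > 0"
  obtains r where "r > 0" "\<And>y h. dist y y0 < r \<Longrightarrow> \<bar>h\<bar> < r \<Longrightarrow>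
    norm (f (y + h *\<^sub>R axis i 1) - f y - h *\<^sub>R f' y0) \<le> \<bar>h\<bar> * \<epsilon>"
proof -
  have "isCont f' y0" using U cont by (simp add: continuous_on_eq_continuous_at)
  then obtain r1 where r1: "r1 > 0" "\<And>y. dist y y0 < r1 \<Longrightarrow> dist (f' y) (f' y0) < \<epsilon>"
    using \<open>\<epsilon> > 0\<close> unfolding continuous_at_eps_delta by blast
  obtain r2 where r2: "r2 > 0" "ball y0 r2 \<subseteq> U" using U open_contains_ball by blast
  define r where "r = min r1 r2 / 2"
  show thesis
  proof (rule that[of r])
    show "r > 0" using r1 r2 by (simp add: r_def)
    fix y h assume yh: "dist y y0 < r" "\<bar>h\<bar> < r"
    have near: "dist (y + t *\<^sub>R axis i 1) y0 < 2 * r" if "\<bar>t\<bar> \<le> \<bar>h\<bar>" for t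
    proof -
      have "dist (y + t *\<^sub>R axis i 1) y0 \<le> dist (y + t *\<^sub>R axis i 1) y + dist y y0"
        by (rule dist_triangle)
      also have "\<dots> < 2 * r" using yh that by (simp add: dist_norm)
      finally show ?thesis .
    qed
    have "norm ((\<lambda>t. f (y + t *\<^sub>R axis i 1)) h - (\<lambda>t. f (y + t *\<^sub>R axis i 1)) 0 - h *\<^sub>R f' y0) \<le> \<bar>h\<bar> * \<epsilon>"
    proof (rule vector_derivative_deviation)
      fix t assume t: "\<bar>t\<bar> \<le> \<bar>h\<bar>"
      have "y + t *\<^sub>R axis i 1 \<in> U"
        using near[OF t] r2(2) by (auto simp: r_def dist_commute min_def split: if_splits)
      then show "((\<lambda>t. f (y + t *\<^sub>R axis i 1)) has_vector_derivative f' (y + t *\<^sub>R axis i 1)) (at t)"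
        using f by (intro has_pderiv_line)
      show "norm (f' (y + t *\<^sub>R axis i 1) - f' y0) \<le> \<epsilon>"
        using r1(2)[of "y + t *\<^sub>R axis i 1"] near[OF t] by (simp add: r_def dist_norm min_def split: if_splits)
    qed
    then show "norm (f (y + h *\<^sub>R axis i 1) - f y - h *\<^sub>R f' y0) \<le> \<bar>h\<bar> * \<epsilon>" by simp
  qed
qed

text \<open>The mean value inequality is applied to t |-> f(y + a e_j + t e_i) - f(y + t e_i), whose
  derivative is a difference of f'; the previous lemma compares that difference with a
  f''(y0).\<close>

lemma pderiv_second_difference:
  fixes f :: "real^'n::finite \<Rightarrow> 'b::real_normed_vector"
  assumes U: "open U" "y0 \<in> U" and f: "\<And>x. x \<in> U \<Longrightarrow> has_pderiv f i (f' x) x"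
    and f': "\<And>x. x \<in> U \<Longrightarrow> has_pderiv f' j (f'' x) x"
    and cont: "continuous_on U f''" and "\<epsilon> > 0"
  obtains r where "r > 0" "\<And>y a b. dist y y0 < r \<Longrightarrow> \<bar>a\<bar> < r \<Longrightarrow> \<bar>b\<bar> < r \<Longrightarrow>
    norm (f (y + a *\<^sub>R axis j 1 + b *\<^sub>R axis i 1) - f (y + b *\<^sub>R axis i 1)
      - (f (y + a *\<^sub>R axis j 1) - f y) - (a * b) *\<^sub>R f'' y0) \<le> \<bar>a\<bar> * \<bar>b\<bar> * \<epsilon>"
proof -
  obtain r1 where r1: "r1 > 0" "\<And>y a. dist y y0 < r1 \<Longrightarrow> \<bar>a\<bar> < r1 \<Longrightarrow>
    norm (f' (y + a *\<^sub>R axis j 1) - f' y - a *\<^sub>R f'' y0) \<le> \<bar>a\<bar> * \<epsilon>"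
    using pderiv_difference_quotient[OF U f' cont \<open>\<epsilon> > 0\<close>] by metis
  obtain r2 where r2: "r2 > 0" "ball y0 r2 \<subseteq> U" using U open_contains_ball by blast
  define r where "r = min r1 r2 / 3"
  show thesis
  proof (rule that[of r])
    show "r > 0" using r1 r2 by (simp add: r_def)
    fix y a b assume yh: "dist y y0 < r" "\<bar>a\<bar> < r" "\<bar>b\<bar> < r"
    define F where "F = (\<lambda>t. f (y + a *\<^sub>R axis j 1 + t *\<^sub>R axis i 1) - f (y + t *\<^sub>R axis i 1))"
    have near: "dist (y + t *\<^sub>R axis i 1) y0 < 2 * r" if "\<bar>t\<bar> \<le> \<bar>b\<bar>" for t
    proof -
      have "dist (y + t *\<^sub>R axis i 1) y0 \<le> dist (y + t *\<^sub>R axis i 1) y + dist y y0"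
        by (rule dist_triangle)
      also have "\<dots> < 2 * r" using yh that by (simp add: dist_norm)
      finally show ?thesis .
    qed
    have near': "dist (y + a *\<^sub>R axis j 1 + t *\<^sub>R axis i 1) y0 < 3 * r" if "\<bar>t\<bar> \<le> \<bar>b\<bar>" for t
    proof -
      have "dist (y + a *\<^sub>R axis j 1 + t *\<^sub>R axis i 1) y0 \<le>
        dist (y + a *\<^sub>R axis j 1 + t *\<^sub>R axis i 1) (y + t *\<^sub>R axis i 1) + dist (y + t *\<^sub>R axis i 1) y0"
        by (rule dist_triangle)
      also have "\<dots> < 3 * r" using near[OF that] yh by (simp add: dist_norm)
      finally show ?thesis .
    qed
    have 3: "3 * r \<le> r1" "3 * r \<le> r2" "r > 0" using r1 r2 by (auto simp: r_def)
    have "norm (F b - F 0 - b *\<^sub>R (a *\<^sub>R f'' y0)) \<le> \<bar>b\<bar> * (\<bar>a\<bar> * \<epsilon>)"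
    proof (rule vector_derivative_deviation)
      fix t assume t: "\<bar>t\<bar> \<le> \<bar>b\<bar>"
      have "y + t *\<^sub>R axis i 1 \<in> U" "y + a *\<^sub>R axis j 1 + t *\<^sub>R axis i 1 \<in> U"
        using near[OF t] near'[OF t] r2(2) 3 by (auto simp: subset_iff dist_commute)
      then show "(F has_vector_derivative
          f' (y + a *\<^sub>R axis j 1 + t *\<^sub>R axis i 1) - f' (y + t *\<^sub>R axis i 1)) (at t)"
        unfolding F_def using f by (intro has_vector_derivative_diff has_pderiv_line)
      have "y + a *\<^sub>R axis j 1 + t *\<^sub>R axis i 1 = y + t *\<^sub>R axis i 1 + a *\<^sub>R axis j 1" by simp
      then show "norm (f' (y + a *\<^sub>R axis j 1 + t *\<^sub>R axis i 1) - f' (y + t *\<^sub>R axis i 1) - a *\<^sub>R f'' y0) \<le> \<bar>a\<bar> * \<epsilon>"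
        using r1(2)[of "y + t *\<^sub>R axis i 1" a] near[OF t] 3 yh by (simp add: add_ac)
    qed
    then show "norm (f (y + a *\<^sub>R axis j 1 + b *\<^sub>R axis i 1) - f (y + b *\<^sub>R axis i 1)
      - (f (y + a *\<^sub>R axis j 1) - f y) - (a * b) *\<^sub>R f'' y0) \<le> \<bar>a\<bar> * \<bar>b\<bar> * \<epsilon>"
      by (simp add: F_def mult_ac)
  qed
qed

lemma eventually_near_right:
  fixes y0 :: "'a::metric_space"
  assumes "r > 0"
  shows "\<forall>\<^sub>F (y,h) in nhds y0 \<times>\<^sub>F at_right (0::real). dist y y0 < r \<and> 0 < h \<and> h < r"
proof -
  have "\<forall>\<^sub>F h in at_right (0::real). 0 < h \<and> h < r"
    using assms by (auto simp: eventually_at_right_field)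
  moreover have "\<forall>\<^sub>F y in nhds y0. dist y y0 < r"
    using assms by (auto simp: eventually_nhds_metric)
  ultimately show ?thesis
    unfolding eventually_prod_filter
    by (intro exI[of _ "\<lambda>y. dist y y0 < r"] exI[of _ "\<lambda>h. 0 < h \<and> h < r"]) auto
qed

lemma tendsto_near_right:
  fixes y0 :: "'a::metric_space" and c :: "'b::real_normed_vector"
  assumes "\<And>\<epsilon>. \<epsilon> > 0 \<Longrightarrow> \<exists>r>0. \<forall>y h. dist y y0 < r \<longrightarrow> 0 < h \<longrightarrow> h < r \<longrightarrow> norm (f y h - c) \<le> \<epsilon>"
  shows "((\<lambda>(y,h). f y h) \<longlongrightarrow> c) (nhds y0 \<times>\<^sub>F at_right (0::real))"
proof (rule tendstoI)
  fix e :: real assume "e > 0"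
  then obtain r where r: "r > 0" "\<And>y h. dist y y0 < r \<Longrightarrow> 0 < h \<Longrightarrow> h < r \<Longrightarrow> norm (f y h - c) \<le> e / 2"
    using assms[of "e / 2"] by auto
  show "\<forall>\<^sub>F x in nhds y0 \<times>\<^sub>F at_right 0. dist (case x of (y, h) \<Rightarrow> f y h) c < e"
    using eventually_near_right[OF r(1), of y0]
  proof (rule eventually_mono)
    fix x :: "'a \<times> real" assume "case x of (y, h) \<Rightarrow> dist y y0 < r \<and> 0 < h \<and> h < r"
    then show "dist (case x of (y, h) \<Rightarrow> f y h) c < e"
      using r(2)[of "fst x" "snd x"] \<open>e > 0\<close> by (auto simp: dist_norm split: prod.splits)
  qed
qed

text \<open>Joint convergence as (y, h) tends to (y0, 0+) is uniform for y near y0; a finite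
  subcover and the least of its radii make it uniform on K.\<close>

lemma uniform_near_right:
  fixes f :: "'a::metric_space \<Rightarrow> real \<Rightarrow> 'b::metric_space"
  assumes "compact K" and cont: "continuous_on K g"
    and lim: "\<And>y0. y0 \<in> K \<Longrightarrow> ((\<lambda>(y,h). f y h) \<longlongrightarrow> g y0) (nhds y0 \<times>\<^sub>F at_right 0)"
    and "\<epsilon> > 0"
  obtains h0 where "h0 > 0" "\<And>y h. y \<in> K \<Longrightarrow> 0 < h \<Longrightarrow> h < h0 \<Longrightarrow> dist (f y h) (g y) < \<epsilon>"
proof -
  have "\<exists>r>0. \<forall>y h. y \<in> K \<longrightarrow> dist y y0 < r \<longrightarrow> 0 < h \<longrightarrow> h < r \<longrightarrow> dist (f y h) (g y) < \<epsilon>"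
    if y0: "y0 \<in> K" for y0
  proof -
    have "\<forall>\<^sub>F x in nhds y0 \<times>\<^sub>F at_right 0. dist (case x of (y,h) \<Rightarrow> f y h) (g y0) < \<epsilon> / 2"
      using \<open>\<epsilon> > 0\<close> by (intro tendstoD[OF lim[OF y0]]) simp
    then obtain P Q where PQ: "eventually P (nhds y0)" "eventually Q (at_right 0)"
      "\<And>y h. P y \<Longrightarrow> Q h \<Longrightarrow> dist (f y h) (g y0) < \<epsilon> / 2"
      unfolding eventually_prod_filter by auto
    obtain r1 where r1: "r1 > 0" "\<And>y. dist y y0 < r1 \<Longrightarrow> P y"
      using PQ(1) unfolding eventually_nhds_metric by blast
    obtain r2 where r2: "r2 > 0" "\<And>h. 0 < h \<Longrightarrow> h < r2 \<Longrightarrow> Q h"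
      using PQ(2) unfolding eventually_at_right_field by blast
    obtain r3 where r3: "r3 > 0" "\<And>y. y \<in> K \<Longrightarrow> dist y y0 < r3 \<Longrightarrow> dist (g y) (g y0) < \<epsilon> / 2"
      using cont y0 \<open>\<epsilon> > 0\<close> unfolding continuous_on_iff by (metis half_gt_zero)
    have "dist (f y h) (g y) < \<epsilon>"
      if "y \<in> K" "dist y y0 < min r1 (min r2 r3)" "0 < h" "h < min r1 (min r2 r3)" for y h
      using dist_triangle_half_r[of "g y0" "f y h" \<epsilon> "g y"] PQ(3)[of y h] r1(2)[of y] r2(2)[of h] r3(2)[of y] that
      by (simp add: dist_commute)
    then show ?thesis using r1 r2 r3 by (intro exI[of _ "min r1 (min r2 r3)"]) auto
  qed
  then obtain r where r: "\<And>y0. y0 \<in> K \<Longrightarrow> r y0 > 0"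
    "\<And>y0 y h. y0 \<in> K \<Longrightarrow> y \<in> K \<Longrightarrow> dist y y0 < r y0 \<Longrightarrow> 0 < h \<Longrightarrow> h < r y0 \<Longrightarrow> dist (f y h) (g y) < \<epsilon>"
    by metis
  have "K \<subseteq> (\<Union>y0\<in>K. ball y0 (r y0))" using r(1) by (auto intro!: bexI)
  then obtain T where T: "T \<subseteq> K" "finite T" "K \<subseteq> (\<Union>y0\<in>T. ball y0 (r y0))"
    using compactE_image[OF \<open>compact K\<close>, of K "\<lambda>y0. ball y0 (r y0)"] by auto
  \<comment> \<open>The 1 keeps the set nonempty in case the cover is empty.\<close>
  define h0 where "h0 = Min (insert 1 (r ` T))"
  have "h0 > 0" unfolding h0_def using T r(1) by (auto simp: Min_gr_iff)
  moreover have "dist (f y h) (g y) < \<epsilon>" if "y \<in> K" "0 < h" "h < h0" for y h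
  proof -
    obtain y0 where "y0 \<in> T" "dist y y0 < r y0" using T(3) \<open>y \<in> K\<close> by (auto simp: dist_commute)
    moreover have "h0 \<le> r y0" unfolding h0_def using T(2) \<open>y0 \<in> T\<close> by (intro Min_le) auto
    ultimately show ?thesis using r(2)[of y0 y h] T(1) that by auto
  qed
  ultimately show thesis by (rule that)
qed

text \<open>Cramer's rule makes the entries of the inverse quotients of polynomials in the entries
  of A, which is how its continuity is obtained below.\<close>

lemma matrix_inv_cramer:
  fixes A :: "real^'r^'r"
  assumes "A ** matrix_inv A = mat 1"
  shows "matrix_inv A = (\<chi> k l. det (\<chi> i j. if j = k then axis l 1 $ i else A $ i $ j) / det A)"
    and "det A \<noteq> 0"
proof -
  show det: "det A \<noteq> 0" using assms by (metis det_I det_mul mult_eq_0_iff zero_neq_one)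
  have "A *v (matrix_inv A *v axis l 1) = axis l 1" for l
    by (simp add: matrix_vector_mul_assoc assms)
  then have "matrix_inv A *v axis l 1 = (\<chi> k. det (\<chi> i j. if j = k then axis l 1 $ i else A $ i $ j) / det A)" for l
    unfolding cramer[OF det] .
  then have "column l (matrix_inv A) $ k = det (\<chi> i j. if j = k then axis l 1 $ i else A $ i $ j) / det A" for l k
    by (simp add: matrix_vector_mult_basis)
  then show "matrix_inv A = (\<chi> k l. det (\<chi> i j. if j = k then axis l 1 $ i else A $ i $ j) / det A)"
    by (simp add: vec_eq_iff column_def)
qed

lemma continuous_on_matrix_inv:
  fixes G :: "'a::topological_space \<Rightarrow> real^'r^'r"
  assumes "continuous_on U G" "\<And>x. x \<in> U \<Longrightarrow> G x ** matrix_inv (G x) = mat 1"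
  shows "continuous_on U (\<lambda>x. matrix_inv (G x))"
proof -
  have c: "continuous_on U (\<lambda>x. G x $ i $ j)" for i j
    using assms(1) by (intro continuous_intros)
  have cd: "continuous_on U (\<lambda>x. det (B x))"
    if "\<And>i j. continuous_on U (\<lambda>x. B x $ i $ j)" for B :: "'a \<Rightarrow> real^'r^'r"
    unfolding det_def
    by (intro continuous_on_sum continuous_on_mult continuous_on_prod continuous_on_const that)
  have "continuous_on U (\<lambda>x. \<chi> k l. det (\<chi> i j. if j = k then axis l 1 $ i else G x $ i $ j) / det (G x))"
  proof (intro continuous_on_vec_lambda continuous_on_divide cd ballI)
    fix k l i j :: 'r
    show "continuous_on U (\<lambda>x. G x $ i $ j)" by (rule c)
    show "continuous_on U (\<lambda>x. (\<chi> i j. if j = k then axis l 1 $ i else G x $ i $ j) $ i $ j)"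
      by (cases "j = k") (simp_all add: c)
  next
    fix x assume "x \<in> U" then show "det (G x) \<noteq> 0" using matrix_inv_cramer(2) assms(2) by blast
  qed
  then show ?thesis
    by (rule continuous_on_cong[THEN iffD1, rotated -1]) (simp_all add: matrix_inv_cramer(1)[OF assms(2), symmetric])
qed

text \<open>The derivatives are parameters instead of \<open>pd\<close> applied to G, so that
  weighted metrics can be interpreted with explicit formulas for theirs.\<close>

locale C2_metric =
  fixes U :: "(real,'n::{finite,linorder}) vec set" and G :: "(real,'n) vec \<Rightarrow> real^'r^'r"
    and P :: "'n \<Rightarrow> (real,'n) vec \<Rightarrow> real^'r^'r" and S :: "'n \<Rightarrow> 'n \<Rightarrow> (real,'n) vec \<Rightarrow> real^'r^'r"
  assumes U: "open U"
    and G: "\<And>x. x \<in> U \<Longrightarrow> pos_def_sym (G x)"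
    and cont_G: "continuous_on U G" and cont_P: "\<And>i. continuous_on U (P i)"
    and cont_S: "\<And>i j. continuous_on U (S i j)"
    and deriv_G: "\<And>i x. x \<in> U \<Longrightarrow> has_pderiv G i (P i x) x"
    and deriv_P: "\<And>i j x. x \<in> U \<Longrightarrow> has_pderiv (P j) i (S i j x) x"
begin

text \<open>This is - G \<partial>_i (G^{-1} \<partial>_j G), a coefficient of the curvature
  operator lowered with G; see \<open>pd_connection\<close>.\<close>

definition M :: "'n \<Rightarrow> 'n \<Rightarrow> (real,'n) vec \<Rightarrow> real^'r^'r" where
  "M i j x = P i x ** matrix_inv (G x) ** P j x - S i j x"

lemma cont_inv: "continuous_on U (\<lambda>x. matrix_inv (G x))"
  using cont_G G pos_def_sym_matrix_inv by (intro continuous_on_matrix_inv) auto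

lemma cont_M: "continuous_on U (M i j)"
  unfolding M_def by (intro continuous_intros continuous_on_matrix_matrix cont_P cont_S cont_inv)

text \<open>The discrete curvature: \<open>G\<close> times the coefficient \<open>metric_lattice.C\<close> of the commutator of \<open>D j\<close>
  with the adjoint of \<open>D i\<close>.\<close>

definition GC :: "'n \<Rightarrow> 'n \<Rightarrow> (real,'n) vec \<Rightarrow> real \<Rightarrow> real^'r^'r" where
  "GC i j y h = G y ** (matrix_inv (G (y + h *\<^sub>R axis j 1)) ** G (y + h *\<^sub>R axis j 1 - h *\<^sub>R axis i 1)
    - matrix_inv (G y) ** G (y - h *\<^sub>R axis i 1)) /\<^sub>R h\<^sup>2"

text \<open>Let Q be the backward quotient in direction i and Y = y + h e_j. Inserting G(z - h e_i)
  = G(z) - h Q(z) shows that \<open>GC\<close> is exactly ((G(Y) - G(y))/h) G(Y)^{-1} Q(Y) - (Q(Y) -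
  Q(y))/h. Every factor has a limit, and the shift direction j becomes the first index of
  \<open>M\<close>.\<close>

lemma GC_tendsto:
  assumes y0: "y0 \<in> U"
  shows "((\<lambda>(y,h). GC i j y h) \<longlongrightarrow> M j i y0) (nhds y0 \<times>\<^sub>F at_right 0)"
proof -
  let ?F = "nhds y0 \<times>\<^sub>F at_right (0::real)"
  define Q where "Q y h = (G y - G (y - h *\<^sub>R axis i 1)) /\<^sub>R h" for y h
  define Y where "Y y h = y + h *\<^sub>R axis j (1::real)" for y :: "(real,'n) vec" and h
  have T1: "((\<lambda>(y,h). (Q (Y y h) h - Q y h) /\<^sub>R h) \<longlongrightarrow> S j i y0) ?F"
  proof (rule tendsto_near_right)
    fix \<epsilon> :: real assume "\<epsilon> > 0"
    then obtain r where r: "r > 0" "\<And>y a b. dist y y0 < r \<Longrightarrow> \<bar>a\<bar> < r \<Longrightarrow> \<bar>b\<bar> < r \<Longrightarrow>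
      norm (G (y + a *\<^sub>R axis j 1 + b *\<^sub>R axis i 1) - G (y + b *\<^sub>R axis i 1)
        - (G (y + a *\<^sub>R axis j 1) - G y) - (a * b) *\<^sub>R S j i y0) \<le> \<bar>a\<bar> * \<bar>b\<bar> * \<epsilon>"
      using pderiv_second_difference[OF U y0 deriv_G deriv_P cont_S] by metis
    have "norm ((Q (Y y h) h - Q y h) /\<^sub>R h - S j i y0) \<le> \<epsilon>" if "dist y y0 < r" "0 < h" "h < r" for y h
    proof -
      \<comment> \<open>The choice b = - h gives the backward difference in direction i; its sign is
        absorbed by a * b = - h^2.\<close>
      have "norm (G (y + h *\<^sub>R axis j 1 + (-h) *\<^sub>R axis i 1) - G (y + (-h) *\<^sub>R axis i 1)
        - (G (y + h *\<^sub>R axis j 1) - G y) - (h * (-h)) *\<^sub>R S j i y0) \<le> \<bar>h\<bar> * \<bar>-h\<bar> * \<epsilon>"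
        using that by (intro r(2)) auto
      also have "G (y + h *\<^sub>R axis j 1 + (-h) *\<^sub>R axis i 1) - G (y + (-h) *\<^sub>R axis i 1)
        - (G (y + h *\<^sub>R axis j 1) - G y) - (h * (-h)) *\<^sub>R S j i y0 =
        (- (h\<^sup>2)) *\<^sub>R ((Q (Y y h) h - Q y h) /\<^sub>R h - S j i y0)"
        using that by (simp add: Q_def Y_def power2_eq_square algebra_simps)
      finally show ?thesis using that by (simp add: power2_eq_square)
    qed
    then show "\<exists>r>0. \<forall>y h. dist y y0 < r \<longrightarrow> 0 < h \<longrightarrow> h < r \<longrightarrow> norm ((Q (Y y h) h - Q y h) /\<^sub>R h - S j i y0) \<le> \<epsilon>"
      using r(1) by blast
  qed
  have T2: "((\<lambda>(y,h). (G (Y y h) - G y) /\<^sub>R h) \<longlongrightarrow> P j y0) ?F"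
  proof (rule tendsto_near_right)
    fix \<epsilon> :: real assume "\<epsilon> > 0"
    then obtain r where r: "r > 0" "\<And>y h. dist y y0 < r \<Longrightarrow> \<bar>h\<bar> < r \<Longrightarrow>
      norm (G (y + h *\<^sub>R axis j 1) - G y - h *\<^sub>R P j y0) \<le> \<bar>h\<bar> * \<epsilon>"
      using pderiv_difference_quotient[OF U y0 deriv_G cont_P] by metis
    have "norm ((G (Y y h) - G y) /\<^sub>R h - P j y0) \<le> \<epsilon>" if "dist y y0 < r" "0 < h" "h < r" for y h
    proof -
      have "G (y + h *\<^sub>R axis j 1) - G y - h *\<^sub>R P j y0 = h *\<^sub>R ((G (Y y h) - G y) /\<^sub>R h - P j y0)"
        using that by (simp add: Y_def algebra_simps)
      then show ?thesis using r(2)[of y h] that by simp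
    qed
    then show "\<exists>r>0. \<forall>y h. dist y y0 < r \<longrightarrow> 0 < h \<longrightarrow> h < r \<longrightarrow> norm ((G (Y y h) - G y) /\<^sub>R h - P j y0) \<le> \<epsilon>"
      using r(1) by blast
  qed
  have near_Y: "dist (Y y h) y0 < r" if "dist y y0 < r / 2" "0 < h" "h < r / 2" for y h r
  proof -
    have "dist (Y y h) y0 \<le> dist (Y y h) y + dist y y0" by (rule dist_triangle)
    also have "dist (Y y h) y = h" using that by (simp add: Y_def dist_norm)
    finally show ?thesis using that by simp
  qed
  have T3: "((\<lambda>(y,h). Q (Y y h) h) \<longlongrightarrow> P i y0) ?F"
  proof (rule tendsto_near_right)
    fix \<epsilon> :: real assume "\<epsilon> > 0"
    then obtain r where r: "r > 0" "\<And>y h. dist y y0 < r \<Longrightarrow> \<bar>h\<bar> < r \<Longrightarrow>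
      norm (G (y + h *\<^sub>R axis i 1) - G y - h *\<^sub>R P i y0) \<le> \<bar>h\<bar> * \<epsilon>"
      using pderiv_difference_quotient[OF U y0 deriv_G cont_P] by metis
    have "norm (Q (Y y h) h - P i y0) \<le> \<epsilon>" if "dist y y0 < r / 2" "0 < h" "h < r / 2" for y h
    proof -
      have "G (Y y h + (-h) *\<^sub>R axis i 1) - G (Y y h) - (-h) *\<^sub>R P i y0 = (-h) *\<^sub>R (Q (Y y h) h - P i y0)"
        using that by (simp add: Q_def algebra_simps)
      then show ?thesis using r(2)[of "Y y h" "-h"] that near_Y[OF that] r(1) by simp
    qed
    then show "\<exists>r>0. \<forall>y h. dist y y0 < r \<longrightarrow> 0 < h \<longrightarrow> h < r \<longrightarrow> norm (Q (Y y h) h - P i y0) \<le> \<epsilon>"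
      using r(1) half_gt_zero by blast
  qed
  have T4: "((\<lambda>(y,h). matrix_inv (G (Y y h))) \<longlongrightarrow> matrix_inv (G y0)) ?F"
  proof (rule tendsto_near_right)
    fix \<epsilon> :: real assume "\<epsilon> > 0"
    have "isCont (\<lambda>x. matrix_inv (G x)) y0"
      using cont_inv U y0 by (simp add: continuous_on_eq_continuous_at)
    then obtain r where r: "r > 0" "\<And>y. dist y y0 < r \<Longrightarrow> dist (matrix_inv (G y)) (matrix_inv (G y0)) < \<epsilon>"
      using \<open>\<epsilon> > 0\<close> unfolding continuous_at_eps_delta by blast
    then have "norm (matrix_inv (G (Y y h)) - matrix_inv (G y0)) \<le> \<epsilon>"
      if "dist y y0 < r / 2" "0 < h" "h < r / 2" for y h
      using near_Y[OF that] by (simp add: dist_norm less_imp_le)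
    then show "\<exists>r>0. \<forall>y h. dist y y0 < r \<longrightarrow> 0 < h \<longrightarrow> h < r \<longrightarrow>
        norm (matrix_inv (G (Y y h)) - matrix_inv (G y0)) \<le> \<epsilon>"
      using r(1) half_gt_zero by blast
  qed
  have lim: "((\<lambda>x. (case x of (y,h) \<Rightarrow> (G (Y y h) - G y) /\<^sub>R h) ** (case x of (y,h) \<Rightarrow> matrix_inv (G (Y y h)))
      ** (case x of (y,h) \<Rightarrow> Q (Y y h) h) - (case x of (y,h) \<Rightarrow> (Q (Y y h) h - Q y h) /\<^sub>R h)) \<longlongrightarrow> M j i y0) ?F"
    unfolding M_def by (intro tendsto_diff tendsto_matrix_matrix T1 T2 T3 T4)
  obtain r where r: "r > 0" "ball y0 r \<subseteq> U" using U y0 open_contains_ball by blast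
  have ev: "\<forall>\<^sub>F x in ?F. case x of (y,h) \<Rightarrow> dist y y0 < r / 2 \<and> 0 < h \<and> h < r / 2"
    using r(1) by (intro eventually_near_right) simp
  show ?thesis
  proof (rule Lim_transform_eventually[OF lim], rule eventually_mono[OF ev])
    fix x :: "(real,'n) vec \<times> real"
    assume near: "case x of (y,h) \<Rightarrow> dist y y0 < r / 2 \<and> 0 < h \<and> h < r / 2"
    obtain y h where x: "x = (y,h)" by (cases x)
    have h: "0 < h" and yU: "y \<in> U" and YU: "Y y h \<in> U"
      using near near_Y[of y r h] r by (auto simp: x dist_commute)
    let ?H = "\<lambda>x. matrix_inv (G x)"
    let ?y = "Y y h"
    have inv: "G y ** ?H y = mat 1" "?H y ** G y = mat 1" "G ?y ** ?H ?y = mat 1" "?H ?y ** G ?y = mat 1"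
      using pos_def_sym_matrix_inv G yU YU by auto
    have GQ: "G (z - h *\<^sub>R axis i 1) = G z - h *\<^sub>R Q z h" for z
      using h by (simp add: Q_def)
    have "GC i j y h = G y ** (?H ?y ** (G ?y - h *\<^sub>R Q ?y h) - ?H y ** (G y - h *\<^sub>R Q y h)) /\<^sub>R h\<^sup>2"
      unfolding GC_def Y_def[symmetric] GQ ..
    also have "\<dots> = (h *\<^sub>R Q y h - h *\<^sub>R (G y ** ?H ?y ** Q ?y h)) /\<^sub>R h\<^sup>2"
      by (simp add: matrix_diff_ldistrib matrix_scalar_ac scalar_matrix_assoc[symmetric] matrix_mul_assoc inv)
    also have "G y ** ?H ?y ** Q ?y h = Q ?y h - (G ?y - G y) ** ?H ?y ** Q ?y h"
      by (simp add: matrix_diff_rdistrib inv)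
    finally have "GC i j y h = (h *\<^sub>R Q y h - h *\<^sub>R (Q ?y h - (G ?y - G y) ** ?H ?y ** Q ?y h)) /\<^sub>R h\<^sup>2" .
    also have "\<dots> = ((G ?y - G y) ** ?H ?y ** Q ?y h) /\<^sub>R h - (Q ?y h - Q y h) /\<^sub>R h"
    proof -
      have "(h *\<^sub>R u - h *\<^sub>R (v - w)) /\<^sub>R h\<^sup>2 = w /\<^sub>R h - (v - u) /\<^sub>R h" for u v w :: "real^'r^'r"
      proof -
        have "h * inverse (h\<^sup>2) = inverse h" using h by (simp add: power2_eq_square)
        then show ?thesis by (simp add: scaleR_right_diff_distrib mult.commute)
      qed
      then show ?thesis .
    qed
    also have "((G ?y - G y) ** ?H ?y ** Q ?y h) /\<^sub>R h = ((G ?y - G y) /\<^sub>R h) ** ?H ?y ** Q ?y h"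
      by (simp only: scalar_matrix_assoc)
    finally show "(case x of (y,h) \<Rightarrow> (G (Y y h) - G y) /\<^sub>R h) ** (case x of (y,h) \<Rightarrow> matrix_inv (G (Y y h)))
      ** (case x of (y,h) \<Rightarrow> Q (Y y h) h) - (case x of (y,h) \<Rightarrow> (Q (Y y h) h - Q y h) /\<^sub>R h) =
      (case x of (y,h) \<Rightarrow> GC i j y h)"
      by (simp only: x prod.case)
  qed
qed

lemma GC_uniform:
  assumes "compact K" "K \<subseteq> U" "\<epsilon> > 0"
  obtains h0 where "h0 > 0" "\<And>y h i j. y \<in> K \<Longrightarrow> 0 < h \<Longrightarrow> h < h0 \<Longrightarrow> norm (GC i j y h - M j i y) < \<epsilon>"
proof -
  have "\<exists>h0. h0 > 0 \<and> (\<forall>y h. y \<in> K \<longrightarrow> 0 < h \<longrightarrow> h < h0 \<longrightarrow> norm (GC i j y h - M j i y) < \<epsilon>)" for i j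
  proof -
    have "((\<lambda>(y,h). GC i j y h) \<longlongrightarrow> M j i y0) (nhds y0 \<times>\<^sub>F at_right 0)" if "y0 \<in> K" for y0
      using that assms(2) by (intro GC_tendsto) auto
    then obtain h0 where "h0 > 0" "\<And>y h. y \<in> K \<Longrightarrow> 0 < h \<Longrightarrow> h < h0 \<Longrightarrow> dist (GC i j y h) (M j i y) < \<epsilon>"
      using uniform_near_right[OF assms(1) continuous_on_subset[OF cont_M assms(2)] _ assms(3)] by blast
    then show ?thesis unfolding dist_norm by (intro exI[of _ h0]) simp
  qed
  then have "\<forall>i j. \<exists>h0. h0 > 0 \<and> (\<forall>y h. y \<in> K \<longrightarrow> 0 < h \<longrightarrow> h < h0 \<longrightarrow> norm (GC i j y h - M j i y) < \<epsilon>)"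
    by simp
  then obtain H where H': "\<forall>i j. H i j > 0 \<and> (\<forall>y h. y \<in> K \<longrightarrow> 0 < h \<longrightarrow> h < H i j \<longrightarrow> norm (GC i j y h - M j i y) < \<epsilon>)"
    unfolding choice_iff by blast
  then have H: "H i j > 0" "y \<in> K \<Longrightarrow> 0 < h \<Longrightarrow> h < H i j \<Longrightarrow> norm (GC i j y h - M j i y) < \<epsilon>" for i j y h
    by simp_all
  define h0 where "h0 = Min (range (\<lambda>(i,j). H i j))"
  have h0: "h0 > 0" unfolding h0_def using H(1) by (subst Min_gr_iff) auto
  have le: "h0 \<le> H i j" for i j unfolding h0_def by (rule Min_le) auto
  have "norm (GC i j y h - M j i y) < \<epsilon>" if "y \<in> K" "0 < h" "h < h0" for y h i j
    using H(2)[of y h i j] that le[of i j] by simp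
  with h0 show thesis by (rule that)
qed

end

section \<open>Sampling a metric on a grid: the error in the Bochner identity\<close>

definition lattice_point :: "real^'n \<Rightarrow> real \<Rightarrow> ('n \<Rightarrow> int) \<Rightarrow> real^'n" where
  "lattice_point z h k = z + h *\<^sub>R (\<chi> i. real_of_int (k i))"

lemma lattice_point_nth [simp]: "lattice_point z h k $ i = z $ i + h * real_of_int (k i)"
  by (simp add: lattice_point_def)

lemma lattice_point_upd:
  "lattice_point z h (k(i := k i + 1)) = lattice_point z h k + h *\<^sub>R axis i 1"
  "lattice_point z h (k(i := k i - 1)) = lattice_point z h k - h *\<^sub>R axis i 1"
  by (auto simp: vec_eq_iff axis_def algebra_simps)

context lattice
begin

text \<open>Together with \<open>energy0\<close> the Euclidean counterpart of \<open>ip\<close> and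
  \<open>energy\<close>. Discretization errors are measured in these; eigenvalue bounds of a metric
  convert them afterwards.\<close>

definition norm2 :: "(('n \<Rightarrow> int) \<Rightarrow> 'n set \<Rightarrow> real^'r) \<Rightarrow> real" where
  "norm2 \<alpha> = (\<Sum>I\<in>UNIV. \<Sum>k\<in>X. (norm (\<alpha> k I))\<^sup>2)"

definition energy0 :: "(('n \<Rightarrow> int) \<Rightarrow> 'n set \<Rightarrow> real^'r) \<Rightarrow> real" where
  "energy0 \<alpha> = (\<Sum>J\<in>UNIV. \<Sum>i\<in>-J. \<Sum>k\<in>X. (norm (D i (\<lambda>k. \<alpha> k (insert i J)) k))\<^sup>2) +
    (\<Sum>J\<in>UNIV. \<Sum>i\<in>-J. \<Sum>k\<in>Box (insert i J). (norm (D i (\<lambda>k. \<alpha> k J) k))\<^sup>2)"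

lemma norm2_nonneg [simp]: "norm2 \<alpha> \<ge> 0" and energy0_nonneg [simp]: "energy0 \<alpha> \<ge> 0"
  by (auto simp: norm2_def energy0_def intro!: sum_nonneg add_nonneg_nonneg)

lemma sum_norm2_le: "(\<Sum>k\<in>X. (norm (\<alpha> k I))\<^sup>2) \<le> norm2 \<alpha>"
  unfolding norm2_def by (rule member_le_sum) (auto intro: sum_nonneg)

lemma sum_D_le_energy0:
  assumes "i \<notin> J"
  shows "(\<Sum>k\<in>Box (insert i J). (norm (D i (\<lambda>k. \<alpha> k J) k))\<^sup>2) \<le> energy0 \<alpha>"
proof -
  have "(\<Sum>k\<in>Box (insert i J). (norm (D i (\<lambda>k. \<alpha> k J) k))\<^sup>2) \<le>
      (\<Sum>i\<in>-J. \<Sum>k\<in>Box (insert i J). (norm (D i (\<lambda>k. \<alpha> k J) k))\<^sup>2)"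
    using assms by (intro member_le_sum[of i "-J" "\<lambda>i. \<Sum>k\<in>Box (insert i J). (norm (D i (\<lambda>k. \<alpha> k J) k))\<^sup>2"])
      (auto intro: sum_nonneg)
  also have "\<dots> \<le> (\<Sum>J\<in>UNIV. \<Sum>i\<in>-J. \<Sum>k\<in>Box (insert i J). (norm (D i (\<lambda>k. \<alpha> k J) k))\<^sup>2)"
    by (intro member_le_sum[of J UNIV "\<lambda>J. \<Sum>i\<in>-J. \<Sum>k\<in>Box (insert i J). (norm (D i (\<lambda>k. \<alpha> k J) k))\<^sup>2"])
      (simp_all add: sum_nonneg)
  also have "\<dots> \<le> energy0 \<alpha>"
    unfolding energy0_def by (auto intro!: sum_nonneg)
  finally show ?thesis .
qed

end

context C2_metric
begin

text \<open>The form <Theta a, a>_g, summed over J = I - {i} instead of I, which is the shape in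
  which the Bochner identity delivers it; see \<open>form_inner_curv\<close>.\<close>

definition curv :: "(real,'n) vec \<Rightarrow> ('n set \<Rightarrow> real^'r) \<Rightarrow> real" where
  "curv x a = (\<Sum>J\<in>UNIV. \<Sum>i\<in>-J. \<Sum>j\<in>-J. isgn i J * isgn j J * (a (insert j J) \<bullet> (M j i x *v a (insert i J))))"

end

locale C2_lattice = C2_metric U G P S + lattice L h dummy
  for U and G :: "(real,'n::{finite,linorder}) vec \<Rightarrow> real^'r^'r" and P S and L h and dummy :: "'n itself" +
  fixes z :: "(real,'n) vec"
  assumes point_in_U: "k \<in> X \<Longrightarrow> lattice_point z h k \<in> U"
begin

abbreviation pt :: "('n \<Rightarrow> int) \<Rightarrow> (real,'n) vec" where "pt \<equiv> lattice_point z h"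

sublocale metric_lattice L h dummy "\<lambda>k. G (pt k)" "\<lambda>k. matrix_inv (G (pt k))"
proof
  fix k :: "'n \<Rightarrow> int" assume "k \<in> X"
  then have "pos_def_sym (G (pt k))" using G point_in_U by blast
  then show "u \<bullet> (G (pt k) *v v) = v \<bullet> (G (pt k) *v u)" "G (pt k) ** matrix_inv (G (pt k)) = mat 1"
    "matrix_inv (G (pt k)) ** G (pt k) = mat 1" "v \<noteq> 0 \<Longrightarrow> v \<bullet> (G (pt k) *v v) > 0" for u v
    using pos_def_sym_matrix_inv inner_symmetric_matrix unfolding pos_def_sym_def by blast+
qed

text \<open>The two inequalities exclude a wrap-around of the shifts, so that \<open>up j\<close>
  and \<open>dn i\<close> are genuine translations by h.\<close>

lemma C_eq_GC:
  assumes "1 \<le> k i" "k j + 1 < L" "k \<in> X"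
  shows "G (pt k) ** C i j k = GC i j (pt k) h"
proof -
  have k: "0 \<le> k l" "k l < L" for l using assms(3) by (auto simp: X_def)
  have up: "up j k = k(j := k j + 1)" using assms(2) k[of j] by (simp add: up_def)
  have dn: "dn i k = k(i := k i - 1)"
    using assms(1) k[of i] by (simp add: dn_def)
  have "dn i (up j k) = (k(j := k j + 1))(i := (k(j := k j + 1)) i - 1)"
    unfolding up unfolding dn_def using assms(1) k[of i] k[of j] by (simp add: fun_eq_iff)
  then have 1: "pt (dn i (up j k)) = pt k + h *\<^sub>R axis j 1 - h *\<^sub>R axis i 1"
    by (simp only: lattice_point_upd)
  have 2: "pt (dn i k) = pt k - h *\<^sub>R axis i 1" "pt (up j k) = pt k + h *\<^sub>R axis j 1"
    by (simp_all only: dn up lattice_point_upd)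
  show ?thesis
    unfolding C_def A_def GC_def 1 2 by (simp only: matrix_scalar_ac scalar_matrix_assoc)
qed

text \<open>For i = j the two shifts of the argument cancel, so the only error is that of replacing
  \<open>GC\<close> by \<open>M\<close>.\<close>

lemma curvature_term_diagonal:
  assumes \<alpha>: "cochain q \<alpha>" and "i \<in> I"
    and approx: "\<And>k. k \<in> X \<Longrightarrow> norm (GC i i (pt k) h - M i i (pt k)) \<le> \<omega>"
  shows "\<bar>(\<Sum>k\<in>X. \<alpha> k I \<bullet> (G (pt k) *v (C i i k *v \<alpha> (up i (dn i k)) I))) -
    (\<Sum>k\<in>X. \<alpha> k I \<bullet> (M i i (pt k) *v \<alpha> k I))\<bar> \<le> \<omega> * norm2 \<alpha>"
proof -
  have "\<bar>\<alpha> k I \<bullet> (G (pt k) *v (C i i k *v \<alpha> (up i (dn i k)) I)) - \<alpha> k I \<bullet> (M i i (pt k) *v \<alpha> k I)\<bar>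
    \<le> \<omega> * (norm (\<alpha> k I))\<^sup>2" if k: "k \<in> X" for k
  proof (cases "k \<in> Box I")
    case True
    then have "1 \<le> k i" "k i + 1 < L" using Box_le[OF True, of i] \<open>i \<in> I\<close> by auto
    then have "G (pt k) ** C i i k = GC i i (pt k) h" using k by (intro C_eq_GC)
    then have "\<alpha> k I \<bullet> (G (pt k) *v (C i i k *v \<alpha> (up i (dn i k)) I)) - \<alpha> k I \<bullet> (M i i (pt k) *v \<alpha> k I)
      = \<alpha> k I \<bullet> ((GC i i (pt k) h - M i i (pt k)) *v \<alpha> k I)"
      using k by (simp add: matrix_vector_mul_assoc matrix_vector_mult_diff_rdistrib inner_diff_right)
    also have "\<bar>\<dots>\<bar> \<le> norm (GC i i (pt k) h - M i i (pt k)) * norm (\<alpha> k I) * norm (\<alpha> k I)"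
      by (rule abs_inner_matrix_le)
    also have "\<dots> \<le> \<omega> * (norm (\<alpha> k I))\<^sup>2"
      unfolding power2_eq_square mult.assoc by (intro mult_right_mono approx k) auto
    finally show ?thesis .
  next
    case False
    then show ?thesis using cochain_zero(1)[OF \<alpha>] by simp
  qed
  then have "\<bar>(\<Sum>k\<in>X. \<alpha> k I \<bullet> (G (pt k) *v (C i i k *v \<alpha> (up i (dn i k)) I))) -
    (\<Sum>k\<in>X. \<alpha> k I \<bullet> (M i i (pt k) *v \<alpha> k I))\<bar> \<le> (\<Sum>k\<in>X. \<omega> * (norm (\<alpha> k I))\<^sup>2)"
    unfolding sum_subtractf[symmetric] by (intro order.trans[OF sum_abs] sum_mono)
  also have "\<dots> \<le> \<omega> * norm2 \<alpha>"
  proof -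
    have "(\<lambda>_. 0) \<in> X" using L by (simp add: X_def)
    then have "\<omega> \<ge> 0" using approx norm_ge_zero order.trans by blast
    then show ?thesis unfolding sum_distrib_left[symmetric] by (intro mult_left_mono sum_norm2_le)
  qed
  finally show ?thesis .
qed

text \<open>Write the difference as a'(N - M)b' + (a' - a)Mb' + aM(b' - b). Moving an argument by
  one grid step costs h times a difference quotient, and splitting products into squares prepares
  the absorption of these quotients by the energy.\<close>

lemma perturbed_product_le:
  fixes N M :: "real^'r^'r"
  assumes "norm (N - M) \<le> \<omega>" "norm M \<le> B"
  shows "\<bar>a' \<bullet> (N *v b') - a \<bullet> (M *v b)\<bar> \<le>
    \<omega> / 2 * ((norm a')\<^sup>2 + (norm b')\<^sup>2) +
    h * B / 2 * ((norm ((a' - a) /\<^sub>R h))\<^sup>2 + (norm b')\<^sup>2 + (norm a)\<^sup>2 + (norm ((b' - b) /\<^sub>R h))\<^sup>2)"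
proof -
  define u where "u = (a' - a) /\<^sub>R h"
  define v where "v = (b' - b) /\<^sub>R h"
  have amgm: "x * y \<le> (x\<^sup>2 + y\<^sup>2) / 2" for x y :: real
    using sum_squares_bound[of x y] by simp
  have a': "a' = a + h *\<^sub>R u" and b': "b' = b + h *\<^sub>R v" using h by (simp_all add: u_def v_def)
  have "a' \<bullet> (N *v b') - a \<bullet> (M *v b) = a' \<bullet> ((N - M) *v b') + h * (u \<bullet> (M *v b')) + h * (a \<bullet> (M *v v))"
    by (simp add: matrix_vector_mult_diff_rdistrib inner_diff_right)
      (simp add: a' b' matrix_vector_right_distrib matrix_vector_mult_scaleR algebra_simps inner_add_right)
  also have "\<bar>\<dots>\<bar> \<le> \<bar>a' \<bullet> ((N - M) *v b')\<bar> + h * \<bar>u \<bullet> (M *v b')\<bar> + h * \<bar>a \<bullet> (M *v v)\<bar>"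
    using h abs_triangle_ineq[of "a' \<bullet> ((N - M) *v b') + h * (u \<bullet> (M *v b'))" "h * (a \<bullet> (M *v v))"]
      abs_triangle_ineq[of "a' \<bullet> ((N - M) *v b')" "h * (u \<bullet> (M *v b'))"] by (simp add: abs_mult)
  finally have split: "\<bar>a' \<bullet> (N *v b') - a \<bullet> (M *v b)\<bar> \<le>
    \<bar>a' \<bullet> ((N - M) *v b')\<bar> + h * \<bar>u \<bullet> (M *v b')\<bar> + h * \<bar>a \<bullet> (M *v v)\<bar>" .
  have bound: "\<bar>x \<bullet> (K *v y)\<bar> \<le> c * (((norm x)\<^sup>2 + (norm y)\<^sup>2) / 2)" if "norm K \<le> c" for x y c and K :: "real^'r^'r"
  proof -
    have "\<bar>x \<bullet> (K *v y)\<bar> \<le> norm K * (norm x * norm y)"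
      using abs_inner_matrix_le[of x K y] by (simp add: mult.assoc)
    also have "\<dots> \<le> c * (((norm x)\<^sup>2 + (norm y)\<^sup>2) / 2)"
      using that order.trans[OF norm_ge_zero that] by (intro mult_mono amgm) auto
    finally show ?thesis .
  qed
  have "\<bar>a' \<bullet> ((N - M) *v b')\<bar> + h * \<bar>u \<bullet> (M *v b')\<bar> + h * \<bar>a \<bullet> (M *v v)\<bar> \<le>
    \<omega> * (((norm a')\<^sup>2 + (norm b')\<^sup>2) / 2) + h * (B * (((norm u)\<^sup>2 + (norm b')\<^sup>2) / 2)) +
    h * (B * (((norm a)\<^sup>2 + (norm v)\<^sup>2) / 2))"
    using h by (intro add_mono mult_left_mono bound assms) auto
  with split show ?thesis
    unfolding u_def[symmetric] v_def[symmetric] by (simp add: field_simps)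
qed

text \<open>Substituting k = \<open>up i m\<close> puts the two arguments at \<open>up i m\<close>
  and \<open>up j m\<close>, both neighbours of m. Moving them to m costs differences in direction i
  of the component \<open>insert j J\<close> and in direction j of \<open>insert i J\<close>, which
  are among those counted by \<open>energy0\<close>. Outside the box of J with i and j added both
  products vanish. The factor 2 of \<omega> covers replacing \<open>GC\<close> by \<open>M\<close>
  and moving \<open>M\<close> to m.\<close>

lemma curvature_term_offdiagonal:
  assumes \<alpha>: "cochain q \<alpha>" and ij: "i \<noteq> j" "i \<notin> J" "j \<notin> J"
    and approx: "\<And>k. k \<in> X \<Longrightarrow> norm (GC i j (pt k) h - M j i (pt k)) \<le> \<omega>"
    and osc: "\<And>k. k \<in> X \<Longrightarrow> k i + 1 < L \<Longrightarrow> norm (M j i (pt (up i k)) - M j i (pt k)) \<le> \<omega>"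
    and bd: "\<And>k. k \<in> X \<Longrightarrow> norm (M j i (pt k)) \<le> B"
  shows "\<bar>(\<Sum>k\<in>X. \<alpha> k (insert j J) \<bullet> (G (pt k) *v (C i j k *v \<alpha> (up j (dn i k)) (insert i J)))) -
    (\<Sum>k\<in>X. \<alpha> k (insert j J) \<bullet> (M j i (pt k) *v \<alpha> k (insert i J)))\<bar>
    \<le> (2 * \<omega> + h * B) * (norm2 \<alpha> + energy0 \<alpha>)"
proof -
  let ?p = "insert j J" and ?r = "insert i J" and ?K = "insert i (insert j J)"
  have "(\<lambda>_. 0) \<in> X" using L by (simp add: X_def)
  then have nonneg: "\<omega> \<ge> 0" "B \<ge> 0" using approx bd norm_ge_zero order.trans by blast+
  define E where "E k = (if k \<in> Box ?K then (norm (D i (\<lambda>k. \<alpha> k ?p) k))\<^sup>2 + (norm (D j (\<lambda>k. \<alpha> k ?r) k))\<^sup>2 else 0)" for k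
  let ?n = "\<lambda>k I. (norm (\<alpha> k I))\<^sup>2"
  have "\<bar>\<alpha> (up i m) ?p \<bullet> (G (pt (up i m)) *v (C i j (up i m) *v \<alpha> (up j (dn i (up i m))) ?r)) -
      \<alpha> m ?p \<bullet> (M j i (pt m) *v \<alpha> m ?r)\<bar>
    \<le> \<omega> * (?n (up i m) ?p + ?n (up j m) ?r) + h * B / 2 * (?n (up j m) ?r + ?n m ?p + E m)" if m: "m \<in> X" for m
  proof (cases "m \<in> Box ?K")
    case True
    have le: "m i + 1 < L" "m j + 1 < L" "0 \<le> m i"
      using Box_le[OF True, of i] Box_le[OF True, of j] by auto
    have up: "up i m = m(i := m i + 1)" using up_no_wrap[OF True, of i] by simp
    have uX: "up i m \<in> X" using m by simp
    have "G (pt (up i m)) ** C i j (up i m) = GC i j (pt (up i m)) h"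
      using le ij uX by (intro C_eq_GC) (auto simp: up)
    then have N: "G (pt (up i m)) *v (C i j (up i m) *v \<alpha> (up j (dn i (up i m))) ?r) =
      GC i j (pt (up i m)) h *v \<alpha> (up j m) ?r"
      using m by (simp add: matrix_vector_mul_assoc)
    have "norm (GC i j (pt (up i m)) h - M j i (pt m)) \<le>
      norm (GC i j (pt (up i m)) h - M j i (pt (up i m))) + norm (M j i (pt (up i m)) - M j i (pt m))"
      by (rule norm_triangle_sub[of "GC i j (pt (up i m)) h - M j i (pt m)"
          "GC i j (pt (up i m)) h - M j i (pt (up i m))", simplified])
    also have "\<dots> \<le> 2 * \<omega>" using approx[OF uX] osc[OF m le(1)] by simp
    finally show ?thesis
      unfolding N using perturbed_product_le[OF _ bd[OF m], of _ "2 * \<omega>" "\<alpha> (up i m) ?p" "\<alpha> (up j m) ?r" "\<alpha> m ?p" "\<alpha> m ?r"]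
      by (simp add: E_def True D_def add_ac)
  next
    case False
    then have "\<not> ((m \<in> Box ?p \<or> up i m \<in> Box ?p) \<and> (m \<in> Box ?r \<or> up j m \<in> Box ?r))"
      using Box_insert2I[OF ij, of m] by blast
    then have "(\<alpha> m ?p = 0 \<and> \<alpha> (up i m) ?p = 0) \<or> (\<alpha> m ?r = 0 \<and> \<alpha> (up j m) ?r = 0)"
      using cochain_zero(1)[OF \<alpha>] by blast
    then have "\<alpha> (up i m) ?p \<bullet> (G (pt (up i m)) *v (C i j (up i m) *v \<alpha> (up j (dn i (up i m))) ?r)) -
      \<alpha> m ?p \<bullet> (M j i (pt m) *v \<alpha> m ?r) = 0" using m by auto
    moreover have "E m = 0" using False by (simp add: E_def)
    ultimately show ?thesis using nonneg h by simp
  qed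
  then have "\<bar>\<Sum>m\<in>X. \<alpha> (up i m) ?p \<bullet> (G (pt (up i m)) *v (C i j (up i m) *v \<alpha> (up j (dn i (up i m))) ?r)) -
      \<alpha> m ?p \<bullet> (M j i (pt m) *v \<alpha> m ?r)\<bar>
    \<le> (\<Sum>m\<in>X. \<omega> * (?n (up i m) ?p + ?n (up j m) ?r) + h * B / 2 * (?n (up j m) ?r + ?n m ?p + E m))"
    by (intro order.trans[OF sum_abs] sum_mono)
  also have "\<dots> = \<omega> * ((\<Sum>m\<in>X. ?n m ?p) + (\<Sum>m\<in>X. ?n m ?r)) +
      h * B / 2 * ((\<Sum>m\<in>X. ?n m ?r) + (\<Sum>m\<in>X. ?n m ?p) + (\<Sum>m\<in>X. E m))"
    using sum_up[of "\<lambda>m. ?n m ?p" i] sum_up[of "\<lambda>m. ?n m ?r" j]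
    by (simp only: sum.distrib sum_distrib_left[symmetric])
  also have "\<dots> \<le> \<omega> * (norm2 \<alpha> + norm2 \<alpha>) + h * B / 2 * (norm2 \<alpha> + norm2 \<alpha> + (energy0 \<alpha> + energy0 \<alpha>))"
  proof -
    have "(\<Sum>m\<in>X. E m) = (\<Sum>k\<in>Box ?K. (norm (D i (\<lambda>k. \<alpha> k ?p) k))\<^sup>2) + (\<Sum>k\<in>Box ?K. (norm (D j (\<lambda>k. \<alpha> k ?r) k))\<^sup>2)"
      unfolding E_def using Box_subset_X[of ?K] by (simp add: sum.If_cases Int_absorb1 sum.distrib)
    also have "\<dots> \<le> energy0 \<alpha> + energy0 \<alpha>"
      using sum_D_le_energy0[of i ?p \<alpha>] sum_D_le_energy0[of j ?r \<alpha>] ij by (simp add: insert_commute)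
    finally show ?thesis using nonneg h
      by (intro add_mono mult_left_mono sum_norm2_le) auto
  qed
  also have "\<dots> \<le> (2 * \<omega> + h * B) * (norm2 \<alpha> + energy0 \<alpha>)"
    using mult_nonneg_nonneg[OF nonneg(1), of "energy0 \<alpha>"] by (simp add: algebra_simps)
  finally show ?thesis
    using sum_up[of "\<lambda>k. \<alpha> k ?p \<bullet> (G (pt k) *v (C i j k *v \<alpha> (up j (dn i k)) ?r))" i]
    by (simp only: sum_subtractf)
qed

lemma Bochner_error:
  assumes \<alpha>: "cochain q \<alpha>"
    and approx: "\<And>i j k. k \<in> X \<Longrightarrow> norm (GC i j (pt k) h - M j i (pt k)) \<le> \<omega>"
    and osc: "\<And>i j k. k \<in> X \<Longrightarrow> k i + 1 < L \<Longrightarrow> norm (M j i (pt (up i k)) - M j i (pt k)) \<le> \<omega>"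
    and bd: "\<And>i j k. k \<in> X \<Longrightarrow> norm (M j i (pt k)) \<le> B"
  shows "\<bar>ip (\<delta> \<alpha>) (\<delta> \<alpha>) + ip (d \<alpha>) (d \<alpha>) - (\<Sum>k\<in>X. curv (pt k) (\<alpha> k)) - energy \<alpha>\<bar> \<le>
    real (card (UNIV :: 'n set set) * CARD('n) * CARD('n)) * ((2 * \<omega> + h * B) * (norm2 \<alpha> + energy0 \<alpha>))"
proof -
  let ?T = "\<lambda>i j J. \<Sum>k\<in>X. \<alpha> k (insert j J) \<bullet> (G (pt k) *v (C i j k *v \<alpha> (up j (dn i k)) (insert i J)))"
  let ?M = "\<lambda>i j J. \<Sum>k\<in>X. \<alpha> k (insert j J) \<bullet> (M j i (pt k) *v \<alpha> k (insert i J))"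
  let ?e = "(2 * \<omega> + h * B) * (norm2 \<alpha> + energy0 \<alpha>)"
  have "(\<lambda>_. 0) \<in> X" using L by (simp add: X_def)
  then have nonneg: "\<omega> \<ge> 0" "B \<ge> 0" using approx bd norm_ge_zero order.trans by blast+
  have e: "?e \<ge> 0" using nonneg h by (intro mult_nonneg_nonneg add_nonneg_nonneg) auto
  have curv: "(\<Sum>k\<in>X. curv (pt k) (\<alpha> k)) = (\<Sum>J\<in>UNIV. \<Sum>i\<in>-J. \<Sum>j\<in>-J. isgn i J * isgn j J * ?M i j J)"
    unfolding curv_def
    by (simp add: sum.swap[of _ X] sum_distrib_left)
  have "\<bar>isgn i J * isgn j J * (?T i j J - ?M i j J)\<bar> \<le> ?e" if "i \<notin> J" "j \<notin> J" for i j J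
  proof (cases "i = j")
    case True
    have "\<bar>?T i j J - ?M i j J\<bar> \<le> \<omega> * norm2 \<alpha>"
      unfolding True by (intro curvature_term_diagonal[OF \<alpha> _ approx]) auto
    also have "\<dots> \<le> ?e" using nonneg h by (intro mult_mono) auto
    finally show ?thesis by (simp add: abs_mult)
  next
    case False
    then show ?thesis
      using curvature_term_offdiagonal[OF \<alpha> False that approx osc bd] by (simp add: abs_mult)
  qed
  then have "\<bar>\<Sum>J\<in>UNIV. \<Sum>i\<in>-J. \<Sum>j\<in>-J. isgn i J * isgn j J * (?T i j J - ?M i j J)\<bar> \<le>
    (\<Sum>J\<in>(UNIV::'n set set). \<Sum>i\<in>-J. \<Sum>j\<in>-J. ?e)"
    by (intro order.trans[OF sum_abs] sum_mono) auto
  also have "\<dots> \<le> (\<Sum>J\<in>(UNIV::'n set set). \<Sum>i\<in>(UNIV::'n set). \<Sum>j\<in>(UNIV::'n set). ?e)"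
    using e by (intro sum_mono order.trans[OF sum_mono sum_mono2] sum_mono2) (auto intro!: sum_nonneg)
  also have "\<dots> = real (card (UNIV :: 'n set set) * CARD('n) * CARD('n)) * ?e"
    by simp
  also have "(\<Sum>J\<in>UNIV. \<Sum>i\<in>-J. \<Sum>j\<in>-J. isgn i J * isgn j J * (?T i j J - ?M i j J)) =
    ip (\<delta> \<alpha>) (\<delta> \<alpha>) + ip (d \<alpha>) (d \<alpha>) - (\<Sum>k\<in>X. curv (pt k) (\<alpha> k)) - energy \<alpha>"
    unfolding discrete_Bochner[OF \<alpha>] curv by (simp add: right_diff_distrib sum_subtractf)
  finally show ?thesis .
qed

lemma energy_bounds:
  assumes "\<And>k v. k \<in> X \<Longrightarrow> c * (norm v)\<^sup>2 \<le> v \<bullet> (G (pt k) *v v)"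
  shows "c * energy0 \<alpha> \<le> energy \<alpha>"
proof -
  have "c * (norm v)\<^sup>2 \<le> v \<bullet> (G (pt k) *v v)" if "k \<in> Box I" for k v I
    using assms Box_subset_X that by blast
  then show ?thesis
    unfolding energy0_def energy_def lip_def distrib_left sum_distrib_left
    by (intro add_mono sum_mono) (auto intro: assms)
qed

end

context C2_lattice
begin

text \<open>The error may contain the gradient of the cochain: the energy in the identity will
  absorb it when \<epsilon> is small compared with the eigenvalues of the metric.\<close>

definition Bochner_close :: "real \<Rightarrow> bool" where
  "Bochner_close \<epsilon> \<longleftrightarrow> (\<forall>q \<alpha>. cochain q \<alpha> \<longrightarrow>
    \<bar>ip (\<delta> \<alpha>) (\<delta> \<alpha>) + ip (d \<alpha>) (d \<alpha>) - (\<Sum>k\<in>X. curv (pt k) (\<alpha> k)) - energy \<alpha>\<bar>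
      \<le> \<epsilon> * (norm2 \<alpha> + energy0 \<alpha>))"

end

context C2_metric
begin

text \<open>On K the convergence of \<open>GC\<close> to \<open>M\<close> is uniform and
  \<open>M\<close> is bounded and uniformly continuous, so one mesh bound makes
  \<open>Bochner_error\<close> small for all grids in K and all cochains at once.\<close>

lemma Bochner_uniform:
  assumes "compact K" "K \<subseteq> U" "\<epsilon> > 0"
  obtains h0 where "h0 > 0"
    "\<And>L h z. C2_lattice U G P S L h z \<Longrightarrow> h < h0 \<Longrightarrow> (\<And>k. k \<in> lattice.X L \<Longrightarrow> lattice_point z h k \<in> K) \<Longrightarrow>
      C2_lattice.Bochner_close G P S L h z \<epsilon>"
proof -
  define c where "c = real (card (UNIV :: 'n set set) * CARD('n) * CARD('n))"
  have c: "c > 0" by (simp add: c_def card_gt_0_iff)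
  \<comment> \<open>Half of \<epsilon> is spent here, since c * 2 \<omega> = \<epsilon> / 2; the
    bound \<epsilon> / (2 c B) in \<open>h0\<close> spends the other half on c h B.\<close>
  define \<omega> where "\<omega> = \<epsilon> / (4 * c)"
  have \<omega>: "\<omega> > 0" using assms(3) c by (simp add: \<omega>_def)
  obtain h1 where h1: "h1 > 0" "\<And>y h i j. y \<in> K \<Longrightarrow> 0 < h \<Longrightarrow> h < h1 \<Longrightarrow> norm (GC i j y h - M j i y) < \<omega>"
    using GC_uniform[OF assms(1,2) \<omega>] by blast
  \<comment> \<open>Packing all coefficients into a matrix of matrices gives one modulus of
    continuity and one bound for all pairs (i, j).\<close>
  have cM: "continuous_on K (\<lambda>x. \<chi> i j. M i j x)"
    by (intro continuous_on_vec_lambda continuous_on_subset[OF cont_M assms(2)])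
  have "uniformly_continuous_on K (\<lambda>x. \<chi> i j. M i j x)"
    by (rule compact_uniformly_continuous[OF cM assms(1)])
  then obtain h2 where h2: "h2 > 0" "\<And>x y. x \<in> K \<Longrightarrow> y \<in> K \<Longrightarrow> dist y x < h2 \<Longrightarrow>
      dist (\<chi> i j. M i j y) (\<chi> i j. M i j x) < \<omega>"
    unfolding uniformly_continuous_on_def using \<omega> by meson
  have comp: "norm (F $ i $ j) \<le> norm F" for F :: "((real^'r^'r, 'n) vec, 'n) vec" and i j
    by (rule order.trans[OF Finite_Cartesian_Product.norm_nth_le Finite_Cartesian_Product.norm_nth_le])
  have osc: "norm (M i j y - M i j x) \<le> \<omega>" if "x \<in> K" "y \<in> K" "dist y x < h2" for x y i j
    using h2(2)[OF that] comp[of "(\<chi> i j. M i j y) - (\<chi> i j. M i j x)" i j] by (simp add: dist_norm)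
  obtain B where "B > 0" and B: "\<And>x. x \<in> K \<Longrightarrow> norm (\<chi> i j. M i j x) \<le> B"
    using compact_imp_bounded[OF compact_continuous_image[OF cM assms(1)]]
    unfolding bounded_pos by blast
  have bd: "norm (M i j x) \<le> B" if "x \<in> K" for x i j
    using B[OF that] comp[of "\<chi> i j. M i j x" i j] by simp
  define h0 where "h0 = min h1 (min h2 (\<epsilon> / (2 * c * B)))"
  show thesis
  proof (rule that[of h0])
    show "h0 > 0" using h1(1) h2(1) assms(3) c \<open>B > 0\<close> by (simp add: h0_def)
    fix L h z
    assume "C2_lattice U G P S L h z" and "h < h0"
      and inK: "\<And>k. k \<in> lattice.X L \<Longrightarrow> lattice_point z h k \<in> K"
    interpret A: C2_lattice U G P S L h "TYPE('n)" z by fact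
    have h: "0 < h" "h < h1" "h < h2" "h < \<epsilon> / (2 * c * B)" using \<open>h < h0\<close> A.h by (auto simp: h0_def)
    show "A.Bochner_close \<epsilon>"
      unfolding A.Bochner_close_def
    proof (intro allI impI)
      fix q and \<alpha> :: "('n \<Rightarrow> int) \<Rightarrow> 'n set \<Rightarrow> real^'r" assume \<alpha>: "A.cochain q \<alpha>"
      have "\<bar>A.ip (A.\<delta> \<alpha>) (A.\<delta> \<alpha>) + A.ip (A.d \<alpha>) (A.d \<alpha>) - (\<Sum>k\<in>A.X. curv (A.pt k) (\<alpha> k)) - A.energy \<alpha>\<bar>
        \<le> c * ((2 * \<omega> + h * B) * (A.norm2 \<alpha> + A.energy0 \<alpha>))"
        unfolding c_def
      proof (rule A.Bochner_error[OF \<alpha>])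
        fix i j k assume k: "k \<in> A.X"
        show "norm (GC i j (A.pt k) h - M j i (A.pt k)) \<le> \<omega>"
          using h1(2)[OF inK[OF k] h(1,2)] by (simp add: less_imp_le)
        show "norm (M j i (A.pt k)) \<le> B" by (rule bd[OF inK[OF k]])
        assume "k i + 1 < L"
        then have "A.up i k = k(i := k i + 1)" using k by (simp add: A.up_def A.X_def)
        then have "A.pt (A.up i k) = A.pt k + h *\<^sub>R axis i 1" by (simp only: lattice_point_upd)
        then have "dist (A.pt (A.up i k)) (A.pt k) < h2" using h by (simp add: dist_norm)
        then show "norm (M j i (A.pt (A.up i k)) - M j i (A.pt k)) \<le> \<omega>"
          using k by (intro osc inK) auto
      qed
      also have "\<dots> = c * (2 * \<omega> + h * B) * (A.norm2 \<alpha> + A.energy0 \<alpha>)" by simp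
      also have "\<dots> \<le> \<epsilon> * (A.norm2 \<alpha> + A.energy0 \<alpha>)"
      proof (rule mult_right_mono)
        have "h * (2 * c * B) \<le> \<epsilon>" using h(4) c \<open>B > 0\<close> by (simp add: field_simps)
        then show "c * (2 * \<omega> + h * B) \<le> \<epsilon>" using c by (simp add: \<omega>_def field_simps)
      qed simp
      finally show "\<bar>A.ip (A.\<delta> \<alpha>) (A.\<delta> \<alpha>) + A.ip (A.d \<alpha>) (A.d \<alpha>) - (\<Sum>k\<in>A.X. curv (A.pt k) (\<alpha> k)) - A.energy \<alpha>\<bar>
        \<le> \<epsilon> * (A.norm2 \<alpha> + A.energy0 \<alpha>)" .
    qed
  qed
qed

end

section \<open>Multiplication of a metric by a Gaussian weight\<close>

lemma matrix_inv_unique: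
  fixes A B :: "real^'r^'r"
  assumes "A ** B = mat 1" "B ** A = mat 1"
  shows "matrix_inv A = B"
proof -
  have "invertible A" using assms unfolding invertible_def by blast
  then have "A ** matrix_inv A = mat 1" by (rule invertible_matrix_inv)
  then have "B ** (A ** matrix_inv A) = B" by simp
  then show ?thesis by (simp add: matrix_mul_assoc assms)
qed

lemma pos_def_sym_scaleR:
  assumes "pos_def_sym A" "c > 0" shows "pos_def_sym (c *\<^sub>R A)"
  using assms unfolding pos_def_sym_def
  by (simp add: transpose_scalar scaleR_matrix_vector_assoc[symmetric])

lemma matrix_inv_scaleR:
  assumes "pos_def_sym A" "c > 0"
  shows "matrix_inv (c *\<^sub>R A) = matrix_inv A /\<^sub>R c"
  using pos_def_sym_matrix_inv[OF assms(1)] assms(2)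
  by (intro matrix_inv_unique) (simp_all add: matrix_scalar_ac scalar_matrix_assoc[symmetric])

lemma has_pderiv_scaleR:
  assumes "has_pderiv f i f' x" "has_pderiv g i g' x"
  shows "has_pderiv (\<lambda>x. f x *\<^sub>R g x) i (f x *\<^sub>R g' + f' *\<^sub>R g x) x"
  using has_vector_derivative_scaleR[OF assms(1)[unfolded has_pderiv_def has_real_derivative_iff_has_vector_derivative[symmetric]]
      assms(2)[unfolded has_pderiv_def]]
  by (simp add: has_pderiv_def)

lemma has_pderiv_add:
  assumes "has_pderiv f i f' x" "has_pderiv g i g' x"
  shows "has_pderiv (\<lambda>x. f x + g x) i (f' + g') x"
  using assms unfolding has_pderiv_def by (rule has_vector_derivative_add)

context C2_metric
begin

context
  fixes \<sigma> :: real and x0 :: "(real,'n) vec"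
begin

definition weight :: "(real,'n) vec \<Rightarrow> real" where
  "weight x = exp (- \<sigma> * (norm (x - x0))\<^sup>2)"

text \<open>The logarithmic derivative of \<open>weight\<close>, so that all derivatives of the
  weighted metric keep \<open>weight\<close> as a common factor.\<close>

definition dweight :: "'n \<Rightarrow> (real,'n) vec \<Rightarrow> real" where
  "dweight i x = - 2 * \<sigma> * (x - x0) $ i"

definition wG :: "(real,'n) vec \<Rightarrow> real^'r^'r" where
  "wG x = weight x *\<^sub>R G x"

definition wP :: "'n \<Rightarrow> (real,'n) vec \<Rightarrow> real^'r^'r" where
  "wP j x = weight x *\<^sub>R (P j x + dweight j x *\<^sub>R G x)"

definition wS :: "'n \<Rightarrow> 'n \<Rightarrow> (real,'n) vec \<Rightarrow> real^'r^'r" where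
  "wS i j x = weight x *\<^sub>R (S i j x + dweight j x *\<^sub>R P i x + (if i = j then - 2 * \<sigma> else 0) *\<^sub>R G x
     + dweight i x *\<^sub>R (P j x + dweight j x *\<^sub>R G x))"

lemma weight_pos [simp]: "weight x > 0"
  by (simp add: weight_def)

lemma weight_deriv: "has_pderiv weight i (weight x * dweight i x) x"
proof -
  have "((\<lambda>t. exp (- \<sigma> * ((x + t *\<^sub>R axis i 1 - x0) \<bullet> (x + t *\<^sub>R axis i 1 - x0)))) has_real_derivative
    weight x * dweight i x) (at 0)"
  proof -
    have "((\<lambda>t. (x + t *\<^sub>R axis i 1 - x0) \<bullet> (x + t *\<^sub>R axis i 1 - x0)) has_vector_derivative 2 * (x - x0) $ i) (at 0)"
      unfolding has_vector_derivative_def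
      by (auto intro!: derivative_eq_intros simp: fun_eq_iff inner_axis inner_axis' inner_commute algebra_simps)
    then have "((\<lambda>t. (x + t *\<^sub>R axis i 1 - x0) \<bullet> (x + t *\<^sub>R axis i 1 - x0)) has_real_derivative 2 * (x - x0) $ i) (at 0)"
      by (simp add: has_real_derivative_iff_has_vector_derivative)
    then show ?thesis
      by (auto intro!: derivative_eq_intros simp: weight_def dweight_def power2_norm_eq_inner)
  qed
  then show ?thesis
    unfolding has_pderiv_def weight_def power2_norm_eq_inner has_real_derivative_iff_has_vector_derivative .
qed

lemma dweight_deriv: "has_pderiv (dweight j) i (if i = j then - 2 * \<sigma> else 0) x"
  unfolding has_pderiv_def dweight_def has_vector_derivative_def
  by (auto intro!: derivative_eq_intros simp: axis_def fun_eq_iff algebra_simps)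

lemma weighted: "C2_metric U wG wP wS"
proof
  have cw: "continuous_on U weight" and cd: "continuous_on U (dweight i)" for i
    unfolding weight_def dweight_def by (intro continuous_intros)+
  show "continuous_on U wG" "continuous_on U (wP i)" "continuous_on U (wS i j)" for i j
    unfolding wG_def wP_def wS_def by (intro continuous_intros cw cd cont_G cont_P cont_S)+
  fix x assume x: "x \<in> U"
  show "pos_def_sym (wG x)" unfolding wG_def by (intro pos_def_sym_scaleR G x weight_pos)
  show "has_pderiv wG i (wP i x) x" for i
    using has_pderiv_scaleR[OF weight_deriv deriv_G[OF x], of i]
    unfolding wG_def wP_def by (simp add: scaleR_right_distrib)
  show "has_pderiv (wP j) i (wS i j x) x" for i j
  proof -
    have "has_pderiv (\<lambda>x. weight x *\<^sub>R (P j x + dweight j x *\<^sub>R G x)) i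
      (weight x *\<^sub>R (S i j x + (dweight j x *\<^sub>R P i x + (if i = j then - 2 * \<sigma> else 0) *\<^sub>R G x)) +
       (weight x * dweight i x) *\<^sub>R (P j x + dweight j x *\<^sub>R G x)) x"
      by (intro has_pderiv_scaleR has_pderiv_add weight_deriv dweight_deriv deriv_P deriv_G x)
    then show ?thesis
      unfolding wP_def[abs_def] wS_def by (simp only: scaleR_right_distrib scaleR_scaleR add.assoc mult.assoc)
  qed
qed (rule U)

text \<open>A factor exp \<phi> adds the scalar matrix \<partial>_j \<phi> to g^{-1} \<partial>_j g,
  so the curvature changes by minus the Hessian of \<phi> and the first derivatives of \<phi>
  cancel. For \<phi> = - \<sigma> |x - x0|^2 the change is 2 \<sigma> on the diagonal.\<close>

lemma weighted_M:
  assumes x: "x \<in> U"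
  shows "C2_metric.M wG wP wS i j x = weight x *\<^sub>R (M i j x + (if i = j then 2 * \<sigma> else 0) *\<^sub>R G x)"
proof -
  interpret W: C2_metric U wG wP wS by (rule weighted)
  have inv: "G x ** matrix_inv (G x) = mat 1" "matrix_inv (G x) ** G x = mat 1"
    using pos_def_sym_matrix_inv G[OF x] by auto
  have "W.M i j x = weight x *\<^sub>R ((P i x + dweight i x *\<^sub>R G x) ** matrix_inv (G x) ** (P j x + dweight j x *\<^sub>R G x)) - wS i j x"
    unfolding W.M_def wP_def wG_def matrix_inv_scaleR[OF G[OF x] weight_pos]
    by (simp add: matrix_scalar_ac scalar_matrix_assoc[symmetric] less_imp_neq[OF weight_pos, symmetric])
  also have "(P i x + dweight i x *\<^sub>R G x) ** matrix_inv (G x) = P i x ** matrix_inv (G x) + dweight i x *\<^sub>R mat 1"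
    by (simp add: matrix_add_rdistrib scalar_matrix_assoc[symmetric] inv)
  also have "\<dots> ** (P j x + dweight j x *\<^sub>R G x) = P i x ** matrix_inv (G x) ** P j x
      + dweight j x *\<^sub>R P i x + dweight i x *\<^sub>R (P j x + dweight j x *\<^sub>R G x)"
    by (simp add: matrix_add_rdistrib matrix_add_ldistrib scalar_matrix_assoc[symmetric] matrix_scalar_ac
        matrix_mul_assoc[symmetric] inv algebra_simps)
  finally have M_eq: "W.M i j x = weight x *\<^sub>R (P i x ** matrix_inv (G x) ** P j x
      + dweight j x *\<^sub>R P i x + dweight i x *\<^sub>R (P j x + dweight j x *\<^sub>R G x)) - wS i j x" .
  show ?thesis unfolding M_eq unfolding wS_def M_def
    by (cases "i = j") (simp_all add: algebra_simps)
qed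

text \<open>Only i = j survives in the added term, with sign +1, and each I of size q is reached
  once for every i in I; whence the factor q.\<close>

lemma weighted_curv:
  assumes x: "x \<in> U" and a: "\<And>I. card I \<noteq> q \<Longrightarrow> a I = 0"
  shows "C2_metric.curv wG wP wS x a =
    weight x * (curv x a + 2 * \<sigma> * real q * (\<Sum>I\<in>UNIV. a I \<bullet> (G x *v a I)))"
proof -
  interpret W: C2_metric U wG wP wS by (rule weighted)
  have 1: "a I \<bullet> (W.M j i x *v a I') = weight x * (a I \<bullet> (M j i x *v a I')) +
      weight x * (if j = i then 2 * \<sigma> else 0) * (a I \<bullet> (G x *v a I'))" for i j I I'
    unfolding weighted_M[OF x]
    by (simp add: scaleR_matrix_vector_assoc[symmetric] matrix_vector_mult_add_rdistrib inner_add_right algebra_simps)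
  have "(\<Sum>j\<in>-J. isgn i J * isgn j J * (weight x * (if j = i then 2 * \<sigma> else 0) * (a (insert j J) \<bullet> (G x *v a (insert i J)))))
      = weight x * (2 * \<sigma>) * (a (insert i J) \<bullet> (G x *v a (insert i J)))" if "i \<in> -J" for i J
  proof -
    have "(\<Sum>j\<in>-J. isgn i J * isgn j J * (weight x * (if j = i then 2 * \<sigma> else 0) * (a (insert j J) \<bullet> (G x *v a (insert i J)))))
      = (\<Sum>j\<in>-J. if j = i then isgn i J * isgn i J * (weight x * (2 * \<sigma>) * (a (insert i J) \<bullet> (G x *v a (insert i J)))) else 0)"
      by (rule sum.cong) auto
    then show ?thesis using that by simp
  qed
  then have "W.curv x a = weight x * curv x a +
      (\<Sum>J\<in>UNIV. \<Sum>i\<in>-J. weight x * (2 * \<sigma>) * (a (insert i J) \<bullet> (G x *v a (insert i J))))"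
    unfolding W.curv_def curv_def 1
    by (simp add: distrib_left sum.distrib sum_distrib_left mult.left_commute)
  also have "(\<Sum>J\<in>UNIV. \<Sum>i\<in>-J. weight x * (2 * \<sigma>) * (a (insert i J) \<bullet> (G x *v a (insert i J)))) =
      (\<Sum>I\<in>UNIV. \<Sum>i\<in>I. weight x * (2 * \<sigma>) * (a I \<bullet> (G x *v a I)))"
    by (rule sum_subset_insert[of "\<lambda>i I. weight x * (2 * \<sigma>) * (a I \<bullet> (G x *v a I))"])
  also have "\<dots> = (\<Sum>I\<in>UNIV. real q * (weight x * (2 * \<sigma>) * (a I \<bullet> (G x *v a I))))"
  proof (rule sum.cong[OF refl])
    fix I show "(\<Sum>i\<in>I. weight x * (2 * \<sigma>) * (a I \<bullet> (G x *v a I))) = real q * (weight x * (2 * \<sigma>) * (a I \<bullet> (G x *v a I)))"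
      using a[of I] by (cases "card I = q") simp_all
  qed
  finally show ?thesis by (simp add: sum_distrib_left algebra_simps)
qed

end

end

section \<open>Curvature and Nakano semipositivity\<close>

lemma has_vector_derivative_at_0_iff:
  "(f has_vector_derivative D) (at 0) \<longleftrightarrow> ((\<lambda>t. (f t - f 0) /\<^sub>R t) \<longlongrightarrow> D) (at 0)"
proof -
  have key: "norm ((f t - f 0) - (t - 0) *\<^sub>R D) / norm (t - 0) = norm ((f t - f 0) /\<^sub>R t - D)" if "t \<noteq> 0" for t
  proof -
    have "(f t - f 0) - (t - 0) *\<^sub>R D = t *\<^sub>R ((f t - f 0) /\<^sub>R t - D)" using that by (simp add: algebra_simps)
    then show ?thesis using that by simp
  qed
  have "\<forall>\<^sub>F t in at 0. norm ((f t - f 0) - (t - 0) *\<^sub>R D) / norm (t - 0) = norm ((f t - f 0) /\<^sub>R t - D)"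
    unfolding eventually_at_topological using key by (intro exI[of _ UNIV]) blast
  then have "((\<lambda>t. norm ((f t - f 0) - (t - 0) *\<^sub>R D) / norm (t - 0)) \<longlongrightarrow> 0) (at 0) \<longleftrightarrow>
    ((\<lambda>t. norm ((f t - f 0) /\<^sub>R t - D)) \<longlongrightarrow> 0) (at 0)"
    by (rule filterlim_cong[OF refl refl])
  then show ?thesis
    unfolding has_vector_derivative_def has_derivative_iff_norm
    by (simp add: bounded_linear_scaleR_left tendsto_norm_zero_iff LIM_zero_iff)
qed

lemma C2_metric_pd:
  assumes "open D" "riem_metric D g" "C2_on D g"
  shows "C2_metric D g (\<lambda>i. pd i g) (\<lambda>i j. pd i (pd j g))"
  using assms
  by unfold_locales (auto simp: riem_metric_def C2_on_def has_pderiv_def has_pd_def pd_def vector_derivative_works)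

context C2_metric
begin

lemma open_line: "open {t. x + t *\<^sub>R axis i 1 \<in> U}"
proof -
  have "open ((\<lambda>t. x + t *\<^sub>R axis i 1) -` U)"
    by (intro open_vimage U continuous_intros)
  then show ?thesis by (simp add: vimage_def)
qed

text \<open>With H the inverse of G, H(y) - H(x) = - H(y) (G(y) - G(x)) H(x); continuity of H and
  differentiability of G do the rest.\<close>

lemma matrix_inv_deriv:
  assumes x: "x \<in> U"
  shows "has_pderiv (\<lambda>x. matrix_inv (G x)) i (- (matrix_inv (G x) ** P i x ** matrix_inv (G x))) x"
proof -
  let ?y = "\<lambda>t. x + t *\<^sub>R axis i 1"
  let ?H = "\<lambda>x. matrix_inv (G x)"
  have cont_y: "(?y \<longlongrightarrow> x) (at 0)" by (auto intro!: tendsto_eq_intros)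
  have "isCont ?H x" using cont_inv U x by (simp add: continuous_on_eq_continuous_at)
  then have H: "((\<lambda>t. ?H (?y t)) \<longlongrightarrow> ?H x) (at 0)"
    by (rule isCont_tendsto_compose[OF _ cont_y])
  have Q: "((\<lambda>t. (G (?y t) - G x) /\<^sub>R t) \<longlongrightarrow> P i x) (at 0)"
    using deriv_G[OF x] unfolding has_pderiv_def has_vector_derivative_at_0_iff by simp
  have "((\<lambda>t. - (?H (?y t) ** ((G (?y t) - G x) /\<^sub>R t) ** ?H x)) \<longlongrightarrow> - (?H x ** P i x ** ?H x)) (at 0)"
    by (intro tendsto_minus tendsto_matrix_matrix H Q tendsto_const)
  moreover have "\<forall>\<^sub>F t in at 0. - (?H (?y t) ** ((G (?y t) - G x) /\<^sub>R t) ** ?H x) = (?H (?y t) - ?H x) /\<^sub>R t"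
  proof -
    have "\<forall>\<^sub>F t in at 0. t \<in> {t. ?y t \<in> U}"
      using x by (intro eventually_at_in_open' open_line) simp
    then show ?thesis
    proof (rule eventually_mono)
      fix t assume "t \<in> {t. ?y t \<in> U}"
      then have inv: "?H (?y t) ** G (?y t) = mat 1" "G x ** ?H x = mat 1"
        using pos_def_sym_matrix_inv G x by auto
      have "?H (?y t) ** (G (?y t) - G x) ** ?H x = ?H x - ?H (?y t) ** (G x ** ?H x)"
        by (simp add: matrix_diff_ldistrib matrix_diff_rdistrib inv(1) matrix_mul_assoc)
      then have "- (?H (?y t) ** (G (?y t) - G x) ** ?H x) = ?H (?y t) - ?H x" by (simp add: inv)
      then show "- (?H (?y t) ** ((G (?y t) - G x) /\<^sub>R t) ** ?H x) = (?H (?y t) - ?H x) /\<^sub>R t"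
        by (simp add: matrix_scalar_ac scalar_matrix_assoc[symmetric] flip: scaleR_minus_right)
    qed
  qed
  ultimately have "((\<lambda>t. (?H (?y t) - ?H x) /\<^sub>R t) \<longlongrightarrow> - (?H x ** P i x ** ?H x)) (at 0)"
    by (rule Lim_transform_eventually)
  then show ?thesis unfolding has_pderiv_def has_vector_derivative_at_0_iff by simp
qed

lemma pd_connection:
  assumes x: "x \<in> U"
  shows "G x ** pd i (\<lambda>y. matrix_inv (G y) ** pd j G y) x = - M i j x"
proof -
  let ?H = "\<lambda>x. matrix_inv (G x)"
  let ?N = "?H x ** S i j x + - (?H x ** P i x ** ?H x) ** P j x"
  have pd_G: "pd j G y = P j y" if "y \<in> U" for y
    using deriv_G[OF that, of j] unfolding pd_def has_pderiv_def by (rule vector_derivative_at)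
  have "((\<lambda>t. ?H (x + t *\<^sub>R axis i 1) ** P j (x + t *\<^sub>R axis i 1)) has_vector_derivative ?N) (at 0)"
    using bounded_bilinear.has_vector_derivative[OF bounded_bilinear_matrix_matrix
        matrix_inv_deriv[OF x, unfolded has_pderiv_def] deriv_P[OF x, unfolded has_pderiv_def]] by simp
  then have "((\<lambda>t. ?H (x + t *\<^sub>R axis i 1) ** pd j G (x + t *\<^sub>R axis i 1)) has_vector_derivative ?N) (at 0)"
    by (rule has_vector_derivative_transform_within_open[OF _ open_line[of x i]]) (use x pd_G in auto)
  then have "pd i (\<lambda>y. ?H y ** pd j G y) x = ?N"
    unfolding pd_def by (rule vector_derivative_at)
  moreover have "G x ** ?H x = mat 1" using pos_def_sym_matrix_inv G[OF x] by auto
  moreover have "- (?H x ** P i x ** ?H x) ** P j x = - (?H x ** (P i x ** ?H x ** P j x))"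
    using matrix_diff_rdistrib[of 0 "?H x ** P i x ** ?H x" "P j x"] by (simp add: matrix_mul_assoc)
  ultimately show ?thesis
    by (simp add: matrix_diff_ldistrib matrix_mul_assoc M_def)
qed

text \<open>With J = I - {i}, the coefficient \<open>wedge_contr i j a I\<close> is a at
  \<open>insert j J\<close> with sign \<open>isgn i J * isgn j J\<close>, and
  \<open>pd_connection\<close> turns G times the curvature coefficient into \<open>M\<close>.
  Cutting a down to |I| = q changes nothing, because \<open>insert j J\<close> has as many elements
  as I.\<close>

lemma form_inner_curv:
  assumes x: "x \<in> U"
  shows "form_inner q (G x) (curv_apply G x a) a = curv x (\<lambda>I. if card I = q then a I else 0)"
proof -
  define b where "b = (\<lambda>I. if card I = q then a I else 0)"
  let ?N = "\<lambda>i j. pd i (\<lambda>y. matrix_inv (G y) ** pd j G y) x"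
  have N: "(?N i j *v u) \<bullet> (G x *v v) = - (v \<bullet> (M i j x *v u))" for i j u v
  proof -
    have "(?N i j *v u) \<bullet> (G x *v v) = v \<bullet> (G x *v (?N i j *v u))"
      using inner_symmetric_matrix G[OF x] unfolding pos_def_sym_def by blast
    also have "\<dots> = v \<bullet> ((- M i j x) *v u)"
      by (simp only: matrix_vector_mul_assoc pd_connection[OF x])
    also have "(- M i j x) *v u = - (M i j x *v u)"
      using matrix_vector_mult_diff_rdistrib[of 0 "M i j x" u] by simp
    finally show ?thesis by simp
  qed
  have wedge: "wedge_contr i j c I = (isgn i (I - {i}) * isgn j (I - {i})) *\<^sub>R c (insert j (I - {i}))"
    if "i \<in> I" "j \<notin> I - {i}" for i j and c :: "'n set \<Rightarrow> real^'r" and I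
    using that unfolding wedge_contr_def isgn_def by (simp only: power_add simp_thms if_True)
  have wedge_0: "wedge_contr i j c I = 0" if "\<not> (i \<in> I \<and> j \<notin> I - {i})" for i j and c :: "'n set \<Rightarrow> real^'r" and I
    unfolding wedge_contr_def by (rule if_not_P[OF that])
  have "form_inner q (G x) (curv_apply G x a) a =
    (\<Sum>I | card I = q. \<Sum>i\<in>UNIV. \<Sum>j\<in>UNIV. a I \<bullet> (M i j x *v wedge_contr i j a I))"
    unfolding form_inner_def curv_apply_def by (simp add: inner_sum_left N sum_negf)
  also have "\<dots> = (\<Sum>I | card I = q. \<Sum>i\<in>UNIV. \<Sum>j\<in>UNIV. b I \<bullet> (M i j x *v wedge_contr i j b I))"
  proof (intro sum.cong refl)
    fix I i j assume I: "I \<in> {I::'n set. card I = q}"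
    have "wedge_contr i j a I = wedge_contr i j b I"
    proof (cases "i \<in> I \<and> j \<notin> I - {i}")
      case True
      have "card I > 0" using True by (auto simp: card_gt_0_iff)
      then have "card (insert j (I - {i})) = q" using True I by simp
      then have "b (insert j (I - {i})) = a (insert j (I - {i}))" unfolding b_def by (rule if_P)
      then show ?thesis using wedge[of i I j a] wedge[of i I j b] True by simp
    next
      case False
      then show ?thesis using wedge_0 by simp
    qed
    moreover have "b I = a I" using I by (simp add: b_def)
    ultimately show "a I \<bullet> (M i j x *v wedge_contr i j a I) = b I \<bullet> (M i j x *v wedge_contr i j b I)"
      by simp
  qed
  also have "\<dots> = (\<Sum>I\<in>UNIV. \<Sum>i\<in>UNIV. \<Sum>j\<in>UNIV. b I \<bullet> (M i j x *v wedge_contr i j b I))"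
    by (rule sum.mono_neutral_left) (auto simp: b_def)
  also have "\<dots> = (\<Sum>I\<in>UNIV. \<Sum>i\<in>I. \<Sum>j\<in>-(I - {i}). isgn i (I - {i}) * isgn j (I - {i}) *
      (b (insert i (I - {i})) \<bullet> (M i j x *v b (insert j (I - {i})))))"
  proof (rule sum.cong[OF refl])
    fix I :: "'n set"
    have "(\<Sum>i\<in>UNIV. \<Sum>j\<in>UNIV. b I \<bullet> (M i j x *v wedge_contr i j b I)) =
      (\<Sum>i\<in>I. \<Sum>j\<in>UNIV. b I \<bullet> (M i j x *v wedge_contr i j b I))"
      by (rule sum.mono_neutral_right) (simp_all add: wedge_0)
    also have "\<dots> = (\<Sum>i\<in>I. \<Sum>j\<in>-(I - {i}). b I \<bullet> (M i j x *v wedge_contr i j b I))"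
      by (rule sum.cong[OF refl], rule sum.mono_neutral_right) (simp_all add: wedge_0)
    also have "\<dots> = (\<Sum>i\<in>I. \<Sum>j\<in>-(I - {i}). isgn i (I - {i}) * isgn j (I - {i}) *
      (b (insert i (I - {i})) \<bullet> (M i j x *v b (insert j (I - {i})))))"
    proof (rule sum.cong[OF refl], rule sum.cong[OF refl])
      fix i j assume i: "i \<in> I" and j: "j \<in> -(I - {i})"
      have "insert i (I - {i}) = I" using i by auto
      moreover have "wedge_contr i j b I = (isgn i (I - {i}) * isgn j (I - {i})) *\<^sub>R b (insert j (I - {i}))"
        using i j by (intro wedge) auto
      ultimately show "b I \<bullet> (M i j x *v wedge_contr i j b I) = isgn i (I - {i}) * isgn j (I - {i}) *
        (b (insert i (I - {i})) \<bullet> (M i j x *v b (insert j (I - {i}))))"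
        by (simp only: matrix_vector_mult_scaleR inner_scaleR_right)
    qed
    finally show "(\<Sum>i\<in>UNIV. \<Sum>j\<in>UNIV. b I \<bullet> (M i j x *v wedge_contr i j b I)) =
      (\<Sum>i\<in>I. \<Sum>j\<in>-(I - {i}). isgn i (I - {i}) * isgn j (I - {i}) *
      (b (insert i (I - {i})) \<bullet> (M i j x *v b (insert j (I - {i})))))" .
  qed
  also have "\<dots> = (\<Sum>J\<in>UNIV. \<Sum>i\<in>-J. \<Sum>j\<in>-J. isgn i J * isgn j J * (b (insert i J) \<bullet> (M i j x *v b (insert j J))))"
    by (rule sum_subset_remove[of "\<lambda>i J. \<Sum>j\<in>-J. isgn i J * isgn j J * (b (insert i J) \<bullet> (M i j x *v b (insert j J)))"])
  also have "\<dots> = curv x b"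
    unfolding curv_def by (rule sum.cong[OF refl], subst sum.swap) (simp add: mult.commute)
  finally show ?thesis unfolding b_def .
qed

lemma nakano_iff_curv:
  "nakano_q_semipos q U G \<longleftrightarrow> (\<forall>x\<in>U. \<forall>a. (\<forall>I. card I \<noteq> q \<longrightarrow> a I = 0) \<longrightarrow> curv x a \<ge> 0)"
proof
  assume L: "nakano_q_semipos q U G"
  show "\<forall>x\<in>U. \<forall>a. (\<forall>I. card I \<noteq> q \<longrightarrow> a I = 0) \<longrightarrow> curv x a \<ge> 0"
  proof (intro ballI allI impI)
    fix x and a :: "'n set \<Rightarrow> real^'r" assume x: "x \<in> U" and a: "\<forall>I. card I \<noteq> q \<longrightarrow> a I = 0"
    then have eq: "(\<lambda>I. if card I = q then a I else 0) = a" by auto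
    have "0 \<le> form_inner q (G x) (curv_apply G x a) a" using L x unfolding nakano_q_semipos_def by blast
    then show "curv x a \<ge> 0" unfolding form_inner_curv[OF x] eq .
  qed
next
  assume "\<forall>x\<in>U. \<forall>a. (\<forall>I. card I \<noteq> q \<longrightarrow> a I = 0) \<longrightarrow> curv x a \<ge> 0"
  then show "nakano_q_semipos q U G"
    unfolding nakano_q_semipos_def by (simp add: form_inner_curv)
qed

lemma continuous_quadratic:
  assumes "K \<subseteq> U"
  shows "continuous_on (K \<times> T) (\<lambda>p. snd p \<bullet> (G (fst p) *v snd p))"
proof -
  have "continuous_on (K \<times> T) (\<lambda>p. G (fst p))"
    by (rule continuous_on_compose2[OF cont_G]) (use assms in \<open>auto intro!: continuous_intros\<close>)
  then show ?thesis
    by (intro continuous_intros continuous_on_matrix_vector)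
qed

lemma uniformly_positive:
  assumes "compact K" "K \<subseteq> U"
  obtains c where "c > 0" "\<And>x v. x \<in> K \<Longrightarrow> c * (norm v)\<^sup>2 \<le> v \<bullet> (G x *v v)"
proof (cases "K = {}")
  case True then show ?thesis using that[of 1] by simp
next
  case False
  let ?T = "sphere (0::real^'r) 1"
  let ?f = "\<lambda>p. snd p \<bullet> (G (fst p) *v snd p)"
  have "compact (K \<times> ?T)" using assms(1) by (intro compact_Times) auto
  moreover have "K \<times> ?T \<noteq> {}" using False by simp
  ultimately obtain p where p: "p \<in> K \<times> ?T" "\<And>p'. p' \<in> K \<times> ?T \<Longrightarrow> ?f p \<le> ?f p'"
    using continuous_attains_inf[OF _ _ continuous_quadratic[OF assms(2)]] by blast
  have "snd p \<noteq> 0" "fst p \<in> U" using p(1) assms(2) by auto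
  then have pos: "?f p > 0" using G[of "fst p"] unfolding pos_def_sym_def by blast
  have "?f p * (norm v)\<^sup>2 \<le> v \<bullet> (G x *v v)" if x: "x \<in> K" for x v
  proof (cases "v = 0")
    case False
    let ?u = "v /\<^sub>R norm v"
    have v: "v = norm v *\<^sub>R ?u" using False by simp
    have "(x, ?u) \<in> K \<times> ?T" using False x by simp
    then have "?f p * (norm v)\<^sup>2 \<le> (?u \<bullet> (G x *v ?u)) * (norm v)\<^sup>2"
      using p(2)[of "(x, ?u)"] by (intro mult_right_mono) auto
    also have "\<dots> = v \<bullet> (G x *v v)"
      using False by (simp add: matrix_vector_mult_scaleR power2_eq_square field_simps)
    finally show ?thesis .
  qed simp
  with pos show ?thesis by (rule that)
qed

lemma uniformly_bounded:
  assumes "compact K" "K \<subseteq> U"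
  obtains c where "c > 0" "\<And>x v. x \<in> K \<Longrightarrow> v \<bullet> (G x *v v) \<le> c * (norm v)\<^sup>2"
proof -
  obtain c where "c > 0" and c: "\<And>x. x \<in> K \<Longrightarrow> norm (G x) \<le> c"
    using compact_imp_bounded[OF compact_continuous_image[OF continuous_on_subset[OF cont_G assms(2)] assms(1)]]
    unfolding bounded_pos by blast
  have "v \<bullet> (G x *v v) \<le> c * (norm v)\<^sup>2" if "x \<in> K" for x v
  proof -
    have "v \<bullet> (G x *v v) \<le> norm (G x) * norm v * norm v"
      using abs_inner_matrix_le[of v "G x" v] by simp
    also have "\<dots> \<le> c * (norm v)\<^sup>2"
      unfolding power2_eq_square mult.assoc by (intro mult_right_mono c that) auto
    finally show ?thesis .
  qed
  with \<open>c > 0\<close> show ?thesis by (rule that)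
qed

end

text \<open>Dini's argument on K times the unit sphere: the continuous functions F j increase with
  j, and the slack \<eta> makes their limit strictly positive. Homogeneity extends the result to all
  vectors.\<close>

lemma monotone_metrics_uniform:
  fixes gs :: "nat \<Rightarrow> (real,'n::{finite,linorder}) vec \<Rightarrow> real^'r^'r"
  assumes g: "C2_metric U g P S" and gs: "\<And>j. C2_metric U (gs j) (Ps j) (Ss j)"
    and K: "compact K" "K \<subseteq> U" and "\<eta> > 0"
    and mono: "\<And>i j. i \<le> j \<Longrightarrow> metric_le U (gs i) (gs j)"
    and lim: "\<And>x. x \<in> U \<Longrightarrow> (\<lambda>j. gs j x) \<longlonglongrightarrow> g x"
  obtains j where "\<And>x v. x \<in> K \<Longrightarrow> v \<bullet> (g x *v v) \<le> (1 + \<eta>) * (v \<bullet> (gs j x *v v))"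
proof -
  interpret g: C2_metric U g P S by fact
  let ?T = "sphere (0::real^'r) 1"
  define F where "F j p = (1 + \<eta>) * (snd p \<bullet> (gs j (fst p) *v snd p)) - snd p \<bullet> (g (fst p) *v snd p)" for j p
  have cont: "continuous_on (K \<times> ?T) (F j)" for j
    unfolding F_def
    by (intro continuous_intros C2_metric.continuous_quadratic[OF gs K(2)] g.continuous_quadratic K(2))
  have F_mono: "F i p \<le> F j p" if "i \<le> j" "fst p \<in> U" for i j p
  proof -
    have "snd p \<bullet> (gs i (fst p) *v snd p) \<le> snd p \<bullet> (gs j (fst p) *v snd p)"
      using mono[OF that(1)] that(2)
      by (simp add: metric_le_def matrix_vector_mult_diff_rdistrib inner_diff_right)
    then show ?thesis using \<open>\<eta> > 0\<close> by (simp add: F_def mult_left_mono)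
  qed
  have "\<exists>j. \<forall>p\<in>K \<times> ?T. F j p \<ge> 0"
  proof (rule ccontr)
    assume "\<not> ?thesis"
    then have "\<forall>j. \<exists>p. p \<in> K \<times> ?T \<and> F j p < 0" by (meson not_le)
    then obtain p where p: "\<And>j. p j \<in> K \<times> ?T" "\<And>j. F j (p j) < 0" by metis
    have "compact (K \<times> ?T)" using K(1) by (intro compact_Times) auto
    then obtain l r where l: "l \<in> K \<times> ?T" and r: "strict_mono (r :: nat \<Rightarrow> nat)" "(p \<circ> r) \<longlonglongrightarrow> l"
      using p(1) unfolding compact_def by metis
    have lU: "fst l \<in> U" and l0: "snd l \<noteq> 0" using l K(2) by auto
    have "(\<lambda>j. F j l) \<longlonglongrightarrow> (1 + \<eta>) * (snd l \<bullet> (g (fst l) *v snd l)) - snd l \<bullet> (g (fst l) *v snd l)"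
      unfolding F_def by (intro tendsto_intros tendsto_matrix_vector lim lU)
    moreover have "(1 + \<eta>) * (snd l \<bullet> (g (fst l) *v snd l)) - snd l \<bullet> (g (fst l) *v snd l) > 0"
      using g.G[OF lU] l0 \<open>\<eta> > 0\<close> unfolding pos_def_sym_def by (simp add: algebra_simps)
    ultimately have "\<forall>\<^sub>F j in sequentially. F j l > 0" by (rule order_tendstoD(1))
    \<comment> \<open>The index m is fixed at the limit point l; continuity of F m carries
      positivity to nearby p (r k), and monotonicity carries it from m to r k.\<close>
    then obtain m where m: "F m l > 0" by (auto simp: eventually_sequentially)
    have "(\<lambda>k. F m ((p \<circ> r) k)) \<longlonglongrightarrow> F m l"
      by (rule continuous_on_tendsto_compose[OF cont r(2) l]) (use p(1) in auto)
    then have "\<forall>\<^sub>F k in sequentially. F m (p (r k)) > 0" using order_tendstoD(1)[OF _ m] by (simp add: o_def)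
    moreover have "\<forall>\<^sub>F k in sequentially. k \<ge> m" by (rule eventually_ge_at_top)
    ultimately have "\<forall>\<^sub>F k in sequentially. F m (p (r k)) > 0 \<and> k \<ge> m" by (rule eventually_conj)
    then obtain k where k: "F m (p (r k)) > 0" "k \<ge> m" by (auto simp: eventually_sequentially)
    have "m \<le> r k" using k(2) seq_suble[OF r(1), of k] by simp
    moreover have "fst (p (r k)) \<in> U" using p(1)[of "r k"] K(2) by auto
    ultimately have "F m (p (r k)) \<le> F (r k) (p (r k))" by (rule F_mono)
    then show False using k(1) p(2)[of "r k"] by simp
  qed
  then obtain j where j: "\<And>p. p \<in> K \<times> ?T \<Longrightarrow> F j p \<ge> 0" by blast
  show thesis
  proof (rule that[of j])
    fix x and v :: "real^'r" assume x: "x \<in> K"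
    show "v \<bullet> (g x *v v) \<le> (1 + \<eta>) * (v \<bullet> (gs j x *v v))"
    proof (cases "v = 0")
      case False
      have "(x, v /\<^sub>R norm v) \<in> K \<times> ?T" using x False by simp
      from j[OF this] have "0 \<le> (norm v)\<^sup>2 * F j (x, v /\<^sub>R norm v)" by simp
      also have "\<dots> = (1 + \<eta>) * (v \<bullet> (gs j x *v v)) - v \<bullet> (g x *v v)"
        using False by (simp add: F_def matrix_vector_mult_scaleR power2_eq_square field_simps)
      finally show ?thesis by simp
    qed simp
  qed
qed

section \<open>Test forms on a small cube\<close>

text \<open>The eigenvalue bounds are parameters so that they can be fixed before \<sigma> and m are
  chosen.\<close>

locale test_lattice = C2_metric U G P S
  for U and G :: "(real,'n::{finite,linorder}) vec \<Rightarrow> real^'r^'r" and P S +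
  fixes x0 :: "(real,'n) vec" and R \<sigma> :: real and m q :: nat and \<xi> :: "'n set \<Rightarrow> real^'r"
    and lower upper :: real
  assumes R: "R > 0" and \<sigma>: "\<sigma> > 0" and m: "m \<ge> 1"
    and cube_in_U: "\<And>x. (\<And>i. \<bar>x $ i - x0 $ i\<bar> \<le> R) \<Longrightarrow> x \<in> U"
    and \<xi>: "\<And>I. card I \<noteq> q \<Longrightarrow> \<xi> I = 0" "\<exists>I. \<xi> I \<noteq> 0"
    and lower: "lower > 0" "\<And>x v. (\<And>i. \<bar>x $ i - x0 $ i\<bar> \<le> R) \<Longrightarrow> lower * (norm v)\<^sup>2 \<le> v \<bullet> (G x *v v)"
    and upper: "upper > 0" "\<And>x v. (\<And>i. \<bar>x $ i - x0 $ i\<bar> \<le> R) \<Longrightarrow> v \<bullet> (G x *v v) \<le> upper * (norm v)\<^sup>2"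
begin

text \<open>The cube of side \<open>2 * R\<close> around \<open>x0\<close> is divided into \<open>16 * CARD('n) * m\<close> steps in each direction,
  so that the concentric cube of half side \<open>R / (8 * CARD('n))\<close>, which lies in the ball of radius
  \<open>R / 8\<close>, consists of \<open>2 * m\<close> steps.\<close>

definition L :: int where "L = 16 * int CARD('n) * int m + 1"
definition h :: real where "h = R / (8 * real CARD('n) * real m)"
definition z :: "(real,'n) vec" where "z = (\<chi> i. x0 $ i - R)"

abbreviation "w \<equiv> weight \<sigma> x0"

lemma n_pos: "CARD('n) \<ge> 1" by (simp add: Suc_leI)

lemma h_pos: "h > 0" and h_le: "h \<le> R / 8"
proof -
  show "h > 0" using R m n_pos by (simp add: h_def)
  have "1 \<le> real CARD('n) * real m" using m n_pos
    by (metis mult_le_mono nat_mult_1_right of_nat_1 of_nat_le_iff of_nat_mult)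
  then have "8 \<le> 8 * real CARD('n) * real m" by simp
  then show "h \<le> R / 8" unfolding h_def using R by (intro divide_left_mono) auto
qed

lemma h_L: "h * real_of_int (L - 1) = 2 * R"
  using m n_pos by (simp add: h_def L_def field_simps)

lemma L_ge: "L \<ge> 3"
proof -
  have "1 \<le> int CARD('n) * int m" using m n_pos
    by (metis mult_le_mono nat_mult_1_right of_nat_1 of_nat_le_iff of_nat_mult)
  then show ?thesis unfolding L_def mult.assoc by linarith
qed

sublocale grid: lattice L h "TYPE('n)"
  by unfold_locales (simp_all add: L_ge h_pos)

lemma coord: "lattice_point z h k $ i - x0 $ i = h * real_of_int (k i) - R"
  by (simp add: z_def)

lemma X_in_cube:
  assumes "k \<in> grid.X" shows "\<bar>lattice_point z h k $ i - x0 $ i\<bar> \<le> R"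
proof -
  have "0 \<le> k i" "k i \<le> L - 1" using assms by (auto simp: grid.X_def dest: spec[of _ i])
  then have "0 \<le> real_of_int (k i)" "real_of_int (k i) \<le> real_of_int (L - 1)" by linarith+
  then have "0 \<le> h * real_of_int (k i)" "h * real_of_int (k i) \<le> 2 * R"
    using h_pos h_L by (auto simp: mult_left_mono simp flip: h_L)
  then show ?thesis unfolding coord by linarith
qed

sublocale W: C2_metric U "wG \<sigma> x0" "wP \<sigma> x0" "wS \<sigma> x0"
  by (rule weighted)

sublocale A: C2_lattice U "wG \<sigma> x0" "wP \<sigma> x0" "wS \<sigma> x0" L h "TYPE('n)" z
  by unfold_locales (use X_in_cube cube_in_U in blast)

text \<open>It is 1 up to distance R/2 and 0 from 3R/4 on, so its support stays away from the faces
  of the cube. Piecewise linear is enough, as only its differences occur.\<close>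

definition cutoff :: "(real,'n) vec \<Rightarrow> real" where
  "cutoff x = max 0 (min 1 (3 - 4 * norm (x - x0) / R))"

text \<open>The constant form, cut off sharply at the box. Unlike \<alpha> it is exactly closed, and
  it serves as the right-hand side of the equation; \<alpha> is the test form.\<close>

definition f :: "('n \<Rightarrow> int) \<Rightarrow> 'n set \<Rightarrow> real^'r" where
  "f k I = (if k \<in> grid.Box I then \<xi> I else 0)"

definition \<alpha> :: "('n \<Rightarrow> int) \<Rightarrow> 'n set \<Rightarrow> real^'r" where
  "\<alpha> k I = cutoff (A.pt k) *\<^sub>R \<xi> I"

text \<open>The radius R/4 instead of R/2 leaves room for one grid step (h <= R/8), so the tail also
  covers the points at which the cutoff has a nonzero difference.\<close>

definition tail :: real where
  "tail = (\<Sum>k\<in>grid.X. if norm (A.pt k - x0) \<ge> R / 4 then w (A.pt k) else 0)"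

definition nxi :: real where "nxi = (\<Sum>I\<in>UNIV. (norm (\<xi> I))\<^sup>2)"
definition gam :: "(real,'n) vec \<Rightarrow> real" where "gam x = (\<Sum>I\<in>UNIV. \<xi> I \<bullet> (G x *v \<xi> I))"

lemma cutoff_bounds [simp]: "0 \<le> cutoff x" "cutoff x \<le> 1"
  by (auto simp: cutoff_def)

lemma cutoff_eq_1: "norm (x - x0) \<le> R / 2 \<Longrightarrow> cutoff x = 1"
  and cutoff_eq_0: "norm (x - x0) \<ge> 3 * R / 4 \<Longrightarrow> cutoff x = 0"
  using R by (auto simp: cutoff_def field_simps max_def min_def)

lemma cutoff_Lipschitz: "\<bar>cutoff x - cutoff y\<bar> \<le> 4 / R * norm (x - y)"
proof -
  have clamp: "\<bar>max 0 (min 1 (3 - a)) - max 0 (min 1 (3 - b))\<bar> \<le> \<bar>a - b\<bar>" for a b :: real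
    by (simp add: max_def min_def abs_if)
  have "\<bar>cutoff x - cutoff y\<bar> \<le> \<bar>4 * norm (x - x0) / R - 4 * norm (y - x0) / R\<bar>"
    unfolding cutoff_def by (rule clamp)
  also have "\<dots> = 4 / R * \<bar>norm (x - x0) - norm (y - x0)\<bar>"
  proof -
    have "4 * norm (x - x0) / R - 4 * norm (y - x0) / R = 4 / R * (norm (x - x0) - norm (y - x0))"
      by (simp add: diff_divide_distrib right_diff_distrib)
    moreover have "\<bar>4 / R\<bar> = 4 / R" using R by simp
    ultimately show ?thesis by (simp only: abs_mult)
  qed
  also have "\<dots> \<le> 4 / R * norm (x - y)"
    using R norm_triangle_ineq3[of "x - x0" "y - x0"] by (intro mult_left_mono) auto
  finally show ?thesis .
qed

lemma nxi_pos: "nxi > 0"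
proof -
  obtain I where "\<xi> I \<noteq> 0" using \<xi>(2) by blast
  then show ?thesis unfolding nxi_def by (intro sum_pos2[of UNIV I]) auto
qed

lemma gam_bounds:
  assumes "\<And>i. \<bar>x $ i - x0 $ i\<bar> \<le> R"
  shows "lower * nxi \<le> gam x" "gam x \<le> upper * nxi"
  unfolding gam_def nxi_def sum_distrib_left by (intro sum_mono lower(2) upper(2) assms)+

lemma cutoff_zero_outside:
  assumes "k i < 1 \<or> k i \<ge> L - 1" shows "cutoff (A.pt k) = 0"
proof (rule cutoff_eq_0)
  have "h * real_of_int (k i) \<le> 0 \<or> h * real_of_int (k i) \<ge> 2 * R"
    using assms
  proof
    assume "k i < 1" then have "real_of_int (k i) \<le> 0" by simp
    then show ?thesis using h_pos by (simp add: mult_le_0_iff)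
  next
    assume "k i \<ge> L - 1" then have "real_of_int (L - 1) \<le> real_of_int (k i)" by linarith
    then have "h * real_of_int (L - 1) \<le> h * real_of_int (k i)" using h_pos by (intro mult_left_mono) auto
    then show ?thesis unfolding h_L by simp
  qed
  then have "R \<le> \<bar>(A.pt k - x0) $ i\<bar>" using coord[of k i] by auto
  also have "\<dots> \<le> norm (A.pt k - x0)" by (rule component_le_norm_cart)
  finally show "3 * R / 4 \<le> norm (A.pt k - x0)" using R by simp
qed

lemma cutoff_zero_outside_Box:
  assumes "k \<notin> grid.Box I" shows "cutoff (A.pt k) = 0"
proof -
  obtain i where "\<not> (1 \<le> k i \<and> k i < (if i \<in> I then L - 1 else L))"
    using assms unfolding grid.Box_def by blast
  then have "k i < 1 \<or> k i \<ge> L - 1" by (auto split: if_splits)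
  then show ?thesis by (rule cutoff_zero_outside)
qed

lemma cochain_f: "grid.cochain q f" and cochain_\<alpha>: "grid.cochain q \<alpha>"
  using \<xi>(1) cutoff_zero_outside_Box by (auto simp: grid.cochain_def f_def \<alpha>_def)

lemma d_f: "grid.d f k K = 0"
  by (rule grid.d_const[of _ \<xi>]) (simp add: f_def)

lemma ip_eq: "A.ip \<beta> \<gamma> = (\<Sum>k\<in>grid.X. \<Sum>I\<in>UNIV. w (A.pt k) * (\<beta> k I \<bullet> (G (A.pt k) *v \<gamma> k I)))"
  unfolding A.ip_def A.lip_def
  by (subst sum.swap) (simp add: wG_def scaleR_matrix_vector_assoc[symmetric])

lemma ip_\<alpha>_\<alpha>: "A.ip \<alpha> \<alpha> = (\<Sum>k\<in>grid.X. (cutoff (A.pt k))\<^sup>2 * (w (A.pt k) * gam (A.pt k)))"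
  unfolding ip_eq gam_def \<alpha>_def
  by (simp add: matrix_vector_mult_scaleR sum_distrib_left power2_eq_square mult_ac)

lemma ip_f_\<alpha>: "A.ip f \<alpha> = (\<Sum>k\<in>grid.X. cutoff (A.pt k) * (w (A.pt k) * gam (A.pt k)))"
proof -
  have eq: "w (A.pt k) * (f k I \<bullet> (G (A.pt k) *v \<alpha> k I)) = cutoff (A.pt k) * (w (A.pt k) * (\<xi> I \<bullet> (G (A.pt k) *v \<xi> I)))" for k I
    using cutoff_zero_outside_Box[of k I] by (auto simp: f_def \<alpha>_def matrix_vector_mult_scaleR)
  show ?thesis unfolding ip_eq gam_def eq by (simp only: sum_distrib_left)
qed

lemma gam_nonneg: "k \<in> grid.X \<Longrightarrow> 0 \<le> gam (A.pt k)"
  using gam_bounds(1)[OF X_in_cube] nxi_pos lower(1) by (meson less_imp_le mult_pos_pos order.trans)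

lemma ip_\<alpha>_le: "A.ip \<alpha> \<alpha> \<le> A.ip f \<alpha>"
  unfolding ip_\<alpha>_\<alpha> ip_f_\<alpha>
  by (intro sum_mono mult_right_mono mult_nonneg_nonneg gam_nonneg)
    (auto simp: power2_eq_square mult_left_le_one_le less_imp_le)

lemma tail_nonneg: "tail \<ge> 0"
  unfolding tail_def by (intro sum_nonneg) (auto simp: less_imp_le)

lemma ip_f_f_le: "A.ip f f \<le> A.ip \<alpha> \<alpha> + upper * nxi * tail"
proof -
  have "A.ip f f \<le> (\<Sum>k\<in>grid.X. w (A.pt k) * gam (A.pt k))"
    unfolding ip_eq gam_def sum_distrib_left
  proof (intro sum_mono)
    fix k I assume k: "k \<in> grid.X"
    have "0 \<le> \<xi> I \<bullet> (G (A.pt k) *v \<xi> I)"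
      using G cube_in_U X_in_cube[OF k] pos_def_sym_inner_ge by blast
    then show "w (A.pt k) * (f k I \<bullet> (G (A.pt k) *v f k I)) \<le> w (A.pt k) * (\<xi> I \<bullet> (G (A.pt k) *v \<xi> I))"
      by (auto simp: f_def less_imp_le)
  qed
  also have "\<dots> \<le> (\<Sum>k\<in>grid.X. (cutoff (A.pt k))\<^sup>2 * (w (A.pt k) * gam (A.pt k)) +
      upper * nxi * (if norm (A.pt k - x0) \<ge> R / 4 then w (A.pt k) else 0))"
  proof (rule sum_mono)
    fix k assume k: "k \<in> grid.X"
    show "w (A.pt k) * gam (A.pt k) \<le> (cutoff (A.pt k))\<^sup>2 * (w (A.pt k) * gam (A.pt k)) +
      upper * nxi * (if norm (A.pt k - x0) \<ge> R / 4 then w (A.pt k) else 0)"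
    proof (cases "norm (A.pt k - x0) \<ge> R / 4")
      case False
      then have "cutoff (A.pt k) = 1" using R by (intro cutoff_eq_1) simp
      then show ?thesis using False by simp
    next
      case True
      have "w (A.pt k) * gam (A.pt k) \<le> w (A.pt k) * (upper * nxi)"
        using gam_bounds(2)[OF X_in_cube[OF k]] by (intro mult_left_mono) (auto simp: less_imp_le)
      moreover have "0 \<le> (cutoff (A.pt k))\<^sup>2 * (w (A.pt k) * gam (A.pt k))"
        using gam_nonneg[OF k] by (simp add: less_imp_le)
      moreover have "w (A.pt k) * (upper * nxi) = upper * nxi * w (A.pt k)" by simp
      ultimately show ?thesis unfolding if_P[OF True] by linarith
    qed
  qed
  also have "\<dots> = A.ip \<alpha> \<alpha> + upper * nxi * tail"
    by (simp add: ip_\<alpha>_\<alpha> tail_def sum.distrib sum_distrib_left)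
  finally show ?thesis .
qed

lemma D_\<alpha>: "grid.D i (\<lambda>k. \<alpha> k I) k = ((cutoff (A.pt (grid.up i k)) - cutoff (A.pt k)) / h) *\<^sub>R \<xi> I"
  by (simp add: grid.D_def \<alpha>_def algebra_simps divide_inverse)

lemma cutoff_difference:
  assumes k: "k \<in> grid.X"
  shows "\<bar>(cutoff (A.pt (grid.up i k)) - cutoff (A.pt k)) / h\<bar> \<le> (if norm (A.pt k - x0) \<ge> R / 4 then 4 / R else 0)"
\<comment> \<open>In the last layer \<open>up i\<close> wraps around to layer 0; the cutoff vanishes
  in both.\<close>
proof (cases "k i = L - 1")
  case True
  then have "cutoff (A.pt k) = 0" "cutoff (A.pt (grid.up i k)) = 0"
    by (intro cutoff_zero_outside[of _ i]; simp add: grid.up_def)+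
  then show ?thesis using R by simp
next
  case False
  then have "grid.up i k = k(i := k i + 1)" using k by (auto simp: grid.up_def grid.X_def dest: spec[of _ i])
  then have pt: "A.pt (grid.up i k) = A.pt k + h *\<^sub>R axis i 1" by (simp only: lattice_point_upd)
  have "\<bar>cutoff (A.pt (grid.up i k)) - cutoff (A.pt k)\<bar> \<le> 4 / R * h"
    using cutoff_Lipschitz[of "A.pt (grid.up i k)" "A.pt k"] h_pos by (simp add: pt)
  then have bound: "\<bar>(cutoff (A.pt (grid.up i k)) - cutoff (A.pt k)) / h\<bar> \<le> 4 / R"
    using h_pos by (simp add: field_simps abs_divide)
  show ?thesis
  proof (cases "norm (A.pt k - x0) \<ge> R / 4")
    case True then show ?thesis using bound by simp
  next
    case False
    have "norm (A.pt (grid.up i k) - x0) \<le> norm (A.pt k - x0) + norm (h *\<^sub>R axis i (1::real))"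
      unfolding pt using norm_triangle_ineq[of "A.pt k - x0" "h *\<^sub>R axis i 1"] by (simp add: algebra_simps)
    then have "norm (A.pt (grid.up i k) - x0) \<le> R / 2" using False h_pos h_le R by simp
    then have "cutoff (A.pt (grid.up i k)) = 1" by (rule cutoff_eq_1)
    moreover have "cutoff (A.pt k) = 1" using False R by (intro cutoff_eq_1) simp
    ultimately show ?thesis using False by simp
  qed
qed

lemma norm_xi_le: "(norm (\<xi> I))\<^sup>2 \<le> nxi"
  unfolding nxi_def by (rule member_le_sum) auto

lemma D_\<alpha>_norm:
  assumes k: "k \<in> grid.X"
  shows "(norm (grid.D i (\<lambda>k. \<alpha> k I) k))\<^sup>2 \<le> (if norm (A.pt k - x0) \<ge> R / 4 then 16 / R\<^sup>2 * nxi else 0)"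
proof -
  let ?s = "(cutoff (A.pt (grid.up i k)) - cutoff (A.pt k)) / h"
  have "(norm (grid.D i (\<lambda>k. \<alpha> k I) k))\<^sup>2 = \<bar>?s\<bar>\<^sup>2 * (norm (\<xi> I))\<^sup>2"
    unfolding D_\<alpha> by (simp only: norm_scaleR power_mult_distrib)
  also have "\<dots> \<le> (if norm (A.pt k - x0) \<ge> R / 4 then 4 / R else 0)\<^sup>2 * nxi"
    by (intro mult_mono power_mono cutoff_difference k norm_xi_le) auto
  also have "\<dots> = (if norm (A.pt k - x0) \<ge> R / 4 then 16 / R\<^sup>2 * nxi else 0)"
    by (simp add: power_divide)
  finally show ?thesis .
qed

definition subsets :: real where "subsets = real (card (UNIV :: 'n set set) * CARD('n))"

lemma sum_subsets_le:
  fixes F :: "'n set \<Rightarrow> 'n \<Rightarrow> real"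
  assumes "\<And>J i. F J i \<le> c" "c \<ge> 0"
  shows "(\<Sum>J\<in>UNIV. \<Sum>i\<in>-J. F J i) \<le> subsets * c"
proof -
  have "(\<Sum>J\<in>UNIV. \<Sum>i\<in>-J. F J i) \<le> (\<Sum>J\<in>(UNIV::'n set set). \<Sum>i\<in>-J. c)"
    by (intro sum_mono assms)
  also have "\<dots> \<le> (\<Sum>J\<in>(UNIV::'n set set). \<Sum>i\<in>(UNIV::'n set). c)"
    by (intro sum_mono sum_mono2) (use assms in auto)
  finally show ?thesis by (simp add: subsets_def)
qed

lemma energy_\<alpha>_le: "A.energy \<alpha> \<le> 2 * subsets * (upper * (16 / R\<^sup>2 * nxi)) * tail"
proof -
  let ?c = "upper * (16 / R\<^sup>2 * nxi) * tail"
  let ?q = "\<lambda>i I k. grid.D i (\<lambda>k. \<alpha> k I) k \<bullet> (wG \<sigma> x0 (A.pt k) *v grid.D i (\<lambda>k. \<alpha> k I) k)"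
  have q0: "0 \<le> ?q i I k" if "k \<in> grid.X" for i I k using that by (rule A.G_nonneg)
  have c0: "?c \<ge> 0" using tail_nonneg upper(1) nxi_pos by simp
  have q: "?q i I k \<le> upper * (16 / R\<^sup>2 * nxi) * (if norm (A.pt k - x0) \<ge> R / 4 then w (A.pt k) else 0)"
    if k: "k \<in> grid.X" for i I k
  proof -
    have "?q i I k = w (A.pt k) * (grid.D i (\<lambda>k. \<alpha> k I) k \<bullet> (G (A.pt k) *v grid.D i (\<lambda>k. \<alpha> k I) k))"
      by (simp add: wG_def scaleR_matrix_vector_assoc[symmetric])
    also have "\<dots> \<le> w (A.pt k) * (upper * (norm (grid.D i (\<lambda>k. \<alpha> k I) k))\<^sup>2)"
      by (intro mult_left_mono upper(2) X_in_cube k) (simp add: less_imp_le)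
    also have "\<dots> \<le> w (A.pt k) * (upper * (if norm (A.pt k - x0) \<ge> R / 4 then 16 / R\<^sup>2 * nxi else 0))"
      using upper(1) by (intro mult_left_mono D_\<alpha>_norm k) (auto simp: less_imp_le)
    finally show ?thesis by (simp add: mult_ac split: if_splits)
  qed
  have sumX: "(\<Sum>k\<in>grid.X. ?q i I k) \<le> ?c" for i I
    unfolding tail_def sum_distrib_left by (intro sum_mono q)
  have sumB: "(\<Sum>k\<in>grid.Box I'. ?q i I k) \<le> ?c" for i I I'
    by (rule order.trans[OF sum_mono2 sumX[of i I]]) (use grid.Box_subset_X q0 in auto)
  have "A.energy \<alpha> \<le> subsets * ?c + subsets * ?c"
    unfolding A.energy_def A.lip_def by (intro add_mono sum_subsets_le sumX sumB c0)
  then show ?thesis by (simp add: mult_ac)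
qed

text \<open>The yardstick for all sums over the grid, which carry no volume factor; it cancels in
  \<open>final_estimate\<close>.\<close>

definition Y :: real where "Y = real (card grid.X)"

lemma norm2_\<alpha>_le: "grid.norm2 \<alpha> \<le> nxi * Y"
proof -
  have "grid.norm2 \<alpha> \<le> (\<Sum>I\<in>(UNIV :: 'n set set). \<Sum>k\<in>grid.X. (norm (\<xi> I))\<^sup>2)"
    unfolding grid.norm2_def
    by (intro sum_mono power_mono) (auto simp: \<alpha>_def mult_left_le_one_le)
  also have "\<dots> = nxi * Y" by (simp add: nxi_def Y_def sum_distrib_left mult.commute)
  finally show ?thesis .
qed

lemma energy0_\<alpha>_le: "grid.energy0 \<alpha> \<le> 2 * subsets * (16 / R\<^sup>2 * nxi) * Y"
proof -
  let ?c = "16 / R\<^sup>2 * nxi * Y"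
  have c0: "?c \<ge> 0" using nxi_pos by (simp add: Y_def)
  have q: "(norm (grid.D i (\<lambda>k. \<alpha> k I) k))\<^sup>2 \<le> 16 / R\<^sup>2 * nxi" if "k \<in> grid.X" for i I k
    using D_\<alpha>_norm[OF that, of i I] nxi_pos by (auto split: if_splits elim: order.trans)
  have sumX: "(\<Sum>k\<in>grid.X. (norm (grid.D i (\<lambda>k. \<alpha> k I) k))\<^sup>2) \<le> ?c" for i I
    using sum_mono[of grid.X "\<lambda>k. (norm (grid.D i (\<lambda>k. \<alpha> k I) k))\<^sup>2" "\<lambda>_. 16 / R\<^sup>2 * nxi"] q
    by (simp add: Y_def mult_ac)
  have sumB: "(\<Sum>k\<in>grid.Box I'. (norm (grid.D i (\<lambda>k. \<alpha> k I) k))\<^sup>2) \<le> ?c" for i I I'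
    by (rule order.trans[OF sum_mono2 sumX[of i I]]) (use grid.Box_subset_X in auto)
  have "grid.energy0 \<alpha> \<le> subsets * ?c + subsets * ?c"
    unfolding grid.energy0_def by (intro add_mono sum_subsets_le sumX sumB c0)
  then show ?thesis by (simp add: mult_ac)
qed

lemma tail_le: "tail \<le> exp (- \<sigma> * R\<^sup>2 / 16) * Y"
proof -
  have "tail \<le> (\<Sum>k\<in>grid.X. exp (- \<sigma> * R\<^sup>2 / 16))"
    unfolding tail_def
  proof (rule sum_mono)
    fix k
    have "w (A.pt k) \<le> exp (- \<sigma> * R\<^sup>2 / 16)" if "norm (A.pt k - x0) \<ge> R / 4"
    proof -
      have "(R / 4)\<^sup>2 \<le> (norm (A.pt k - x0))\<^sup>2" using that R by (intro power_mono) auto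
      then have "\<sigma> * (R\<^sup>2 / 16) \<le> \<sigma> * (norm (A.pt k - x0))\<^sup>2"
        using \<sigma> by (intro mult_left_mono) (auto simp: power_divide)
      then show ?thesis by (simp add: weight_def)
    qed
    then show "(if R / 4 \<le> norm (A.pt k - x0) then w (A.pt k) else 0) \<le> exp (- \<sigma> * R\<^sup>2 / 16)" by simp
  qed
  then show ?thesis by (simp add: Y_def mult.commute)
qed

text \<open>The denominator comes from counting: at least a fraction 1/(8n)^n of the grid points
  lies in the concentric cube of half side R/(8n), where the cutoff is 1.\<close>

definition \<kappa> :: real where "\<kappa> = lower * nxi / (8 * real CARD('n)) ^ CARD('n)"

lemma \<kappa>_pos: "\<kappa> > 0" using lower(1) nxi_pos n_pos by (simp add: \<kappa>_def)

lemma ip_\<alpha>_ge: "\<kappa> * exp (- \<sigma> * R\<^sup>2 / 64) * Y \<le> A.ip \<alpha> \<alpha>"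
proof -
  \<comment> \<open>h * ?c = R, so ?c is the index of the centre x0 in every coordinate, and B
    consists of the points at most m steps away from it in each direction.\<close>
  let ?c = "8 * int CARD('n) * int m"
  define B where "B = PiE (UNIV :: 'n set) (\<lambda>_. {?c - int m .. ?c + int m})"
  have B: "k \<in> B \<longleftrightarrow> (\<forall>i. \<bar>k i - ?c\<bar> \<le> int m)" for k
  proof -
    have "\<bar>k i - ?c\<bar> \<le> int m \<longleftrightarrow> ?c - int m \<le> k i \<and> k i \<le> ?c + int m" for i by linarith
    then show ?thesis unfolding B_def PiE_UNIV_domain by (simp only: Pi_iff atLeastAtMost_iff UNIV_I) simp
  qed
  have "card B = (2 * m + 1) ^ CARD('n)"
    unfolding B_def by (simp add: card_PiE nat_add_distrib nat_mult_distrib)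
  have "1 * int m \<le> 8 * int CARD('n) * int m" using n_pos by (intro mult_right_mono; linarith)
  then have mc: "int m \<le> ?c" by simp
  have BX: "B \<subseteq> grid.X"
  proof
    fix k assume k: "k \<in> B"
    have "0 \<le> k i \<and> k i < L" for i
    proof -
      have "\<bar>k i - ?c\<bar> \<le> int m" using k unfolding B by blast
      moreover have "L = 2 * ?c + 1" by (simp add: L_def)
      ultimately show ?thesis using mc by linarith
    qed
    then show "k \<in> grid.X" by (simp add: grid.X_def)
  qed
  have near: "(norm (A.pt k - x0))\<^sup>2 \<le> R\<^sup>2 / 64" if k: "k \<in> B" for k
  proof -
    have hc: "h * real_of_int ?c = R" using m n_pos by (simp add: h_def)
    have c: "\<bar>(A.pt k - x0) $ i\<bar> \<le> R / (8 * real CARD('n))" for i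
    proof -
      have "(A.pt k - x0) $ i = h * real_of_int (k i - ?c)"
        using coord[of k i] hc by (simp add: right_diff_distrib)
      then have "\<bar>(A.pt k - x0) $ i\<bar> = h * real_of_int \<bar>k i - ?c\<bar>"
        using h_pos by (simp add: abs_mult)
      also have "\<dots> \<le> h * real m"
      proof (rule mult_left_mono)
        have "\<bar>k i - ?c\<bar> \<le> int m" using k unfolding B by blast
        then show "real_of_int \<bar>k i - ?c\<bar> \<le> real m" by linarith
      qed (use h_pos in simp)
      finally show ?thesis using m by (simp add: h_def)
    qed
    have "(norm (A.pt k - x0))\<^sup>2 = (\<Sum>i\<in>UNIV. \<bar>(A.pt k - x0) $ i\<bar>\<^sup>2)"
      by (simp add: norm_vec_def L2_set_def sum_nonneg)
    also have "\<dots> \<le> (\<Sum>i\<in>(UNIV::'n set). (R / (8 * real CARD('n)))\<^sup>2)"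
      by (intro sum_mono power_mono c) auto
    also have "\<dots> = R\<^sup>2 / 64 / real CARD('n)"
      by (simp add: power_divide power_mult_distrib power2_eq_square)
    also have "\<dots> \<le> R\<^sup>2 / 64"
      using n_pos by (simp add: divide_le_eq mult_le_cancel_left1)
    finally show ?thesis .
  qed
  have "Y = real (nat L) ^ CARD('n)" by (simp add: Y_def grid.card_X)
  also have "\<dots> \<le> (8 * real CARD('n) * (2 * real m + 1)) ^ CARD('n)"
  proof (rule power_mono)
    have "real (nat L) = 16 * real CARD('n) * real m + 1"
      unfolding L_def by (simp add: nat_add_distrib nat_mult_distrib)
    also have "\<dots> \<le> 16 * real CARD('n) * real m + 8 * real CARD('n)" using n_pos by linarith
    also have "\<dots> = 8 * real CARD('n) * (2 * real m + 1)" by (simp add: algebra_simps)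
    finally show "real (nat L) \<le> 8 * real CARD('n) * (2 * real m + 1)" .
  qed simp
  finally have Y: "Y \<le> (8 * real CARD('n)) ^ CARD('n) * real (card B)"
    unfolding \<open>card B = _\<close> by (simp add: power_mult_distrib add.commute)
  define E where "E = exp (- \<sigma> * R\<^sup>2 / 64)"
  define P where "P = (8 * real CARD('n)) ^ CARD('n)"
  have "8 * real CARD('n) > 0" using n_pos by linarith
  then have "P > 0" unfolding P_def by (rule zero_less_power)
  then have P: "\<kappa> * P = lower * nxi" unfolding \<kappa>_def P_def[symmetric] by simp
  have E: "E > 0" by (simp add: E_def)
  have "\<kappa> * E * Y \<le> \<kappa> * E * (P * real (card B))"
    using \<kappa>_pos E Y unfolding P_def[symmetric] by (intro mult_left_mono) auto
  moreover have "\<kappa> * E * (P * real (card B)) = (\<Sum>k\<in>B. E * (lower * nxi))"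
    unfolding P[symmetric] by simp
  moreover have "(\<Sum>k\<in>B. E * (lower * nxi)) \<le> (\<Sum>k\<in>B. (cutoff (A.pt k))\<^sup>2 * (w (A.pt k) * gam (A.pt k)))"
  proof (rule sum_mono)
    fix k assume k: "k \<in> B"
    then have kX: "k \<in> grid.X" by (rule subsetD[OF BX])
    have "norm (A.pt k - x0) \<le> R / 8"
    proof (rule power2_le_imp_le)
      show "(norm (A.pt k - x0))\<^sup>2 \<le> (R / 8)\<^sup>2" using near[OF k] by (simp add: power_divide)
    qed (use R in simp)
    then have 1: "cutoff (A.pt k) = 1" using R by (intro cutoff_eq_1) simp
    have "\<sigma> * (norm (A.pt k - x0))\<^sup>2 \<le> \<sigma> * (R\<^sup>2 / 64)" using near[OF k] \<sigma> by (intro mult_left_mono) auto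
    then have "E \<le> w (A.pt k)" by (simp add: E_def weight_def)
    moreover have "0 \<le> lower * nxi" using lower(1) nxi_pos by simp
    ultimately have "E * (lower * nxi) \<le> w (A.pt k) * gam (A.pt k)"
      using gam_bounds(1)[OF X_in_cube[OF kX]] E by (intro mult_mono) auto
    then show "E * (lower * nxi) \<le> (cutoff (A.pt k))\<^sup>2 * (w (A.pt k) * gam (A.pt k))"
      by (simp add: 1)
  qed
  moreover have "(\<Sum>k\<in>B. (cutoff (A.pt k))\<^sup>2 * (w (A.pt k) * gam (A.pt k))) \<le> A.ip \<alpha> \<alpha>"
    unfolding ip_\<alpha>_\<alpha> by (intro sum_mono2 BX) (auto simp: gam_nonneg less_imp_le)
  ultimately show ?thesis unfolding E_def by linarith
qed

text \<open>The Bochner identity read as an upper bound: |d \<alpha>|^2 is dropped on the left, and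
  the energy lives in the tail. Since \<open>gam\<close> is at most \<open>upper * nxi\<close>,
  curvature below - c0 is also below - c0 / (upper * nxi) times \<open>gam\<close>, that is,
  proportional to the norm.\<close>

lemma \<delta>_\<alpha>_le:
  assumes close: "A.Bochner_close \<epsilon>" and "\<epsilon> > 0"
    and curv: "\<And>x. (\<And>i. \<bar>x $ i - x0 $ i\<bar> \<le> R) \<Longrightarrow> curv x \<xi> \<le> - c0" and "c0 > 0"
  shows "A.ip (A.\<delta> \<alpha>) (A.\<delta> \<alpha>) \<le> (2 * \<sigma> * real q - c0 / (upper * nxi)) * A.ip \<alpha> \<alpha> +
    2 * subsets * (upper * (16 / R\<^sup>2 * nxi)) * tail + \<epsilon> * (nxi + 2 * subsets * (16 / R\<^sup>2 * nxi)) * Y"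
proof -
  have c: "W.curv (A.pt k) (\<alpha> k) \<le> (2 * \<sigma> * real q - c0 / (upper * nxi)) * ((cutoff (A.pt k))\<^sup>2 * (w (A.pt k) * gam (A.pt k)))"
    if k: "k \<in> grid.X" for k
  proof -
    let ?x = "A.pt k"
    have "c0 / (upper * nxi) * gam ?x \<le> c0 / (upper * nxi) * (upper * nxi)"
      using gam_bounds(2)[OF X_in_cube[OF k]] \<open>c0 > 0\<close> upper(1) nxi_pos by (intro mult_left_mono) auto
    then have "curv ?x \<xi> \<le> - (c0 / (upper * nxi) * gam ?x)"
      using curv[OF X_in_cube[OF k]] upper(1) nxi_pos by simp
    then have le: "curv ?x \<xi> + 2 * \<sigma> * real q * gam ?x \<le> (2 * \<sigma> * real q - c0 / (upper * nxi)) * gam ?x"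
      by (simp add: left_diff_distrib)
    have "W.curv ?x (\<alpha> k) = w ?x * (curv ?x (\<alpha> k) + 2 * \<sigma> * real q * (\<Sum>I\<in>UNIV. \<alpha> k I \<bullet> (G ?x *v \<alpha> k I)))"
      by (rule weighted_curv) (use cube_in_U X_in_cube[OF k] \<xi>(1) in \<open>auto simp: \<alpha>_def\<close>)
    also have "curv ?x (\<alpha> k) = (cutoff ?x)\<^sup>2 * curv ?x \<xi>"
      unfolding curv_def \<alpha>_def
      by (simp add: matrix_vector_mult_scaleR sum_distrib_left power2_eq_square mult_ac)
    also have "(\<Sum>I\<in>UNIV. \<alpha> k I \<bullet> (G ?x *v \<alpha> k I)) = (cutoff ?x)\<^sup>2 * gam ?x"
      unfolding gam_def \<alpha>_def
      by (simp add: matrix_vector_mult_scaleR sum_distrib_left power2_eq_square mult_ac)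
    also have "w ?x * ((cutoff ?x)\<^sup>2 * curv ?x \<xi> + 2 * \<sigma> * real q * ((cutoff ?x)\<^sup>2 * gam ?x)) =
      (cutoff ?x)\<^sup>2 * w ?x * (curv ?x \<xi> + 2 * \<sigma> * real q * gam ?x)" by (simp add: algebra_simps)
    also have "\<dots> \<le> (cutoff ?x)\<^sup>2 * w ?x * ((2 * \<sigma> * real q - c0 / (upper * nxi)) * gam ?x)"
      by (intro mult_left_mono le) (simp add: less_imp_le)
    finally show ?thesis by (simp add: mult_ac)
  qed
  have "A.ip (A.\<delta> \<alpha>) (A.\<delta> \<alpha>) \<le> A.ip (A.\<delta> \<alpha>) (A.\<delta> \<alpha>) + A.ip (grid.d \<alpha>) (grid.d \<alpha>)"
    using A.ip_nonneg by simp
  also have "\<dots> \<le> (\<Sum>k\<in>grid.X. W.curv (A.pt k) (\<alpha> k)) + A.energy \<alpha> + \<epsilon> * (grid.norm2 \<alpha> + grid.energy0 \<alpha>)"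
  proof -
    have "\<bar>A.ip (A.\<delta> \<alpha>) (A.\<delta> \<alpha>) + A.ip (grid.d \<alpha>) (grid.d \<alpha>) -
        (\<Sum>k\<in>grid.X. W.curv (A.pt k) (\<alpha> k)) - A.energy \<alpha>\<bar> \<le> \<epsilon> * (grid.norm2 \<alpha> + grid.energy0 \<alpha>)"
      using close cochain_\<alpha> unfolding A.Bochner_close_def by blast
    then show ?thesis using abs_le_D1 by fastforce
  qed
  also have "\<dots> \<le> (2 * \<sigma> * real q - c0 / (upper * nxi)) * A.ip \<alpha> \<alpha> +
    2 * subsets * (upper * (16 / R\<^sup>2 * nxi)) * tail + \<epsilon> * (nxi * Y + 2 * subsets * (16 / R\<^sup>2 * nxi) * Y)"
    unfolding ip_\<alpha>_\<alpha> sum_distrib_left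
    using \<open>\<epsilon> > 0\<close> by (intro add_mono sum_mono c energy_\<alpha>_le mult_left_mono norm2_\<alpha>_le energy0_\<alpha>_le) auto
  finally show ?thesis by (simp add: algebra_simps)
qed

lemma weight_ge:
  assumes "\<And>i. \<bar>x $ i - x0 $ i\<bar> \<le> R"
  shows "exp (- \<sigma> * (real CARD('n) * R\<^sup>2)) \<le> w x"
proof -
  have "(norm (x - x0))\<^sup>2 = (\<Sum>i\<in>UNIV. \<bar>x $ i - x0 $ i\<bar>\<^sup>2)"
    by (simp add: norm_vec_def L2_set_def sum_nonneg)
  also have "\<dots> \<le> (\<Sum>i\<in>(UNIV::'n set). R\<^sup>2)"
    by (intro sum_mono power_mono assms) auto
  finally have "\<sigma> * (norm (x - x0))\<^sup>2 \<le> \<sigma> * (real CARD('n) * R\<^sup>2)"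
    using \<sigma> by (intro mult_left_mono) auto
  then show ?thesis by (simp add: weight_def)
qed

text \<open>Duality: solve d u = f with the estimate for G', then write <f, \<alpha>> = <d u,
  \<alpha>> = <u, \<delta> \<alpha>> in the inner product of G and apply Cauchy-Schwarz. The passage
  from G' to G uses only the values of both metrics.\<close>

lemma comparison:
  fixes G' P' S'
  assumes G': "C2_metric U G' P' S'" and q: "q = Suc p"
    and le1: "\<And>x v. (\<And>i. \<bar>x $ i - x0 $ i\<bar> \<le> R) \<Longrightarrow> v \<bullet> (G' x *v v) \<le> v \<bullet> (G x *v v)"
    and le2: "\<And>x v. (\<And>i. \<bar>x $ i - x0 $ i\<bar> \<le> R) \<Longrightarrow> v \<bullet> (G x *v v) \<le> (1 + \<eta>) * (v \<bullet> (G' x *v v))"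
    and nonneg: "\<And>x a. x \<in> U \<Longrightarrow> (\<And>I. card I \<noteq> q \<Longrightarrow> a I = 0) \<Longrightarrow> C2_metric.curv G' P' S' x a \<ge> 0"
    and lower': "c' > 0" "\<And>x v. (\<And>i. \<bar>x $ i - x0 $ i\<bar> \<le> R) \<Longrightarrow> c' * (norm v)\<^sup>2 \<le> v \<bullet> (G' x *v v)"
    and close: "C2_lattice.Bochner_close (C2_metric.wG G' \<sigma> x0) (C2_metric.wP G' P' \<sigma> x0)
      (C2_metric.wS G' P' S' \<sigma> x0) L h z (c' * exp (- \<sigma> * (real CARD('n) * R\<^sup>2)) * e)"
    and e: "0 < e" "e \<le> 1" "e < 2 * \<sigma> * real q" and "\<eta> > 0"
  shows "(2 * \<sigma> * real q - e) * (A.ip f \<alpha>)\<^sup>2 \<le> (1 + \<eta>) * A.ip f f * A.ip (A.\<delta> \<alpha>) (A.\<delta> \<alpha>)"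
proof -
  interpret G': C2_metric U G' P' S' by fact
  interpret W': C2_metric U "G'.wG \<sigma> x0" "G'.wP \<sigma> x0" "G'.wS \<sigma> x0" by (rule G'.weighted)
  interpret B: C2_lattice U "G'.wG \<sigma> x0" "G'.wP \<sigma> x0" "G'.wS \<sigma> x0" L h "TYPE('n)" z
    by unfold_locales (use X_in_cube cube_in_U in blast)
  \<comment> \<open>A lower bound for the eigenvalues of the weighted G' on the cube; the admissible
    Bochner error is c * e.\<close>
  define c where "c = c' * exp (- \<sigma> * (real CARD('n) * R\<^sup>2))"
  have c: "c > 0" using lower'(1) by (simp add: c_def)
  have ipB: "B.ip \<beta> \<gamma> = (\<Sum>k\<in>grid.X. \<Sum>I\<in>UNIV. w (A.pt k) * (\<beta> k I \<bullet> (G' (A.pt k) *v \<gamma> k I)))" for \<beta> \<gamma>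
    unfolding B.ip_def B.lip_def
    by (subst sum.swap) (simp add: G'.wG_def scaleR_matrix_vector_assoc[symmetric])
  have lowerB: "c * (norm v)\<^sup>2 \<le> v \<bullet> (G'.wG \<sigma> x0 (A.pt k) *v v)" if k: "k \<in> grid.X" for k v
  proof -
    have "c * (norm v)\<^sup>2 = exp (- \<sigma> * (real CARD('n) * R\<^sup>2)) * (c' * (norm v)\<^sup>2)" by (simp add: c_def)
    also have "\<dots> \<le> w (A.pt k) * (v \<bullet> (G' (A.pt k) *v v))"
      using lower'(1) by (intro mult_mono weight_ge lower'(2) X_in_cube k) (auto simp: less_imp_le)
    finally show ?thesis by (simp add: G'.wG_def scaleR_matrix_vector_assoc[symmetric])
  qed
  have coercive: "(2 * \<sigma> * real q - e) * B.ip \<beta> \<beta> \<le> B.ip (B.\<delta> \<beta>) (B.\<delta> \<beta>) + B.ip (grid.d \<beta>) (grid.d \<beta>)"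
    if \<beta>: "grid.cochain (Suc p) \<beta>" for \<beta>
  proof -
    have "2 * \<sigma> * real q * B.ip \<beta> \<beta> \<le> (\<Sum>k\<in>grid.X. W'.curv (A.pt k) (\<beta> k))"
      unfolding ipB sum_distrib_left
    proof (rule sum_mono)
      fix k assume k: "k \<in> grid.X"
      have x: "A.pt k \<in> U" using X_in_cube[OF k] cube_in_U by blast
      have z: "\<beta> k I = 0" if "card I \<noteq> q" for I using \<beta> that q by (auto simp: grid.cochain_def)
      have "W'.curv (A.pt k) (\<beta> k) = w (A.pt k) * (G'.curv (A.pt k) (\<beta> k) +
        2 * \<sigma> * real q * (\<Sum>I\<in>UNIV. \<beta> k I \<bullet> (G' (A.pt k) *v \<beta> k I)))"
        by (rule G'.weighted_curv[OF x z])
      also have "\<dots> \<ge> w (A.pt k) * (2 * \<sigma> * real q * (\<Sum>I\<in>UNIV. \<beta> k I \<bullet> (G' (A.pt k) *v \<beta> k I)))"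
        using nonneg[OF x z] by (intro mult_left_mono) (auto simp: less_imp_le)
      finally show "(\<Sum>I\<in>UNIV. 2 * \<sigma> * real q * (w (A.pt k) * (\<beta> k I \<bullet> (G' (A.pt k) *v \<beta> k I)))) \<le>
          W'.curv (A.pt k) (\<beta> k)"
        by (simp add: sum_distrib_left mult_ac)
    qed
    \<comment> \<open>The gradient part of the error is absorbed by the energy, using e <= 1; the
      remaining part costs e of the constant 2 \<sigma> q.\<close>
    moreover have "c * e * grid.energy0 \<beta> \<le> B.energy \<beta>"
    proof -
      have "c * e * grid.energy0 \<beta> \<le> c * 1 * grid.energy0 \<beta>"
        using c e by (intro mult_right_mono mult_left_mono) auto
      also have "\<dots> \<le> B.energy \<beta>" using B.energy_bounds[OF lowerB, of \<beta>] by simp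
      finally show ?thesis .
    qed
    moreover have "c * e * grid.norm2 \<beta> \<le> e * B.ip \<beta> \<beta>"
    proof -
      have "c * grid.norm2 \<beta> \<le> B.ip \<beta> \<beta>"
        unfolding grid.norm2_def B.ip_def B.lip_def sum_distrib_left by (intro sum_mono lowerB)
      then have "e * (c * grid.norm2 \<beta>) \<le> e * B.ip \<beta> \<beta>" using e by (intro mult_left_mono) auto
      then show ?thesis by (simp add: mult_ac)
    qed
    moreover have "\<bar>B.ip (B.\<delta> \<beta>) (B.\<delta> \<beta>) + B.ip (grid.d \<beta>) (grid.d \<beta>) -
        (\<Sum>k\<in>grid.X. W'.curv (A.pt k) (\<beta> k)) - B.energy \<beta>\<bar> \<le> c * e * (grid.norm2 \<beta> + grid.energy0 \<beta>)"
      using close \<beta> unfolding B.Bochner_close_def c_def by blast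
    ultimately show ?thesis
      by (simp only: distrib_left left_diff_distrib)
  qed
  obtain u where u: "\<And>k I. k \<in> grid.X \<Longrightarrow> grid.d u k I = f k I"
    "(2 * \<sigma> * real q - e) * B.ip u u \<le> B.ip f f"
    using B.solve_d[OF _ coercive cochain_f[unfolded q] d_f] e by auto
  \<comment> \<open>The right-hand side passes to the larger metric G without loss, whereas the
    solution pays the factor 1 + \<eta>.\<close>
  have ff: "B.ip f f \<le> A.ip f f"
    unfolding ipB ip_eq by (intro sum_mono mult_left_mono le1 X_in_cube) (auto simp: less_imp_le)
  have uu: "A.ip u u \<le> (1 + \<eta>) * B.ip u u"
  proof -
    have "A.ip u u \<le> (\<Sum>k\<in>grid.X. \<Sum>I\<in>UNIV. w (A.pt k) * ((1 + \<eta>) * (u k I \<bullet> (G' (A.pt k) *v u k I))))"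
      unfolding ip_eq by (intro sum_mono mult_left_mono le2 X_in_cube) (auto simp: less_imp_le)
    then show ?thesis unfolding ipB by (simp add: sum_distrib_left mult.left_commute)
  qed
  have "A.ip f \<alpha> = A.ip (grid.d u) \<alpha>"
    unfolding A.ip_def by (intro sum.cong refl A.lip_cong) (simp_all add: u(1))
  also have "\<dots> = A.ip u (A.\<delta> \<alpha>)" by (rule A.ip_d_left[OF cochain_\<alpha>])
  finally have "(A.ip f \<alpha>)\<^sup>2 \<le> A.ip u u * A.ip (A.\<delta> \<alpha>) (A.\<delta> \<alpha>)"
    using A.ip_Cauchy_Schwarz by simp
  then have "(2 * \<sigma> * real q - e) * (A.ip f \<alpha>)\<^sup>2 \<le>
      (2 * \<sigma> * real q - e) * (A.ip u u * A.ip (A.\<delta> \<alpha>) (A.\<delta> \<alpha>))"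
    using e by (intro mult_left_mono) auto
  also have "\<dots> = ((2 * \<sigma> * real q - e) * A.ip u u) * A.ip (A.\<delta> \<alpha>) (A.\<delta> \<alpha>)" by simp
  also have "(2 * \<sigma> * real q - e) * A.ip u u \<le> (2 * \<sigma> * real q - e) * ((1 + \<eta>) * B.ip u u)"
    using e uu by (intro mult_left_mono) auto
  also have "\<dots> = (1 + \<eta>) * ((2 * \<sigma> * real q - e) * B.ip u u)" by simp
  also have "\<dots> \<le> (1 + \<eta>) * A.ip f f"
    using u(2) ff \<open>\<eta> > 0\<close> by (intro mult_left_mono) auto
  finally show ?thesis using A.ip_nonneg by (simp add: mult_right_mono)
qed

end

section \<open>The contradiction for large \<sigma>\<close>

lemma final_estimate:
  fixes m1 m2 F Z t Y :: real
  assumes m: "0 < m2" "m2 \<le> m1" and F: "F \<le> m2 + C2 * t"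
    and Z: "0 \<le> Z" "Z \<le> a * m2 + C1 * t + e * C3 * Y"
    and key: "c * m1\<^sup>2 \<le> (1 + e) * F * Z"
    and t: "t \<le> T * Y" and Y: "E * Y \<le> m2"
    and pos: "c > 0" "e > 0" "C1 > 0" "C2 > 0" "C3 > 0" "T > 0" "E > 0"
  shows "c \<le> (1 + e) * (1 + C2 * (T / E)) * (a + C1 * (T / E) + e * (C3 / E))"
proof -
  \<comment> \<open>In the application m1 = <f, \<alpha>>, m2 = <\<alpha>, \<alpha>>, F = <f, f>, Z
    = |\<delta> \<alpha>|^2 and t is the tail. Every error becomes a multiple of m2, and m2^2
    cancels at the end because m1 on the left may be lowered to m2.\<close>
  have Y': "Y \<le> m2 / E" using Y pos by (simp add: field_simps)
  have "T * Y \<le> T * (m2 / E)" using Y' pos by (intro mult_left_mono) auto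
  then have t': "t \<le> T / E * m2" using t by simp
  have F': "F \<le> (1 + C2 * (T / E)) * m2"
    using F mult_left_mono[OF t', of C2] pos by (simp add: algebra_simps)
  have Z': "Z \<le> (a + C1 * (T / E) + e * (C3 / E)) * m2"
    using Z(2) mult_left_mono[OF t', of C1] mult_left_mono[OF Y', of "e * C3"] pos by (simp add: algebra_simps)
  have "c * m2\<^sup>2 \<le> c * m1\<^sup>2" using m pos by (intro mult_left_mono power_mono) auto
  also have "\<dots> \<le> (1 + e) * F * Z" by (rule key)
  also have "\<dots> \<le> (1 + e) * ((1 + C2 * (T / E)) * m2) * Z"
    using F' Z(1) pos by (intro mult_right_mono mult_left_mono) auto
  also have "\<dots> \<le> (1 + e) * ((1 + C2 * (T / E)) * m2) * ((a + C1 * (T / E) + e * (C3 / E)) * m2)"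
    using Z' pos m by (intro mult_left_mono) auto
  also have "\<dots> = (1 + e) * (1 + C2 * (T / E)) * (a + C1 * (T / E) + e * (C3 / E)) * m2\<^sup>2"
    by (simp add: power2_eq_square)
  finally show ?thesis using m by (simp add: mult_le_cancel_right)
qed

text \<open>The quotient of exponentials is exp(-3 \<sigma> R^2/64) and beats the factor 2 \<sigma>
  q. The limit e -> 0 comes first, at fixed \<sigma>, because its coefficient contains exp(\<sigma>
  R^2/64). Letting \<sigma> -> \<infinity> then cancels 2 \<sigma> q on both sides and leaves 0 <= -
  c1.\<close>

lemma no_decay_inequality:
  fixes c1 C1 C2 \<kappa> R q :: real
  assumes "c1 > 0" "\<kappa> > 0" "R > 0"
    and ineq: "\<And>\<sigma> e. 0 < \<sigma> \<Longrightarrow> 0 < e \<Longrightarrow> e \<le> 1 \<Longrightarrow> e < 2 * \<sigma> * q \<Longrightarrow>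
      2 * \<sigma> * q - e \<le> (1 + e) * (1 + C2 * (exp (- \<sigma> * R\<^sup>2 / 16) / (\<kappa> * exp (- \<sigma> * R\<^sup>2 / 64)))) *
        (2 * \<sigma> * q - c1 + C1 * (exp (- \<sigma> * R\<^sup>2 / 16) / (\<kappa> * exp (- \<sigma> * R\<^sup>2 / 64))) + e * (C3 / (\<kappa> * exp (- \<sigma> * R\<^sup>2 / 64))))"
    and "q > 0"
  shows False
proof -
  define b where "b = R\<^sup>2 * 3 / 64"
  have b: "b > 0" using assms by (simp add: b_def)
  define \<tau> where "\<tau> \<sigma> = exp (- b * \<sigma>) / \<kappa>" for \<sigma>
  have \<tau>: "exp (- \<sigma> * R\<^sup>2 / 16) / (\<kappa> * exp (- \<sigma> * R\<^sup>2 / 64)) = \<tau> \<sigma>" for \<sigma>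
  proof -
    have "exp (- b * \<sigma>) = exp (- \<sigma> * R\<^sup>2 / 16 - (- \<sigma> * R\<^sup>2 / 64))"
      by (rule arg_cong[of _ _ exp]) (simp add: b_def field_simps)
    then show ?thesis unfolding \<tau>_def by (simp only: exp_diff) (simp add: mult.commute)
  qed
  have "0 \<le> (1 + C2 * \<tau> \<sigma>) * (2 * \<sigma> * q - c1 + C1 * \<tau> \<sigma>) - 2 * \<sigma> * q" if \<sigma>: "\<sigma> > 0" for \<sigma>
  proof -
    define C where "C = C3 / (\<kappa> * exp (- \<sigma> * R\<^sup>2 / 64))"
    have "((\<lambda>e. (1 + e) * (1 + C2 * \<tau> \<sigma>) * (2 * \<sigma> * q - c1 + C1 * \<tau> \<sigma> + e * C) - (2 * \<sigma> * q - e)) \<longlongrightarrow>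
      (1 + 0) * (1 + C2 * \<tau> \<sigma>) * (2 * \<sigma> * q - c1 + C1 * \<tau> \<sigma> + 0 * C) - (2 * \<sigma> * q - 0)) (at_right 0)"
      by (intro tendsto_intros)
    moreover have "\<forall>\<^sub>F e in at_right 0. 0 \<le> (1 + e) * (1 + C2 * \<tau> \<sigma>) * (2 * \<sigma> * q - c1 + C1 * \<tau> \<sigma> + e * C) - (2 * \<sigma> * q - e)"
      unfolding eventually_at_right_field
    proof (intro exI[of _ "min 1 (2 * \<sigma> * q)"] conjI allI impI)
      show "0 < min 1 (2 * \<sigma> * q)" using \<sigma> \<open>q > 0\<close> by simp
      fix e assume "0 < e" "e < min 1 (2 * \<sigma> * q)"
      then show "0 \<le> (1 + e) * (1 + C2 * \<tau> \<sigma>) * (2 * \<sigma> * q - c1 + C1 * \<tau> \<sigma> + e * C) - (2 * \<sigma> * q - e)"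
        using ineq[OF \<sigma>, of e] unfolding \<tau> C_def by simp
    qed
    ultimately show ?thesis using tendsto_lowerbound[OF _ _ trivial_limit_at_right_real] by fastforce
  qed
  then have ev: "\<forall>\<^sub>F \<sigma> in at_top. 0 \<le> (1 + C2 * \<tau> \<sigma>) * (2 * \<sigma> * q - c1 + C1 * \<tau> \<sigma>) - 2 * \<sigma> * q"
    by (intro eventually_mono[OF eventually_gt_at_top[of "0::real"]])
  have "((\<lambda>\<sigma>. (1 + C2 * \<tau> \<sigma>) * (2 * \<sigma> * q - c1 + C1 * \<tau> \<sigma>) - 2 * \<sigma> * q) \<longlongrightarrow> - c1) at_top"
  proof -
    have 1: "(\<tau> \<longlongrightarrow> 0) at_top" unfolding \<tau>_def using b \<open>\<kappa> > 0\<close> by real_asymp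
    have 2: "((\<lambda>\<sigma>. \<sigma> * \<tau> \<sigma>) \<longlongrightarrow> 0) at_top" unfolding \<tau>_def using b \<open>\<kappa> > 0\<close> by real_asymp
    have "((\<lambda>\<sigma>. 2 * q * C2 * (\<sigma> * \<tau> \<sigma>) + (1 + C2 * \<tau> \<sigma>) * (C1 * \<tau> \<sigma> - c1)) \<longlongrightarrow>
      2 * q * C2 * 0 + (1 + C2 * 0) * (C1 * 0 - c1)) at_top"
      by (intro tendsto_intros 1 2)
    moreover have "2 * q * C2 * (\<sigma> * \<tau> \<sigma>) + (1 + C2 * \<tau> \<sigma>) * (C1 * \<tau> \<sigma> - c1) =
      (1 + C2 * \<tau> \<sigma>) * (2 * \<sigma> * q - c1 + C1 * \<tau> \<sigma>) - 2 * \<sigma> * q" for \<sigma>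
      by (simp add: algebra_simps)
    ultimately show ?thesis by simp
  qed
  from tendsto_lowerbound[OF this ev] have "0 \<le> - c1" by simp
  then show False using \<open>c1 > 0\<close> by simp
qed

lemma curvature_contradiction:
  fixes g :: "(real,'n::{finite,linorder}) vec \<Rightarrow> real^'r^'r" and \<xi> :: "'n set \<Rightarrow> real^'r"
  assumes g: "C2_metric U g P S" and gs: "\<And>j. C2_metric U (gs j) (Ps j) (Ss j)"
    and q: "q = Suc p"
    and mono: "\<And>i j. i \<le> j \<Longrightarrow> metric_le U (gs i) (gs j)" and le: "\<And>j. metric_le U (gs j) g"
    and lim: "\<And>x. x \<in> U \<Longrightarrow> (\<lambda>j. gs j x) \<longlonglongrightarrow> g x"
    and nonneg: "\<And>j x a. x \<in> U \<Longrightarrow> (\<And>I. card I \<noteq> q \<Longrightarrow> a I = 0) \<Longrightarrow> C2_metric.curv (gs j) (Ps j) (Ss j) x a \<ge> 0"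
    and x0: "x0 \<in> U" and \<xi>: "\<And>I. card I \<noteq> q \<Longrightarrow> \<xi> I = 0" and neg: "C2_metric.curv g P S x0 \<xi> < 0"
  shows False
proof -
  interpret g: C2_metric U g P S by (rule g)
  \<comment> \<open>Half of the value at x0, so that the curvature on \<xi> stays below - c0 on a
    whole neighbourhood.\<close>
  define c0 where "c0 = - g.curv x0 \<xi> / 2"
  have c0: "c0 > 0" using neg by (simp add: c0_def)
  have \<xi>_ne: "\<exists>I. \<xi> I \<noteq> 0"
  proof (rule ccontr)
    assume "\<not> ?thesis"
    then have "g.curv x0 \<xi> = 0" by (simp add: g.curv_def)
    then show False using neg by simp
  qed
  have "continuous_on U (\<lambda>x. g.curv x \<xi>)"
    unfolding g.curv_def by (intro continuous_intros continuous_on_matrix_vector g.cont_M)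
  then have "isCont (\<lambda>x. g.curv x \<xi>) x0" using g.U x0 by (simp add: continuous_on_eq_continuous_at)
  then obtain r1 where r1: "r1 > 0" "\<And>x. dist x x0 < r1 \<Longrightarrow> dist (g.curv x \<xi>) (g.curv x0 \<xi>) < c0"
    using c0 unfolding continuous_at_eps_delta by blast
  obtain r2 where r2: "r2 > 0" "ball x0 r2 \<subseteq> U" using g.U x0 open_contains_ball by blast
  \<comment> \<open>Summing n coordinates bounds the distance from x0 in the cube by n R = min r1 r2
    / 2.\<close>
  define R where "R = min r1 r2 / (2 * real CARD('n))"
  have R: "R > 0" using r1 r2 by (simp add: R_def card_gt_0_iff)
  have near: "dist x x0 < min r1 r2" if "\<And>i. \<bar>x $ i - x0 $ i\<bar> \<le> R" for x
  proof -
    have "dist x x0 \<le> (\<Sum>i\<in>UNIV. \<bar>(x - x0) $ i\<bar>)" unfolding dist_norm by (rule norm_le_l1_cart)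
    also have "\<dots> \<le> (\<Sum>i\<in>(UNIV::'n set). R)" by (intro sum_mono) (simp add: that)
    also have "\<dots> = min r1 r2 / 2" by (simp add: R_def)
    also have "\<dots> < min r1 r2" using r1(1) r2(1) by linarith
    finally show ?thesis .
  qed
  have cube: "x \<in> U" if "\<And>i. \<bar>x $ i - x0 $ i\<bar> \<le> R" for x
    using near[OF that] r2(2) by (auto simp: dist_commute)
  have curv: "g.curv x \<xi> \<le> - c0" if "\<And>i. \<bar>x $ i - x0 $ i\<bar> \<le> R" for x
    using r1(2)[of x] near[OF that] by (simp add: dist_real_def c0_def)
  define K where "K = cbox (x0 - (\<chi> i. R)) (x0 + (\<chi> i. R))"
  have inK: "x \<in> K \<longleftrightarrow> (\<forall>i. \<bar>x $ i - x0 $ i\<bar> \<le> R)" for x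
    unfolding K_def mem_box_cart by (auto simp: abs_le_iff algebra_simps)
  have K: "compact K" "K \<subseteq> U" using cube inK by (auto simp: K_def)
  obtain lower where lower: "lower > 0" "\<And>x v. x \<in> K \<Longrightarrow> lower * (norm v)\<^sup>2 \<le> v \<bullet> (g x *v v)"
    using g.uniformly_positive[OF K] by blast
  obtain upper where upper: "upper > 0" "\<And>x v. x \<in> K \<Longrightarrow> v \<bullet> (g x *v v) \<le> upper * (norm v)\<^sup>2"
    using g.uniformly_bounded[OF K] by blast
  define nx where "nx = (\<Sum>I\<in>UNIV. (norm (\<xi> I))\<^sup>2)"
  define N where "N = real (card (UNIV :: 'n set set) * CARD('n))"
  define \<kappa> where "\<kappa> = lower * nx / (8 * real CARD('n)) ^ CARD('n)"
  define C1 where "C1 = 2 * N * (upper * (16 / R\<^sup>2 * nx))"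
  define C3 where "C3 = nx + 2 * N * (16 / R\<^sup>2 * nx)"
  have nx: "nx > 0"
  proof -
    obtain I where "\<xi> I \<noteq> 0" using \<xi>_ne by blast
    then show ?thesis unfolding nx_def by (intro sum_pos2[of UNIV I]) auto
  qed
  have N: "N > 0" by (simp add: N_def card_gt_0_iff)
  have \<kappa>: "\<kappa> > 0" using lower(1) nx by (simp add: \<kappa>_def card_gt_0_iff)
  have C: "C1 > 0" "C3 > 0" "upper * nx > 0"
    using upper(1) nx N R by (auto simp: C1_def C3_def intro!: add_pos_pos)
  have ineq: "2 * \<sigma> * real q - e \<le> (1 + e) * (1 + (upper * nx) * (exp (- \<sigma> * R\<^sup>2 / 16) / (\<kappa> * exp (- \<sigma> * R\<^sup>2 / 64)))) *
        (2 * \<sigma> * real q - c0 / (upper * nx) + C1 * (exp (- \<sigma> * R\<^sup>2 / 16) / (\<kappa> * exp (- \<sigma> * R\<^sup>2 / 64))) +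
         e * (C3 / (\<kappa> * exp (- \<sigma> * R\<^sup>2 / 64))))"
    if \<sigma>: "0 < \<sigma>" and e: "0 < e" "e \<le> 1" "e < 2 * \<sigma> * real q" for \<sigma> e
  proof -
    \<comment> \<open>The index j depends on e, c' on j, and the mesh on all of these and \<sigma>;
      none of j, c' and the mesh survives in \<open>ineq\<close>.\<close>
    obtain j where j: "\<And>x v. x \<in> K \<Longrightarrow> v \<bullet> (g x *v v) \<le> (1 + e) * (v \<bullet> (gs j x *v v))"
      using monotone_metrics_uniform[OF g gs K e(1) mono lim] by blast
    interpret gj: C2_metric U "gs j" "Ps j" "Ss j" by (rule gs)
    obtain c' where c': "c' > 0" "\<And>x v. x \<in> K \<Longrightarrow> c' * (norm v)\<^sup>2 \<le> v \<bullet> (gs j x *v v)"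
      using gj.uniformly_positive[OF K] by blast
    interpret W: C2_metric U "g.wG \<sigma> x0" "g.wP \<sigma> x0" "g.wS \<sigma> x0" by (rule g.weighted)
    interpret Wj: C2_metric U "gj.wG \<sigma> x0" "gj.wP \<sigma> x0" "gj.wS \<sigma> x0" by (rule gj.weighted)
    obtain h1 where h1: "h1 > 0" "\<And>L h z. C2_lattice U (g.wG \<sigma> x0) (g.wP \<sigma> x0) (g.wS \<sigma> x0) L h z \<Longrightarrow> h < h1 \<Longrightarrow>
        (\<And>k. k \<in> lattice.X L \<Longrightarrow> lattice_point z h k \<in> K) \<Longrightarrow>
        C2_lattice.Bochner_close (g.wG \<sigma> x0) (g.wP \<sigma> x0) (g.wS \<sigma> x0) L h z e"
      using W.Bochner_uniform[OF K e(1)] by blast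
    \<comment> \<open>For \<open>gs j\<close> the error must be absorbed by coercivity and is
      therefore scaled by the least eigenvalue of the weighted metric. For g plain e suffices, since
      that error is compared with the number of grid points only.\<close>
    define \<epsilon> where "\<epsilon> = c' * exp (- \<sigma> * (real CARD('n) * R\<^sup>2)) * e"
    have "\<epsilon> > 0" using c'(1) e by (simp add: \<epsilon>_def)
    obtain h2 where h2: "h2 > 0" "\<And>L h z. C2_lattice U (gj.wG \<sigma> x0) (gj.wP \<sigma> x0) (gj.wS \<sigma> x0) L h z \<Longrightarrow> h < h2 \<Longrightarrow>
        (\<And>k. k \<in> lattice.X L \<Longrightarrow> lattice_point z h k \<in> K) \<Longrightarrow>
        C2_lattice.Bochner_close (gj.wG \<sigma> x0) (gj.wP \<sigma> x0) (gj.wS \<sigma> x0) L h z \<epsilon>"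
      using Wj.Bochner_uniform[OF K \<open>\<epsilon> > 0\<close>] by blast
    \<comment> \<open>The mesh is R / (8 n m), so a large m brings it below both thresholds.\<close>
    obtain m :: nat where m: "R / min h1 h2 < real m" using reals_Archimedean2 by blast
    have m1: "m \<ge> 1" using m R h1(1) h2(1) by (cases m) (auto simp: divide_less_0_iff not_less)
    interpret T: test_lattice U g P S x0 R \<sigma> m q \<xi> lower upper
      using R \<sigma> m1 cube \<xi> \<xi>_ne lower upper inK by unfold_locales auto
    have h_small: "T.h < min h1 h2"
    proof -
      have "R < min h1 h2 * real m" using m h1(1) h2(1) by (simp add: divide_less_eq mult.commute)
      also have "\<dots> \<le> min h1 h2 * (8 * real CARD('n) * real m)"
      proof (intro mult_left_mono)
        have "1 * real m \<le> 8 * real CARD('n) * real m" using T.n_pos by (intro mult_right_mono; linarith)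
        then show "real m \<le> 8 * real CARD('n) * real m" by simp
      qed (use h1(1) h2(1) in auto)
      finally show ?thesis
        using m1 T.n_pos unfolding T.h_def by (subst divide_less_eq) (auto simp: card_gt_0_iff)
    qed
    have XK: "lattice_point T.z T.h k \<in> K" if "k \<in> lattice.X T.L" for k
      using T.X_in_cube[OF that] inK by blast
    have closeA: "T.A.Bochner_close e"
      using h_small XK by (intro h1(2) T.A.C2_lattice_axioms) auto
    have Bj: "C2_lattice U (gj.wG \<sigma> x0) (gj.wP \<sigma> x0) (gj.wS \<sigma> x0) T.L T.h T.z"
      by unfold_locales (use T.X_in_cube cube in blast)
    have closeB: "C2_lattice.Bochner_close (gj.wG \<sigma> x0) (gj.wP \<sigma> x0) (gj.wS \<sigma> x0) T.L T.h T.z \<epsilon>"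
      using h_small XK by (intro h2(2) Bj) auto
    have le_j: "v \<bullet> (gs j x *v v) \<le> v \<bullet> (g x *v v)" if "x \<in> U" for x v
      using le[of j] that by (simp add: metric_le_def matrix_vector_mult_diff_rdistrib inner_diff_right)
    have key: "(2 * \<sigma> * real q - e) * (T.A.ip T.f T.\<alpha>)\<^sup>2 \<le> (1 + e) * T.A.ip T.f T.f * T.A.ip (T.A.\<delta> T.\<alpha>) (T.A.\<delta> T.\<alpha>)"
      by (rule T.comparison[OF gs q _ _ nonneg c'(1) _ closeB[unfolded \<epsilon>_def] e e(1)])
        (use le_j cube j c'(2) inK in auto)
    have constants_eq: "T.nxi = nx" "T.subsets = N" "T.\<kappa> = \<kappa>"
      by (simp_all add: T.nxi_def nx_def T.subsets_def N_def T.\<kappa>_def \<kappa>_def)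
    have Y0: "T.Y > 0"
    proof -
      have "(\<lambda>_. 0) \<in> T.grid.X" using T.L_ge by (simp add: T.grid.X_def)
      then show ?thesis unfolding T.Y_def by (auto simp: card_gt_0_iff)
    qed
    show ?thesis
    proof (rule final_estimate[where Y = T.Y and t = T.tail and F = "T.A.ip T.f T.f" and ?m1.0 = "T.A.ip T.f T.\<alpha>"
          and ?m2.0 = "T.A.ip T.\<alpha> T.\<alpha>" and Z = "T.A.ip (T.A.\<delta> T.\<alpha>) (T.A.\<delta> T.\<alpha>)"])
      show "\<kappa> * exp (- \<sigma> * R\<^sup>2 / 64) * T.Y \<le> T.A.ip T.\<alpha> T.\<alpha>" using T.ip_\<alpha>_ge by (simp only: constants_eq)
      moreover have "\<kappa> * exp (- \<sigma> * R\<^sup>2 / 64) * T.Y > 0" using \<kappa> Y0 by simp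
      ultimately show "T.A.ip T.\<alpha> T.\<alpha> > 0" by linarith
      show "T.A.ip T.\<alpha> T.\<alpha> \<le> T.A.ip T.f T.\<alpha>" by (rule T.ip_\<alpha>_le)
      show "T.A.ip T.f T.f \<le> T.A.ip T.\<alpha> T.\<alpha> + upper * nx * T.tail" using T.ip_f_f_le by (simp only: constants_eq)
      show "0 \<le> T.A.ip (T.A.\<delta> T.\<alpha>) (T.A.\<delta> T.\<alpha>)" by (rule T.A.ip_nonneg)
      show "T.A.ip (T.A.\<delta> T.\<alpha>) (T.A.\<delta> T.\<alpha>) \<le> (2 * \<sigma> * real q - c0 / (upper * nx)) * T.A.ip T.\<alpha> T.\<alpha> + C1 * T.tail + e * C3 * T.Y"
        using T.\<delta>_\<alpha>_le[OF closeA e(1) curv c0] by (simp only: constants_eq C1_def C3_def)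
      show "T.tail \<le> exp (- \<sigma> * R\<^sup>2 / 16) * T.Y" by (rule T.tail_le)
    qed (use key e C \<kappa> in auto)
  qed
  have "q > 0" using q by simp
  show False
    by (rule no_decay_inequality[OF _ \<kappa> R ineq]) (use c0 C \<open>q > 0\<close> in auto)
qed

theorem theorem1p2:
  fixes D :: "((real,'n::{finite,linorder}) vec) set"
    and gs :: "nat \<Rightarrow> (real,'n) vec \<Rightarrow> ((real,'r::finite) vec,'r) vec"
    and g :: "(real,'n) vec \<Rightarrow> real^'r^'r"
    and q :: nat
  assumes "open D" and "connected D"
    and "1 \<le> q" and "q \<le> CARD('n)"
    and "\<And>j. riem_metric D (gs j)" and "\<And>j. C2_on D (gs j)"
    and "\<And>j. nakano_q_semipos q D (gs j)"
    and "riem_metric D g" and "C2_on D g"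
    and "\<And>i j. i \<le> j \<Longrightarrow> metric_le D (gs i) (gs j)"
    and "\<And>j. metric_le D (gs j) g"
    and "\<And>x. x \<in> D \<Longrightarrow> (\<lambda>j. gs j x) \<longlonglongrightarrow> g x"
  shows "nakano_q_semipos q D g"
proof (rule ccontr)
  assume contra: "\<not> nakano_q_semipos q D g"
  have g: "C2_metric D g (\<lambda>i. pd i g) (\<lambda>i j. pd i (pd j g))"
    by (rule C2_metric_pd) fact+
  have gs: "C2_metric D (gs j) (\<lambda>i. pd i (gs j)) (\<lambda>i k. pd i (pd k (gs j)))" for j
    by (rule C2_metric_pd) fact+
  \<comment> \<open>Solving d u = f lowers the degree by one, and the constant 2 \<sigma> q gained
    from the weight is positive only for q >= 1.\<close>
  obtain p where q: "q = Suc p" using \<open>1 \<le> q\<close> by (cases q) auto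
  obtain x \<xi> where x: "x \<in> D" and \<xi>: "\<And>I. card I \<noteq> q \<Longrightarrow> \<xi> I = 0"
    and neg: "C2_metric.curv g (\<lambda>i. pd i g) (\<lambda>i j. pd i (pd j g)) x \<xi> < 0"
    using contra unfolding C2_metric.nakano_iff_curv[OF g] by (auto simp: not_le)
  have nonneg: "C2_metric.curv (gs j) (\<lambda>i. pd i (gs j)) (\<lambda>i k. pd i (pd k (gs j))) y a \<ge> 0"
    if "y \<in> D" "\<And>I. card I \<noteq> q \<Longrightarrow> a I = 0" for j y a
    using assms(7)[of j] that unfolding C2_metric.nakano_iff_curv[OF gs] by blast
  show False
    by (rule curvature_contradiction[OF g gs q assms(10,11,12) nonneg x \<xi> neg])
qed

end
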